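(* Let $k$ be a field and let $\Delta$ be a simplicial complex of dimension $d-1$. Then $\Delta$ is almost Cohen-Macaulay (over $k$) if and only if both of the following hold: (i) $\tilde H_i(\operatorname{lk}_\Delta F;k)=0$ for all $F\in\Delta\setminus\Delta(d-1)$ and all $i<\dim\operatorname{lk}_\Delta F$; and (ii) $\tilde H_i(\operatorname{lk}_\Delta F;k)=0$ for all $F\in\Delta(d-1)$ and all $i<\dim\operatorname{lk}_\Delta F-1$.
   Context: Simplicial complexes are on a finite vertex set $[n]$, and faces include $\emptyset$. For a simplicial complex $\Delta$ with Stanley-Reisner ideal $I_\Delta\subseteq R=k[x_1,\ldots,x_n]$ and Stanley-Reisner ring $k[\Delta]=R/I_\Delta$, $\Delta$ is called almost Cohen-Macaulay (aCM) if $\operatorname{depth} k[\Delta]\ge\dim k[\Delta]-1$ (depth with respect to the homogeneous maximal ideal). For $F\in\Delta$, $\operatorname{lk}_\Delta F=\{G\in\Delta\mid G\cap F=\emptyset,\ G\cup F\in\Delta\}$. $\Delta(d-1)$ denotes the pure $(d-1)$-th skeleton of $\Delta$: the pure subcomplex of $\Delta$ whose facets are the faces of $\Delta$ of cardinality $d$ (so $F\in\Delta(d-1)$ iff $F$ is contained in a face of cardinality $d$). $\tilde H_i(\,\cdot\,;k)$ is the $i$-th reduced simplicial homology with coefficients in $k$. The complex $\{\emptyset\}$ has dimension $-1$. *)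

theory Defs
  imports
    "HOL-Algebra.Algebra"
    "HOL-Library.Poly_Mapping"
    "HOL-Library.Extended_Nat"
begin

section \<open>Simplicial complexes on the vertex set \<open>{1..n}\<close>\<close>

(* The empty face is always present; singletons {i} need not be faces, so that links are again
   simplicial complexes on the same vertex set. *)
definition simplicial_complex :: "nat \<Rightarrow> nat set set \<Rightarrow> bool" where
  "simplicial_complex n \<Delta> \<longleftrightarrow>
     \<Delta> \<subseteq> Pow {1..n} \<and> {} \<in> \<Delta> \<and> (\<forall>F\<in>\<Delta>. \<forall>G. G \<subseteq> F \<longrightarrow> G \<in> \<Delta>)"

definition face_dim :: "nat set \<Rightarrow> int" where
  "face_dim F = int (card F) - 1"

definition complex_dim :: "nat set set \<Rightarrow> int" where
  "complex_dim \<Delta> = Max (face_dim ` \<Delta>)"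

definition link :: "nat set set \<Rightarrow> nat set \<Rightarrow> nat set set" where
  "link \<Delta> F = {G \<in> \<Delta>. G \<inter> F = {} \<and> G \<union> F \<in> \<Delta>}"

definition pure_skeleton :: "nat set set \<Rightarrow> int \<Rightarrow> nat set set" where
  "pure_skeleton \<Delta> j = {F \<in> \<Delta>. \<exists>G\<in>\<Delta>. face_dim G = j \<and> F \<subseteq> G}"


section \<open>Reduced simplicial homology with coefficients in a field\<close>

(* The augmented chain complex, in all integer degrees: degree -1 is spanned by the empty face
   and the lower degrees are zero. *)
definition simplicial_chains ::
    "'k::field itself \<Rightarrow> int \<Rightarrow> nat set set \<Rightarrow> (nat set \<Rightarrow>\<^sub>0 'k) set" where
  "simplicial_chains k i \<Delta> = {c. Poly_Mapping.keys c \<subseteq> {F \<in> \<Delta>. face_dim F = i}}"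

(* Faces are oriented by the order of the vertices: in F = {v_0 < ... < v_i} the vertex v_j has
   exactly j predecessors, so F - {v_j} gets the sign (-1)^j. *)
definition simplicial_boundary :: "(nat set \<Rightarrow>\<^sub>0 'k) \<Rightarrow> (nat set \<Rightarrow>\<^sub>0 'k::field)" where
  "simplicial_boundary c =
     (\<Sum>F\<in>Poly_Mapping.keys c. \<Sum>v\<in>F.
        Poly_Mapping.single (F - {v}) ((-1) ^ card {u\<in>F. u < v} * Poly_Mapping.lookup c F))"

definition cycle_group ::
    "'k::field itself \<Rightarrow> int \<Rightarrow> nat set set \<Rightarrow> (nat set \<Rightarrow>\<^sub>0 'k) monoid" where
  "cycle_group k i \<Delta> =
     \<lparr>carrier = {c \<in> simplicial_chains k i \<Delta>. simplicial_boundary c = 0}, monoid.mult = (+), one = 0\<rparr>"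

(* The underlying additive group of the i-th reduced homology vector space. *)
definition reduced_homology ::
    "'k::field itself \<Rightarrow> int \<Rightarrow> nat set set \<Rightarrow> (nat set \<Rightarrow>\<^sub>0 'k) set monoid" where
  "reduced_homology k i \<Delta> =
     cycle_group k i \<Delta> Mod (simplicial_boundary ` simplicial_chains k (i + 1) \<Delta>)"


section \<open>The Stanley--Reisner ring\<close>

(* Monomials are exponent vectors nat \<Rightarrow>\<^sub>0 nat, polynomials are finitely supported functions from
   monomials to coefficients; the ring k[x_1, ..., x_n] consists of those polynomials in which
   only the variables with index in {1..n} occur. *)
definition polynomial_ring ::
    "'k::field itself \<Rightarrow> nat \<Rightarrow> ((nat \<Rightarrow>\<^sub>0 nat) \<Rightarrow>\<^sub>0 'k) ring" where
  "polynomial_ring k n =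
     \<lparr>carrier = {p. \<forall>m\<in>Poly_Mapping.keys p. Poly_Mapping.keys m \<subseteq> {1..n}},
      monoid.mult = (*), one = 1, ring.zero = 0, add = (+)\<rparr>"

definition Var :: "'k::field itself \<Rightarrow> nat \<Rightarrow> ((nat \<Rightarrow>\<^sub>0 nat) \<Rightarrow>\<^sub>0 'k)" where
  "Var k i = Poly_Mapping.single (Poly_Mapping.single i 1) 1"

definition SR_ideal ::
    "'k::field itself \<Rightarrow> nat \<Rightarrow> nat set set \<Rightarrow> ((nat \<Rightarrow>\<^sub>0 nat) \<Rightarrow>\<^sub>0 'k) set" where
  "SR_ideal k n \<Delta> = genideal (polynomial_ring k n) {\<Prod>i\<in>F. Var k i | F. F \<subseteq> {1..n} \<and> F \<notin> \<Delta>}"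

definition SR_ring ::
    "'k::field itself \<Rightarrow> nat \<Rightarrow> nat set set \<Rightarrow> ((nat \<Rightarrow>\<^sub>0 nat) \<Rightarrow>\<^sub>0 'k) set ring" where
  "SR_ring k n \<Delta> = polynomial_ring k n Quot SR_ideal k n \<Delta>"

(* The homogeneous maximal ideal of the Stanley--Reisner ring, generated by the residue classes
   of the variables. *)
definition SR_max_ideal ::
    "'k::field itself \<Rightarrow> nat \<Rightarrow> nat set set \<Rightarrow> ((nat \<Rightarrow>\<^sub>0 nat) \<Rightarrow>\<^sub>0 'k) set set" where
  "SR_max_ideal k n \<Delta> =
     genideal (SR_ring k n \<Delta>)
       ((\<lambda>i. SR_ideal k n \<Delta> +>\<^bsub>polynomial_ring k n\<^esub> Var k i) ` {1..n})"


section \<open>Krull dimension and depth\<close>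

(* Supremum of the lengths m of chains P_0 < ... < P_m of prime ideals. *)
definition krull_dim :: "('a, 'b) ring_scheme \<Rightarrow> enat" where
  "krull_dim S =
     (SUP Ps \<in> {Ps. Ps \<noteq> [] \<and> (\<forall>P\<in>set Ps. primeideal P S) \<and> sorted_wrt (\<subset>) Ps}.
        enat (length Ps - 1))"

(* x_1, ..., x_r is S-regular: each x_i is a non-zero-divisor on S/(x_1, ..., x_{i-1}), and
   S/(x_1, ..., x_r) is not zero. *)
definition regular_sequence :: "('a, 'b) ring_scheme \<Rightarrow> 'a list \<Rightarrow> bool" where
  "regular_sequence S xs \<longleftrightarrow>
     set xs \<subseteq> carrier S \<and>
     (\<forall>i < length xs. \<forall>s\<in>carrier S.
        xs ! i \<otimes>\<^bsub>S\<^esub> s \<in> genideal S (set (take i xs)) \<longrightarrow> s \<in> genideal S (set (take i xs))) \<and>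
     genideal S (set xs) \<noteq> carrier S"

(* Depth of the ring S with respect to the ideal J. *)
definition depth :: "('a, 'b) ring_scheme \<Rightarrow> 'a set \<Rightarrow> enat" where
  "depth S J = (SUP xs \<in> {xs. set xs \<subseteq> J \<and> regular_sequence S xs}. enat (length xs))"

(* The inequality depth >= dim - 1, written without subtraction, which is truncated on enat. *)
definition almost_Cohen_Macaulay :: "'k::field itself \<Rightarrow> nat \<Rightarrow> nat set set \<Rightarrow> bool" where
  "almost_Cohen_Macaulay k n \<Delta> \<longleftrightarrow>
     krull_dim (SR_ring k n \<Delta>) \<le> depth (SR_ring k n \<Delta>) (SR_max_ideal k n \<Delta>) + 1"

end

theory Submission
  imports Defs
begin

text \<open>
  Write \<open>k[\<Delta>] = P / J\<close>, where \<open>P\<close> is the full polynomial ring and \<open>J\<close> is spanned by the monomials whose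
  support is not a face. Modulo a non-zero-divisor lying in the ideal of the variables, Koszul cohomology
  with respect to the variables shifts down by one degree, because that ideal annihilates it;
  hence a regular sequence of length \<open>r\<close> makes it vanish below \<open>r\<close>. Conversely, vanishing in degree \<open>0\<close>
  yields a non-zero-divisor by prime avoidance, and one iterates. The Koszul
  cohomology of \<open>k[\<Delta>]\<close> is multigraded: in a degree with a positive entry the complex is a cone, and in degree \<open>-1\<^sub>N\<close> it is the cochain complex of \<open>\<Delta>\<close> with the
  vertices in \<open>N\<close> deleted. The long exact sequence of a vertex, which relates a complex to its
  deletion and its link, trades vanishing for deletions against vanishing for links. So
  \<open>depth k[\<Delta>] \<ge> r\<close> iff the reduced homology of \<open>lk F\<close> vanishes below dimension \<open>r - |F| - 1\<close> for
  every face \<open>F\<close>.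

  For \<open>r = d - 1\<close> this differs from the stated conditions only at faces in no facet with \<open>d\<close> vertices. There
  the two agree once every facet has at least \<open>d - 1\<close> vertices, which follows from connectedness of links.
  Finally \<open>dim k[\<Delta>] = d\<close>: the Hilbert function bounds the number of elements of a chain of primes
  by forcing \<open>d + 1\<close> elements to be algebraically dependent, and such a dependence contradicts a
  chain of \<open>d + 2\<close> primes.
\<close>

text \<open>Ideals live in the ring type itself, with one variable for every natural number, so the
  algebra is done without carrier sets. A variable outside \<open>{1..n}\<close> has a non-face as
  support and thus belongs to \<open>J\<close>. The price is that the polynomial ring is not
  Noetherian: the chain condition has to be established for ideals above \<open>J\<close>.
  Cohomology is used instead of homology because a cochain is then an arbitrary function on sets,
  and restricting it to a deletion or a link costs nothing. Duality over the field returns to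
  homology at the end. Degrees count vertices, so degree \<open>c\<close> is dimension
  \<open>c - 1\<close> and the empty face has degree 0. Every vanishing statement concerns a whole
  initial range of degrees, because the exact sequences involved connect adjacent degrees. What
  stays bounded by \<open>r\<close> in all exchanges is the sum of the degree, the number of deleted
  vertices and the number of vertices whose link is taken.\<close>

abbreviation (input) "keys \<equiv> Poly_Mapping.keys"
abbreviation (input) "lookup \<equiv> Poly_Mapping.lookup"
abbreviation (input) "single \<equiv> Poly_Mapping.single"

type_synonym 'k mpoly = "(nat \<Rightarrow>\<^sub>0 nat) \<Rightarrow>\<^sub>0 'k"

section \<open>Alternating cochains and their contractions\<close>

text \<open>The sign with which \<open>simplicial_boundary\<close> removes \<open>v\<close> from
  \<open>W\<close>, polymorphic because it occurs both in the field and in the polynomial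
  ring.\<close>

definition inc_sign :: "nat \<Rightarrow> nat set \<Rightarrow> 'a::comm_ring_1" where
  "inc_sign v W = (-1) ^ card {u\<in>W. u < v}"

text \<open>Differential of the Koszul cochain complex of the elements \<open>x v\<close>; the
  constant family 1 gives the simplicial coboundary, so one calculus serves both complexes.\<close>

definition koszul_d :: "(nat \<Rightarrow> 'a::comm_ring_1) \<Rightarrow> (nat set \<Rightarrow> 'a) \<Rightarrow> nat set \<Rightarrow> 'a" where
  "koszul_d x u W = (\<Sum>v\<in>W. inc_sign v W * x v * u (W - {v}))"

abbreviation "coboundary \<equiv> koszul_d (\<lambda>_. 1)"

text \<open>Interior product with the basis vector of index \<open>g\<close>, a homotopy operator
  that lowers the degree by one.\<close>

definition contraction :: "nat \<Rightarrow> (nat set \<Rightarrow> 'a::comm_ring_1) \<Rightarrow> nat set \<Rightarrow> 'a" where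
  "contraction g u W = (if g \<in> W then 0 else inc_sign g (insert g W) * u (insert g W))"

lemma inc_sign_sq [simp]: "inc_sign v W * inc_sign v W = (1::'a::comm_ring_1)"
  unfolding inc_sign_def by (simp flip: power_add mult_2)

lemma inc_sign_sq_left [simp]: "inc_sign v W * (inc_sign v W * a) = (a::'a::comm_ring_1)"
  by (simp flip: mult.assoc)

lemma inc_sign_remove_greater: "v < w \<Longrightarrow> inc_sign v (W - {w}) = inc_sign v W"
  unfolding inc_sign_def by (rule arg_cong[where f="\<lambda>A. (-1) ^ card A"]) auto

lemma inc_sign_remove_less:
  assumes "finite W" "v \<in> W" "v < w"
  shows "inc_sign w W = - (inc_sign w (W - {v}) :: 'a::comm_ring_1)"
proof -
  have "{u\<in>W. u < w} = insert v {u\<in>W - {v}. u < w}" using assms by auto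
  then show ?thesis using assms unfolding inc_sign_def by simp
qed

text \<open>Removing the smaller vertex takes one predecessor away from the larger, while removing
  the larger does not affect the smaller: exactly one sign flips.\<close>

lemma inc_sign_swap:
  assumes "finite W" "v \<in> W" "w \<in> W" "v \<noteq> w"
  shows "inc_sign v W * inc_sign w (W - {v}) = - (inc_sign w W * inc_sign v (W - {w}) :: 'a::comm_ring_1)"
proof -
  have *: "inc_sign v W * inc_sign w (W - {v}) = - (inc_sign w W * inc_sign v (W - {w}) :: 'a)"
    if "v < w" "v \<in> W" "w \<in> W" for v w
    using inc_sign_remove_greater[OF that(1), of W, where 'a='a]
      inc_sign_remove_less[OF assms(1) that(2,1), where 'a='a] by (simp add: mult.commute)
  show ?thesis
  proof (cases "v < w")
    case True then show ?thesis using * assms by blast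
  next
    case False
    then have "w < v" using assms by simp
    then show ?thesis using *[of w v] assms by simp
  qed
qed

lemma koszul_d_add: "koszul_d x (\<lambda>W. u W + w W) W = koszul_d x u W + koszul_d x w W"
  unfolding koszul_d_def by (simp add: algebra_simps sum.distrib)

lemma koszul_d_diff: "koszul_d x (\<lambda>W. u W - w W) W = koszul_d x u W - koszul_d x w W"
  unfolding koszul_d_def by (simp add: algebra_simps sum_subtractf)

lemma koszul_d_scale: "koszul_d x (\<lambda>W. a * u W) W = a * koszul_d x u W"
  unfolding koszul_d_def by (simp add: sum_distrib_left ac_simps)

lemma koszul_d_cong:
  "(\<And>v. v \<in> W \<Longrightarrow> u (W - {v}) = w (W - {v})) \<Longrightarrow> koszul_d x u W = koszul_d x w W"
  unfolding koszul_d_def by (rule sum.cong) auto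

lemma koszul_d_d:
  assumes fin: "finite W"
  shows "koszul_d x (koszul_d x u) W = (0::'a::comm_ring_1)"
proof -
  define t where "t v w = inc_sign v W * inc_sign w (W - {v}) * (x v * x w) * u (W - {v} - {w})" for v w
  have anti: "t v w = - t w v" if "v \<in> W" "w \<in> W" "v \<noteq> w" for v w
  proof -
    have "W - {v} - {w} = W - {w} - {v}" by blast
    then show ?thesis
      using inc_sign_swap[OF fin that, where 'a='a] unfolding t_def
      by (metis (no_types, lifting) mult.commute mult_minus_left)
  qed
  let ?L = "{(v,w). v \<in> W \<and> w \<in> W \<and> v < w}" and ?G = "{(v,w). v \<in> W \<and> w \<in> W \<and> w < v}"
  have finLG: "finite ?L" "finite ?G"
    by (rule finite_subset[of _ "W \<times> W"]; use fin in auto)+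
  have "koszul_d x (koszul_d x u) W = (\<Sum>v\<in>W. \<Sum>w\<in>W - {v}. t v w)"
    unfolding koszul_d_def t_def by (simp add: sum_distrib_left ac_simps)
  also have "\<dots> = (\<Sum>(v,w)\<in>(SIGMA v:W. W - {v}). t v w)"
    using fin by (subst sum.Sigma) auto
  also have "(SIGMA v:W. W - {v}) = ?L \<union> ?G" by auto
  also have "(\<Sum>(v,w)\<in>?L \<union> ?G. t v w) = (\<Sum>(v,w)\<in>?L. t v w) + (\<Sum>(v,w)\<in>?G. t v w)"
    by (rule sum.union_disjoint[OF finLG]) auto
  also have "(\<Sum>(v,w)\<in>?G. t v w) = (\<Sum>(v,w)\<in>?L. t w v)"
    by (rule sum.reindex_bij_witness[of _ "\<lambda>(v,w). (w,v)" "\<lambda>(v,w). (w,v)"]) auto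
  also have "\<dots> = (\<Sum>(v,w)\<in>?L. - t v w)"
    by (rule sum.cong) (use anti in auto)
  finally show ?thesis by (simp add: sum_negf case_prod_unfold del: Collect_case_prod)
qed

text \<open>Cartan's formula. For \<open>g\<close> in \<open>W\<close> only the summand at
  \<open>g\<close> of the first term survives; otherwise the first term cancels all of the second
  except its summand at \<open>g\<close>. It shows that the \<open>x g\<close> annihilate Koszul
  cohomology and, for \<open>x = 1\<close>, that cones are acyclic.\<close>

lemma koszul_homotopy:
  assumes fin: "finite W"
  shows "koszul_d x (contraction g u) W + contraction g (koszul_d x u) W = x g * (u W :: 'a::comm_ring_1)"
proof (cases "g \<in> W")
  case True
  have "koszul_d x (contraction g u) W = (\<Sum>v\<in>{g}. inc_sign v W * x v * contraction g u (W - {v}))"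
    unfolding koszul_d_def by (rule sum.mono_neutral_right) (use fin True in \<open>auto simp: contraction_def\<close>)
  also have "\<dots> = x g * u W"
    using True by (simp add: contraction_def insert_absorb ac_simps)
  finally show ?thesis using True by (simp add: contraction_def)
next
  case False
  let ?W = "insert g W"
  have "contraction g (koszul_d x u) W = inc_sign g ?W * (\<Sum>v\<in>?W. inc_sign v ?W * x v * u (?W - {v}))"
    using False by (simp add: contraction_def koszul_d_def)
  also have "\<dots> = x g * u W + (\<Sum>v\<in>W. inc_sign g ?W * (inc_sign v ?W * x v * u (?W - {v})))"
    using False fin by (simp add: distrib_left sum_distrib_left ac_simps)
  also have "(\<Sum>v\<in>W. inc_sign g ?W * (inc_sign v ?W * x v * u (?W - {v})))
      = (\<Sum>v\<in>W. - (inc_sign v W * x v * contraction g u (W - {v})))"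
  proof (rule sum.cong[OF refl])
    fix v assume v: "v \<in> W"
    with False have vg: "v \<noteq> g" by auto
    have e: "insert g (W - {v}) = ?W - {v}" using vg by auto
    have e2: "?W - {g} = W" using False by auto
    have "inc_sign v ?W * inc_sign g (?W - {v}) = - (inc_sign g ?W * inc_sign v W :: 'a)"
      using inc_sign_swap[of ?W v g, where 'a='a] v vg fin e2 by auto
    then have "inc_sign g ?W * (inc_sign v ?W * inc_sign g (?W - {v})) * inc_sign g (?W - {v})
       = - (inc_sign g ?W * (inc_sign g ?W * inc_sign v W) * inc_sign g (?W - {v}) :: 'a)"
      by simp
    then have "inc_sign g ?W * inc_sign v ?W = - (inc_sign v W * inc_sign g (?W - {v}) :: 'a)"
      by (simp add: mult.assoc)
    then have "inc_sign g ?W * inc_sign v ?W * (x v * u (?W - {v}))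
        = - (inc_sign v W * inc_sign g (?W - {v})) * (x v * u (?W - {v}))" by simp
    then show "inc_sign g ?W * (inc_sign v ?W * x v * u (?W - {v}))
        = - (inc_sign v W * x v * contraction g u (W - {v}))"
      using vg False e by (simp add: contraction_def ac_simps)
  qed
  finally show ?thesis by (simp add: sum_negf koszul_d_def[of x "contraction g u" W])
qed

text \<open>
  Cochains are indexed by the cardinality \<open>c\<close> of the faces: this is the vanishing of the reduced
  cohomology in dimension \<open>c - 1\<close>. Values of a cochain outside \<open>\<Gamma>\<close> are junk.
\<close>

definition coh_zero :: "'k::field itself \<Rightarrow> nat set set \<Rightarrow> nat \<Rightarrow> bool" where
  "coh_zero k \<Gamma> c \<longleftrightarrow> (\<forall>\<phi>::nat set \<Rightarrow> 'k.
     (\<forall>F\<in>\<Gamma>. card F = Suc c \<longrightarrow> coboundary \<phi> F = 0) \<longrightarrow>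
     (\<exists>\<psi>. \<forall>F\<in>\<Gamma>. card F = c \<longrightarrow> \<phi> F = coboundary \<psi> F))"

lemma coh_zeroE:
  fixes \<phi> :: "nat set \<Rightarrow> 'k::field"
  assumes "coh_zero (k::'k itself) \<Gamma> c"
    and "\<And>F. F \<in> \<Gamma> \<Longrightarrow> card F = Suc c \<Longrightarrow> coboundary \<phi> F = 0"
  obtains \<psi> where "\<And>F. F \<in> \<Gamma> \<Longrightarrow> card F = c \<Longrightarrow> \<phi> F = coboundary \<psi> F"
proof -
  have "\<exists>\<psi>. \<forall>F\<in>\<Gamma>. card F = c \<longrightarrow> \<phi> F = coboundary \<psi> F"
    using assms(1)[unfolded coh_zero_def, rule_format, of \<phi>] assms(2) by blast
  then show thesis using that by blast
qed

section \<open>Deletion and link of a vertex\<close>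

definition deletion :: "nat set set \<Rightarrow> nat set \<Rightarrow> nat set set" where
  "deletion \<Delta> N = {F\<in>\<Delta>. F \<inter> N = {}}"

definition is_complex :: "nat set set \<Rightarrow> bool" where
  "is_complex \<Delta> \<longleftrightarrow> finite \<Delta> \<and> (\<forall>F\<in>\<Delta>. finite F \<and> (\<forall>G\<subseteq>F. G \<in> \<Delta>))"

text \<open>Exterior product with \<open>v\<close>: a cochain of the link of \<open>v\<close>
  becomes one supported on the faces through \<open>v\<close>. It anticommutes with the differential
  and raises the degree by one.\<close>

definition raise :: "nat \<Rightarrow> (nat set \<Rightarrow> 'a::comm_ring_1) \<Rightarrow> nat set \<Rightarrow> 'a" where
  "raise v \<phi> F = (if v \<in> F then inc_sign v F * \<phi> (F - {v}) else 0)"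

lemma koszul_d_raise_notin: "v \<notin> F \<Longrightarrow> koszul_d x (raise v \<phi>) F = 0"
  unfolding koszul_d_def raise_def by (auto intro: sum.neutral)

lemma koszul_d_raise_insert:
  fixes \<phi> :: "nat set \<Rightarrow> 'a::comm_ring_1"
  assumes "finite F" "v \<notin> F"
  shows "koszul_d x (raise v \<phi>) (insert v F) = - inc_sign v (insert v F) * koszul_d x \<phi> (F::nat set)"
proof -
  let ?F = "insert v F"
  have "koszul_d x (raise v \<phi>) ?F = (\<Sum>w\<in>F. inc_sign w ?F * x w * raise v \<phi> (?F - {w}))"
    using assms unfolding koszul_d_def by (simp add: raise_def)
  also have "\<dots> = (\<Sum>w\<in>F. - inc_sign v ?F * (inc_sign w F * x w * \<phi> (F - {w})))"
  proof (rule sum.cong[OF refl])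
    fix w assume w: "w \<in> F"
    then have vw: "w \<noteq> v" using assms by auto
    have e: "?F - {v} = F" "?F - {w} - {v} = F - {w}" using assms by auto
    have "inc_sign w ?F * inc_sign v (?F - {w}) = - (inc_sign v ?F * inc_sign w F :: 'a)"
      using inc_sign_swap[of ?F w v, where 'a='a] w vw assms e by auto
    then have "inc_sign w ?F * inc_sign v (?F - {w}) * (x w * \<phi> (F - {w}))
       = - (inc_sign v ?F * inc_sign w F) * (x w * \<phi> (F - {w}))" by (simp only:)
    then show "inc_sign w ?F * x w * raise v \<phi> (?F - {w}) = - inc_sign v ?F * (inc_sign w F * x w * \<phi> (F - {w}))"
      using vw e by (simp add: raise_def ac_simps)
  qed
  finally show ?thesis by (simp add: koszul_d_def sum_distrib_left)
qed

text \<open>Exactness of H^c(deletion) -> H^c(link) -> H^(c+1)(\<open>\<Gamma>\<close>), the second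
  map being \<open>raise v\<close>. If \<open>raise v \<phi>\<close> is the coboundary of
  \<open>\<chi>\<close>, contracting with \<open>v\<close> exhibits \<open>\<phi>\<close> as
  \<open>\<chi>\<close> minus a coboundary, and on the deletion \<open>\<chi>\<close> is a
  coboundary too.\<close>

lemma coh_zero_link_vertex:
  assumes cx: "is_complex \<Gamma>" and 1: "coh_zero k (deletion \<Gamma> {v}) c" and 2: "coh_zero k \<Gamma> (Suc c)"
  shows "coh_zero (k::'k::field itself) (link \<Gamma> {v}) c"
  unfolding coh_zero_def
proof (intro allI impI)
  fix \<phi> :: "nat set \<Rightarrow> 'k"
  assume cyc: "\<forall>F\<in>link \<Gamma> {v}. card F = Suc c \<longrightarrow> coboundary \<phi> F = 0"
  have "coboundary (raise v \<phi>) F = 0" if F: "F \<in> \<Gamma>" "card F = Suc (Suc c)" for F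
    proof (cases "v \<in> F")
      case True
      let ?G = "F - {v}"
      have fin: "finite F" and "?G \<in> \<Gamma>" using cx F unfolding is_complex_def by auto
      then have "?G \<in> link \<Gamma> {v}" "card ?G = Suc c" 
        using F True unfolding link_def by (auto simp: insert_absorb)
      then show ?thesis
        using cyc koszul_d_raise_insert[of ?G v "\<lambda>_. 1" \<phi>] fin True by (auto simp: insert_absorb)
    qed (simp add: koszul_d_raise_notin)
  then obtain \<chi> where \<chi>: "\<And>F. F \<in> \<Gamma> \<Longrightarrow> card F = Suc c \<Longrightarrow> raise v \<phi> F = coboundary \<chi> F"
    by (rule coh_zeroE[OF 2, of "raise v \<phi>"]) blast+
  \<comment> \<open>\<open>raise v \<phi>\<close> vanishes on the faces that avoid
    \<open>v\<close>.\<close>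
  have "coboundary \<chi> F = 0" if "F \<in> deletion \<Gamma> {v}" "card F = Suc c" for F
    using \<chi>[of F] that unfolding deletion_def raise_def by simp
  then obtain \<xi> where \<xi>: "\<And>F. F \<in> deletion \<Gamma> {v} \<Longrightarrow> card F = c \<Longrightarrow> \<chi> F = coboundary \<xi> F"
    by (rule coh_zeroE[OF 1, of \<chi>]) blast+
  show "\<exists>\<psi>. \<forall>F\<in>link \<Gamma> {v}. card F = c \<longrightarrow> \<phi> F = coboundary \<psi> F"
  proof (intro exI ballI impI)
    fix F assume F: "F \<in> link \<Gamma> {v}" "card F = c"
    have fin: "finite F" and vF: "v \<notin> F" and FG: "F \<in> \<Gamma>" "insert v F \<in> \<Gamma>"
      using F cx unfolding link_def is_complex_def by auto
    have "raise v \<phi> (insert v F) = coboundary \<chi> (insert v F)"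
      using \<chi> FG F fin vF by simp
    then have r: "\<phi> F = inc_sign v (insert v F) * coboundary \<chi> (insert v F)"
      using vF unfolding raise_def by (metis Diff_insert_absorb insertI1 inc_sign_sq_left)
    have "contraction v (coboundary \<chi>) F = \<phi> F"
      using vF r by (simp add: contraction_def)
    then have "coboundary (contraction v \<chi>) F + \<phi> F = \<chi> F"
      using koszul_homotopy[OF fin, of "\<lambda>_. 1" v \<chi>] by simp
    moreover have "\<chi> F = coboundary \<xi> F"
      using \<xi> F FG vF unfolding deletion_def by auto
    ultimately show "\<phi> F = coboundary (\<lambda>G. \<xi> G - contraction v \<chi> G) F"
      by (simp add: koszul_d_diff algebra_simps)
  qed
qed

text \<open>Exactness of H^c(\<open>\<Gamma>\<close>) -> H^c(deletion) -> H^c(link): a cocycle of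
  the deletion extends over the faces through \<open>v\<close> once its restriction to the link is a
  coboundary.\<close>

lemma coh_zero_deletion_vertex:
  assumes cx: "is_complex \<Gamma>" and 1: "coh_zero k (link \<Gamma> {v}) c" and 2: "coh_zero k \<Gamma> c"
  shows "coh_zero (k::'k::field itself) (deletion \<Gamma> {v}) c"
  unfolding coh_zero_def
proof (intro allI impI)
  fix \<phi> :: "nat set \<Rightarrow> 'k"
  assume cyc: "\<forall>F\<in>deletion \<Gamma> {v}. card F = Suc c \<longrightarrow> coboundary \<phi> F = 0"
  have lk: "link \<Gamma> {v} \<subseteq> deletion \<Gamma> {v}" unfolding link_def deletion_def by auto
  obtain \<psi> where \<psi>: "\<And>F. F \<in> link \<Gamma> {v} \<Longrightarrow> card F = c \<Longrightarrow> \<phi> F = coboundary \<psi> F"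
    by (rule coh_zeroE[OF 1, of \<phi>]) (use cyc lk in blast)+
  define \<phi>' where "\<phi>' F = (if v \<in> F then 0 else \<phi> F)" for F
  \<comment> \<open>On a face through \<open>v\<close>, the coboundary of the extension by zero is,
    up to sign, the value of \<open>\<phi>\<close> on the opposite face in the link;
    \<open>raise v \<psi>\<close> cancels exactly this.\<close>
  have "coboundary (\<lambda>F. \<phi>' F + raise v \<psi> F) F = 0" if F: "F \<in> \<Gamma>" "card F = Suc c" for F
  proof -
    have fin: "finite F" using cx F unfolding is_complex_def by auto
    show "coboundary (\<lambda>F. \<phi>' F + raise v \<psi> F) F = 0"
    proof (cases "v \<in> F")
      case True
      let ?G = "F - {v}"
      have "?G \<in> \<Gamma>" using cx F unfolding is_complex_def by auto
      then have "?G \<in> link \<Gamma> {v}" "card ?G = c" 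
        using F True fin unfolding link_def by (auto simp: insert_absorb)
      then have "coboundary (raise v \<psi>) F = - inc_sign v F * \<phi> ?G"
        using \<psi> koszul_d_raise_insert[of ?G v "\<lambda>_. 1" \<psi>] fin True by (auto simp: insert_absorb)
      moreover have "coboundary \<phi>' F = (\<Sum>w\<in>{v}. inc_sign w F * 1 * \<phi>' (F - {w}))"
        unfolding koszul_d_def by (rule sum.mono_neutral_right) (use fin True in \<open>auto simp: \<phi>'_def\<close>)
      moreover have "\<phi>' (F - {v}) = \<phi> (F - {v})" by (simp add: \<phi>'_def)
      ultimately show ?thesis by (simp add: koszul_d_add)
    next
      case False
      then have "coboundary \<phi>' F = coboundary \<phi> F"
        by (intro koszul_d_cong) (auto simp: \<phi>'_def)
      then show ?thesis using False cyc F
        by (simp add: koszul_d_add koszul_d_raise_notin deletion_def)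
    qed
  qed
  then obtain \<chi> where \<chi>: "\<And>F. F \<in> \<Gamma> \<Longrightarrow> card F = c \<Longrightarrow> \<phi>' F + raise v \<psi> F = coboundary \<chi> F"
    by (rule coh_zeroE[OF 2, of "\<lambda>F. \<phi>' F + raise v \<psi> F"]) blast+
  show "\<exists>\<psi>. \<forall>F\<in>deletion \<Gamma> {v}. card F = c \<longrightarrow> \<phi> F = coboundary \<psi> F"
  proof (intro exI ballI impI)
    fix F assume F: "F \<in> deletion \<Gamma> {v}" "card F = c"
    then show "\<phi> F = coboundary \<chi> F"
      using \<chi>[of F] unfolding deletion_def \<phi>'_def raise_def by auto
  qed
qed

lemma is_complex_link: "is_complex \<Delta> \<Longrightarrow> is_complex (link \<Delta> F)"
  unfolding is_complex_def link_def
  by (auto intro: finite_subset) (metis Un_mono order_refl)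

lemma is_complex_deletion: "is_complex \<Delta> \<Longrightarrow> is_complex (deletion \<Delta> N)"
  unfolding is_complex_def deletion_def
  by (auto intro: finite_subset)

lemma link_deletion_link:
  assumes cx: "is_complex \<Delta>" and v: "v \<notin> F" "v \<notin> N"
  shows "link (deletion (link \<Delta> F) N) {v} = deletion (link \<Delta> (insert v F)) N"
proof -
  have "G \<union> F \<in> \<Delta>" "insert v G \<in> \<Delta>" if G: "G \<union> insert v F \<in> \<Delta>" for G
  proof -
    have "H \<in> \<Delta>" if "H \<subseteq> G \<union> insert v F" for H using G cx that unfolding is_complex_def by blast
    then show "G \<union> F \<in> \<Delta>" "insert v G \<in> \<Delta>" by auto
  qed
  then show ?thesis using v unfolding deletion_def link_def by auto
qed

text \<open>Both inductions run through the mixed complexes, where \<open>N\<close> is deleted from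
  the link of \<open>F\<close>, and keep \<open>c + card F + card N\<close> below \<open>r\<close>.
  Deleting one more vertex uses its link in the same degree; passing to its link uses its deletion
  in the same degree and the complex itself one degree higher.\<close>

lemma coh_zero_links_iff_deletions:
  assumes cx: "is_complex \<Delta>" and V: "\<Union>\<Delta> \<subseteq> V" "finite V"
  shows "(\<forall>F\<in>\<Delta>. \<forall>c. c + card F < r \<longrightarrow> coh_zero k (link \<Delta> F) c) \<longleftrightarrow>
         (\<forall>N\<subseteq>V. \<forall>c. c + card N < r \<longrightarrow> coh_zero (k::'k::field itself) (deletion \<Delta> N) c)"
    (is "?L \<longleftrightarrow> ?D")
proof
  assume L: ?L
  have "\<forall>F\<in>\<Delta>. \<forall>c. c + card F + card N < r \<longrightarrow> coh_zero k (deletion (link \<Delta> F) N) c" if "finite N" for N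
    using that
  proof (induction N)
    case empty
    then show ?case using L by (simp add: deletion_def)
  next
    case (insert v N)
    show ?case
    proof (intro ballI allI impI)
      fix F c assume F: "F \<in> \<Delta>" and c: "c + card F + card (insert v N) < r"
      let ?\<Gamma> = "deletion (link \<Delta> F) N"
      have G: "is_complex ?\<Gamma>" using cx is_complex_link is_complex_deletion by blast
      have del: "deletion ?\<Gamma> {v} = deletion (link \<Delta> F) (insert v N)"
        unfolding deletion_def by auto
      have c': "c + card F + card N < r" using c insert.hyps by simp
      then have G0: "coh_zero k ?\<Gamma> c" using insert.IH F by blast
      show "coh_zero k (deletion (link \<Delta> F) (insert v N)) c"
      proof (cases "{v} \<in> ?\<Gamma>")
        case True
        then have v: "v \<notin> F" "insert v F \<in> \<Delta>" unfolding deletion_def link_def by auto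
        have vN: "v \<notin> N" using insert.hyps by simp
        have finF: "finite F" using F cx unfolding is_complex_def by auto
        have "link ?\<Gamma> {v} = deletion (link \<Delta> (insert v F)) N"
          by (rule link_deletion_link[OF cx v(1) vN])
        moreover have "coh_zero k (deletion (link \<Delta> (insert v F)) N) c"
          using insert.IH v c finF insert.hyps by auto
        ultimately show ?thesis
          using coh_zero_deletion_vertex[OF G _ G0, of v] del by simp
      next
        case False
        then have "deletion ?\<Gamma> {v} = ?\<Gamma>"
          using G unfolding deletion_def[of _ "{v}"] is_complex_def by auto
        then show ?thesis using G0 del by simp
      qed
    qed
  qed
  note B = this
  show ?D
  proof (intro allI impI)
    fix N c assume "N \<subseteq> V" "c + card N < r"
    then have *: "coh_zero k (deletion (link \<Delta> {}) N) c" if "{} \<in> \<Delta>"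
      using B[of N] V(2) finite_subset that by fastforce
    show "coh_zero k (deletion \<Delta> N) c"
    proof (cases "{} \<in> \<Delta>")
      case True
      moreover have "link \<Delta> {} = \<Delta>" by (auto simp: link_def)
      ultimately show ?thesis using * by simp
    next
      case False
      then have "\<Delta> = {}" using cx unfolding is_complex_def by blast
      then show ?thesis by (simp add: coh_zero_def deletion_def)
    qed
  qed
next
  assume D: ?D
  have "\<forall>N\<subseteq>V. \<forall>c. N \<inter> F = {} \<longrightarrow> c + card F + card N < r \<longrightarrow> coh_zero k (deletion (link \<Delta> F) N) c" 
    if "finite F" "F \<in> \<Delta>" for F
    using that
  proof (induction F)
    case empty
    then show ?case using D by (simp add: link_def)
  next
    case (insert v F)
    have FD: "F \<in> \<Delta>" using insert.prems cx unfolding is_complex_def by blast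
    show ?case
    proof (intro allI impI)
      fix N c assume N: "N \<subseteq> V" "N \<inter> insert v F = {}" and c: "c + card (insert v F) + card N < r"
      let ?\<Gamma> = "deletion (link \<Delta> F) N"
      have finN: "finite N" using N V finite_subset by blast
      have G: "is_complex ?\<Gamma>" using cx is_complex_link is_complex_deletion by blast
      have "v \<in> V" using insert.prems V by auto
      then have "coh_zero k (deletion (link \<Delta> F) (insert v N)) c"
        using insert.IH[OF FD] N c finN insert.hyps by auto
      moreover have "deletion ?\<Gamma> {v} = deletion (link \<Delta> F) (insert v N)"
        unfolding deletion_def by auto
      moreover have "coh_zero k ?\<Gamma> (Suc c)"
        using insert.IH[OF FD] N c finN insert.hyps by auto
      ultimately have "coh_zero k (link ?\<Gamma> {v}) c"
        using coh_zero_link_vertex[OF G, of k v c] by simp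
      moreover have "link ?\<Gamma> {v} = deletion (link \<Delta> (insert v F)) N"
        by (rule link_deletion_link[OF cx]) (use insert.hyps N in auto)
      ultimately show "coh_zero k (deletion (link \<Delta> (insert v F)) N) c" by simp
    qed
  qed
  note B = this
  show ?L
  proof (intro ballI allI impI)
    fix F c assume F: "F \<in> \<Delta>" "c + card F < r"
    have "deletion (link \<Delta> F) {} = link \<Delta> F" by (simp add: deletion_def)
    then show "coh_zero k (link \<Delta> F) c"
      using B[of F] F cx V unfolding is_complex_def by (metis Int_empty_left add.right_neutral card.empty empty_subsetI)
  qed
qed

section \<open>Homology and cohomology over a field\<close>

text \<open>Induction on the rows. If the new row vanishes on the kernel of the others, it receives
  coefficient 0; otherwise evaluation at a kernel vector \<open>y0\<close> on which it does not
  vanish forces its coefficient \<open>r\<close>.\<close>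

lemma fredholm_alternative:
  fixes M :: "'r \<Rightarrow> 'c \<Rightarrow> 'k::field"
  assumes "finite A" and fB: "finite B"
    and "\<And>y. (\<And>a. a \<in> A \<Longrightarrow> (\<Sum>b\<in>B. M a b * y b) = 0) \<Longrightarrow> (\<Sum>b\<in>B. t b * y b) = 0"
  shows "\<exists>x. \<forall>b\<in>B. (\<Sum>a\<in>A. x a * M a b) = t b"
  using assms(1,3)
proof (induction A arbitrary: t)
  case empty
  have "t b = 0" if "b \<in> B" for b
  proof -
    have "(\<Sum>c\<in>B. t c * (if c = b then 1 else 0)) = 0" by (rule empty) simp
    then show ?thesis using fB that by (simp add: if_distrib[of "\<lambda>x. _ * x"] cong: if_cong)
  qed
  then show ?case by simp
next
  case (insert m A)
  show ?case
  proof (cases "\<exists>y. (\<forall>a\<in>A. (\<Sum>b\<in>B. M a b * y b) = 0) \<and> (\<Sum>b\<in>B. M m b * y b) \<noteq> 0")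
    case False
    then have "(\<Sum>b\<in>B. t b * y b) = 0" if "\<And>a. a \<in> A \<Longrightarrow> (\<Sum>b\<in>B. M a b * y b) = 0" for y
      using insert.prems[of y] that by (metis insertE)
    then obtain x where x: "\<forall>b\<in>B. (\<Sum>a\<in>A. x a * M a b) = t b"
      using insert.IH[of t] by blast
    have "(\<Sum>a\<in>insert m A. (x(m := 0)) a * M a b) = (\<Sum>a\<in>A. x a * M a b)" for b
      using insert.hyps by (simp add: fun_upd_def) (rule sum.cong, auto)
    then show ?thesis using x by (intro exI[of _ "x(m := 0)"]) simp
  next
    case True
    then obtain y0 where y0: "\<And>a. a \<in> A \<Longrightarrow> (\<Sum>b\<in>B. M a b * y0 b) = 0" "(\<Sum>b\<in>B. M m b * y0 b) \<noteq> 0" by blast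
    define r where "r = (\<Sum>b\<in>B. t b * y0 b) / (\<Sum>b\<in>B. M m b * y0 b)"
    have "(\<Sum>b\<in>B. (t b - r * M m b) * y b) = 0"
      if y: "\<And>a. a \<in> A \<Longrightarrow> (\<Sum>b\<in>B. M a b * y b) = 0" for y
    proof -
      \<comment> \<open>With this \<open>q\<close>, the vector \<open>y - q * y0\<close> is in the
        kernel of all rows, including the new one.\<close>
      define q where "q = (\<Sum>b\<in>B. M m b * y b) / (\<Sum>b\<in>B. M m b * y0 b)"
      have lin: "(\<Sum>b\<in>B. h b * (y b - q * y0 b)) = (\<Sum>b\<in>B. h b * y b) - q * (\<Sum>b\<in>B. h b * y0 b)" for h
        by (simp add: algebra_simps sum_subtractf sum_distrib_left)
      have "(\<Sum>b\<in>B. t b * (y b - q * y0 b)) = 0"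
      proof (rule insert.prems)
        fix a assume "a \<in> insert m A"
        then show "(\<Sum>b\<in>B. M a b * (y b - q * y0 b)) = 0"
          unfolding lin using y y0 by (auto simp: q_def)
      qed
      then have "(\<Sum>b\<in>B. t b * y b) = q * (\<Sum>b\<in>B. t b * y0 b)" unfolding lin by simp
      moreover have "q * (\<Sum>b\<in>B. t b * y0 b) = r * (\<Sum>b\<in>B. M m b * y b)"
        by (simp add: q_def r_def)
      moreover have "(\<Sum>b\<in>B. (t b - r * M m b) * y b) = (\<Sum>b\<in>B. t b * y b) - r * (\<Sum>b\<in>B. M m b * y b)"
        by (simp add: algebra_simps sum_subtractf sum_distrib_left)
      ultimately show ?thesis by simp
    qed
    then obtain x where x: "\<forall>b\<in>B. (\<Sum>a\<in>A. x a * M a b) = t b - r * M m b"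
      using insert.IH[of "\<lambda>b. t b - r * M m b"] by blast
    have "(\<Sum>a\<in>insert m A. (x(m := r)) a * M a b) = r * M m b + (\<Sum>a\<in>A. x a * M a b)" for b
      using insert.hyps by (simp add: fun_upd_def) (rule sum.cong, auto)
    then show ?thesis using x by (intro exI[of _ "x(m := r)"]) simp
  qed
qed

abbreviation faces :: "nat set set \<Rightarrow> nat \<Rightarrow> nat set set" where
  "faces \<Gamma> c \<equiv> {F\<in>\<Gamma>. card F = c}"

definition pairing :: "('a \<Rightarrow> 'k::comm_ring_1) \<Rightarrow> ('a \<Rightarrow>\<^sub>0 'k) \<Rightarrow> 'k" where
  "pairing \<phi> p = (\<Sum>F\<in>keys p. \<phi> F * lookup p F)"

lemma pairing_superset:
  "finite A \<Longrightarrow> keys p \<subseteq> A \<Longrightarrow> pairing \<phi> p = (\<Sum>F\<in>A. \<phi> F * lookup p F)"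
  unfolding pairing_def by (rule sum.mono_neutral_left) (auto simp: in_keys_iff)

lemma pairing_add: "pairing \<phi> (p + q) = pairing \<phi> p + pairing \<phi> q"
proof -
  let ?A = "keys p \<union> keys q"
  have "keys (p + q) \<subseteq> ?A" by (rule Poly_Mapping.keys_add)
  then show ?thesis
    by (simp add: pairing_superset[of ?A] lookup_add distrib_left sum.distrib)
qed

lemma pairing_zero [simp]: "pairing \<phi> 0 = 0"
  by (simp add: pairing_def)

lemma pairing_sum: "pairing \<phi> (sum f A) = (\<Sum>a\<in>A. pairing \<phi> (f a))"
  by (induction A rule: infinite_finite_induct) (auto simp: pairing_add)

lemma pairing_uminus: "pairing \<phi> (- p) = - pairing \<phi> p"
  using pairing_add[of \<phi> p "- p"] by (simp add: eq_neg_iff_add_eq_0 add.commute)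

lemma pairing_single [simp]: "pairing \<phi> (single F a) = \<phi> F * a"
  by (simp add: pairing_def)

lemma pairing_boundary:
  "pairing \<phi> (simplicial_boundary p) = pairing (coboundary \<phi>) p"
  unfolding simplicial_boundary_def pairing_sum pairing_single pairing_def[of _ p] koszul_d_def
  by (simp add: sum_distrib_right sum_distrib_left inc_sign_def ac_simps)

lemma pairing_indicator: "pairing (\<lambda>G. if G = F then 1 else 0) p = lookup p F"
proof -
  let ?A = "insert F (keys p)"
  have "pairing (\<lambda>G. if G = F then 1 else 0) p = (\<Sum>G\<in>?A. (if G = F then 1 else 0) * lookup p G)"
    by (rule pairing_superset) auto
  then show ?thesis by (simp add: if_distrib[of "\<lambda>x. x * _"] cong: if_cong)
qed

text \<open>Cochains separate chains, so identities for the boundary follow from those for its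
  adjoint, the coboundary.\<close>

lemma poly_mapping_pairing_eqI: "(\<And>\<phi>. pairing \<phi> p = pairing \<phi> q) \<Longrightarrow> p = q"
  using pairing_indicator by (metis poly_mapping_eqI)

lemma simplicial_boundary_add:
  "simplicial_boundary (p + q) = simplicial_boundary p + simplicial_boundary q"
  by (rule poly_mapping_pairing_eqI) (simp add: pairing_add pairing_boundary)

lemma simplicial_boundary_uminus: "simplicial_boundary (- p) = - simplicial_boundary p"
  by (rule poly_mapping_pairing_eqI) (simp add: pairing_uminus pairing_boundary)

lemma simplicial_boundary_zero: "simplicial_boundary 0 = 0"
  by (simp add: simplicial_boundary_def)

lemma image_eq_singleton_iff: "z \<in> Z \<Longrightarrow> f ` Z = {b} \<longleftrightarrow> (\<forall>z\<in>Z. f z = b)"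
  by auto

lemma trivial_reduced_homology_iff:
  "trivial_group (reduced_homology k i \<Gamma>) \<longleftrightarrow>
   (\<forall>z\<in>simplicial_chains k i \<Gamma>. simplicial_boundary z = 0 \<longrightarrow>
      z \<in> simplicial_boundary ` simplicial_chains k (i + 1) \<Gamma>)"
proof -
  define B where "B = simplicial_boundary ` simplicial_chains k (i + 1) \<Gamma>"
  let ?H = "reduced_homology k i \<Gamma>"
  have add: "p + q \<in> B" if pq: "p \<in> B" "q \<in> B" for p q
  proof -
    obtain a b where "a \<in> simplicial_chains k (i + 1) \<Gamma>" "b \<in> simplicial_chains k (i + 1) \<Gamma>"
      "p = simplicial_boundary a" "q = simplicial_boundary b" using pq unfolding B_def by blast
    moreover from this have "a + b \<in> simplicial_chains k (i + 1) \<Gamma>"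
      unfolding simplicial_chains_def using Poly_Mapping.keys_add[of a b] by blast
    ultimately show ?thesis unfolding B_def by (metis simplicial_boundary_add image_eqI)
  qed
  have neg: "- p \<in> B" if p: "p \<in> B" for p
  proof -
    obtain a where "a \<in> simplicial_chains k (i + 1) \<Gamma>" "p = simplicial_boundary a"
      using p unfolding B_def by blast
    moreover from this have "- a \<in> simplicial_chains k (i + 1) \<Gamma>"
      unfolding simplicial_chains_def by (simp add: keys.rep_eq)
    ultimately show ?thesis unfolding B_def by (metis simplicial_boundary_uminus image_eqI)
  qed
  have zero: "0 \<in> B"
    unfolding B_def by (rule image_eqI[of _ _ 0]) (auto simp: simplicial_boundary_zero simplicial_chains_def)
  have car: "carrier ?H = (\<lambda>z. (\<lambda>b. b + z) ` B) ` {z\<in>simplicial_chains k i \<Gamma>. simplicial_boundary z = 0}"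
    unfolding reduced_homology_def FactGroup_def RCOSETS_def cycle_group_def r_coset_def B_def by auto
  have one: "one ?H = B" by (simp add: reduced_homology_def FactGroup_def B_def)
  \<comment> \<open>\<open>trivial_group\<close> includes the group axioms; for a carrier consisting
    of the coset \<open>B\<close> alone they are checked directly.\<close>
  have triv: "trivial_group ?H \<longleftrightarrow> carrier ?H = {B}"
  proof
    assume c: "carrier ?H = {B}"
    have m: "B \<otimes>\<^bsub>?H\<^esub> B = B"
    proof -
      have "B \<otimes>\<^bsub>?H\<^esub> B = (\<Union>a\<in>B. \<Union>b\<in>B. {a + b})"
        by (simp add: reduced_homology_def FactGroup_def cycle_group_def set_mult_def flip: B_def)
      also have "\<dots> = B"
      proof (intro subset_antisym subsetI)
        fix x assume "x \<in> B"
        moreover have "x = x + 0" by simp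
        ultimately show "x \<in> (\<Union>a\<in>B. \<Union>b\<in>B. {a + b})" using zero by blast
      qed (use add in blast)
      finally show ?thesis .
    qed
    have "group ?H" by (rule groupI) (use c m one in auto)
    then show "trivial_group ?H" using c one by (simp add: trivial_group_def)
  qed (simp add: trivial_group_def one)
  have coset: "(\<lambda>b. b + z) ` B = B \<longleftrightarrow> z \<in> B" for z
  proof
    assume "(\<lambda>b. b + z) ` B = B" then show "z \<in> B" using zero by (metis add_0 image_eqI)
  next
    assume z: "z \<in> B"
    show "(\<lambda>b. b + z) ` B = B"
    proof (intro subset_antisym subsetI)
      fix x assume "x \<in> B"
      then have "x + (- z) \<in> B" using z add neg by blast
      then show "x \<in> (\<lambda>b. b + z) ` B" by (rule rev_image_eqI) simp
    qed (use add z in blast)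
  qed
  have ne: "0 \<in> {z\<in>simplicial_chains k i \<Gamma>. simplicial_boundary z = 0}"
    by (simp add: simplicial_chains_def simplicial_boundary_zero)
  show ?thesis
    unfolding triv car B_def[symmetric] image_eq_singleton_iff[OF ne] coset by blast
qed

definition poly_mapping_on :: "'a set \<Rightarrow> ('a \<Rightarrow> 'k::zero) \<Rightarrow> 'a \<Rightarrow>\<^sub>0 'k" where
  "poly_mapping_on A f = Abs_poly_mapping (\<lambda>x. if x \<in> A then f x else 0)"

lemma lookup_poly_mapping_on:
  assumes "finite A"
  shows "lookup (poly_mapping_on A f) x = (if x \<in> A then f x else 0)"
proof -
  have "finite {x. (if x \<in> A then f x else 0) \<noteq> 0}"
    by (rule finite_subset[OF _ assms]) auto
  then show ?thesis unfolding poly_mapping_on_def by simp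
qed

lemma keys_poly_mapping_on: "finite A \<Longrightarrow> keys (poly_mapping_on A f) \<subseteq> A"
  by (auto simp: in_keys_iff lookup_poly_mapping_on split: if_splits)

lemma pairing_poly_mapping_on: "finite A \<Longrightarrow> pairing \<phi> (poly_mapping_on A f) = (\<Sum>x\<in>A. \<phi> x * f x)"
  by (simp add: pairing_superset[OF _ keys_poly_mapping_on] lookup_poly_mapping_on)

text \<open>Matrix of the coboundary: \<open>incidence G F\<close> is a sign if \<open>F\<close>
  arises from \<open>G\<close> by adding a vertex, and 0 otherwise.\<close>

definition incidence :: "nat set \<Rightarrow> nat set \<Rightarrow> 'a::comm_ring_1" where
  "incidence F = coboundary (\<lambda>G. if G = F then 1 else 0)"

lemma sum_incidence:
  fixes \<psi> :: "nat set \<Rightarrow> 'a::comm_ring_1"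
  assumes "finite A" "finite F" "\<And>v. v \<in> F \<Longrightarrow> F - {v} \<in> A"
  shows "(\<Sum>G\<in>A. \<psi> G * incidence G F) = coboundary \<psi> F"
proof -
  have "(\<Sum>G\<in>A. \<psi> G * incidence G F) = (\<Sum>v\<in>F. \<Sum>G\<in>A. \<psi> G * (inc_sign v F * (if F - {v} = G then 1 else 0)))"
    unfolding incidence_def koszul_d_def sum_distrib_left by (subst sum.swap) simp
  also have "\<dots> = (\<Sum>v\<in>F. inc_sign v F * \<psi> (F - {v}))"
    by (rule sum.cong[OF refl]) (use assms in \<open>simp add: if_distrib[of "\<lambda>x. _ * x"] mult.commute cong: if_cong\<close>)
  finally show ?thesis by (simp add: koszul_d_def)
qed

text \<open>Boundary and coboundary have transposed matrices, and over a field
  \<open>fredholm_alternative\<close> carries exactness from one to the other in both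
  directions.\<close>

lemma trivial_homology_iff_coh_zero:
  fixes k :: "'k::field itself"
  assumes cx: "is_complex \<Gamma>"
  shows "trivial_group (reduced_homology k (int c - 1) \<Gamma>) \<longleftrightarrow> coh_zero k \<Gamma> c"
proof -
  have fin: "finite (faces \<Gamma> c)" "finite (faces \<Gamma> (Suc c))" for c using cx unfolding is_complex_def by auto
  have chains: "p \<in> simplicial_chains k (int c - 1) \<Gamma> \<longleftrightarrow> keys p \<subseteq> faces \<Gamma> c" for p c
    unfolding simplicial_chains_def face_dim_def by auto
  have chains': "p \<in> simplicial_chains k (int c) \<Gamma> \<longleftrightarrow> keys p \<subseteq> faces \<Gamma> (Suc c)" for p c
    using chains[of p "Suc c"] by simp
  have del: "F - {v} \<in> faces \<Gamma> c" if "F \<in> faces \<Gamma> (Suc c)" "v \<in> F" for F v c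
    using that cx unfolding is_complex_def by auto
  have finF: "finite F" if "F \<in> \<Gamma>" for F using cx that unfolding is_complex_def by auto
  have bdry: "simplicial_boundary p = 0 \<longleftrightarrow> (\<forall>\<phi>. pairing (coboundary \<phi>) p = 0)" for p :: "nat set \<Rightarrow>\<^sub>0 'k"
    using poly_mapping_pairing_eqI[of "simplicial_boundary p" 0] pairing_boundary[of _ p] pairing_zero by metis
  show ?thesis
    unfolding trivial_reduced_homology_iff
  proof
    assume ex: "\<forall>z\<in>simplicial_chains k (int c - 1) \<Gamma>. simplicial_boundary z = 0 \<longrightarrow>
      z \<in> simplicial_boundary ` simplicial_chains k (int c - 1 + 1) \<Gamma>"
    show "coh_zero k \<Gamma> c"
      unfolding coh_zero_def
    proof (intro allI impI)
      fix \<phi> :: "nat set \<Rightarrow> 'k"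
      assume cyc: "\<forall>F\<in>\<Gamma>. card F = Suc c \<longrightarrow> coboundary \<phi> F = 0"
      \<comment> \<open>All subsets of the faces in question serve as rows, so every
        \<open>F - {v}\<close> is included without forming \<open>c - 1\<close>.\<close>
      let ?A = "{G. \<exists>F\<in>faces \<Gamma> c. G \<subseteq> F}"
      have finA: "finite ?A"
        by (rule finite_subset[of _ "\<Union>(Pow ` faces \<Gamma> c)"]) (use fin finF in auto)
      have "\<exists>\<psi>. \<forall>F\<in>faces \<Gamma> c. (\<Sum>G\<in>?A. \<psi> G * incidence G F) = \<phi> F"
      proof (rule fredholm_alternative[OF finA fin(1)])
        fix y :: "nat set \<Rightarrow> 'k" assume y: "\<And>a. a \<in> ?A \<Longrightarrow> (\<Sum>b\<in>faces \<Gamma> c. incidence a b * y b) = 0"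
        define z where "z = poly_mapping_on (faces \<Gamma> c) y"
        have "pairing (coboundary \<psi>) z = 0" for \<psi>
        proof -
          have "pairing (coboundary \<psi>) z = (\<Sum>b\<in>faces \<Gamma> c. coboundary \<psi> b * y b)"
            unfolding z_def by (rule pairing_poly_mapping_on[OF fin(1)])
          also have "\<dots> = (\<Sum>b\<in>faces \<Gamma> c. (\<Sum>G\<in>?A. \<psi> G * incidence G b) * y b)"
          proof (intro sum.cong refl arg_cong2[of _ _ _ _ "(*)"])
            fix b assume "b \<in> faces \<Gamma> c"
            then show "coboundary \<psi> b = (\<Sum>G\<in>?A. \<psi> G * incidence G b)"
              by (intro sum_incidence[symmetric] finA) (auto simp: finF)
          qed
          also have "\<dots> = (\<Sum>G\<in>?A. \<psi> G * (\<Sum>b\<in>faces \<Gamma> c. incidence G b * y b))"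
            unfolding sum_distrib_left sum_distrib_right by (subst sum.swap) (simp add: ac_simps)
          also have "\<dots> = 0" using y by simp
          finally show ?thesis .
        qed
        then have "simplicial_boundary z = 0" using bdry by blast
        moreover have "z \<in> simplicial_chains k (int c - 1) \<Gamma>"
          unfolding chains z_def by (rule keys_poly_mapping_on[OF fin(1)])
        ultimately obtain w where w: "w \<in> simplicial_chains k (int c) \<Gamma>" "z = simplicial_boundary w"
          using ex by auto
        \<comment> \<open>As \<open>z\<close> is the boundary of \<open>w\<close>, the value of
          \<open>\<phi>\<close> on \<open>z\<close> is that of its coboundary on \<open>w\<close>,
          which is 0.\<close>
        have "(\<Sum>b\<in>faces \<Gamma> c. \<phi> b * y b) = pairing \<phi> z"
          unfolding z_def by (rule pairing_poly_mapping_on[symmetric, OF fin(1)])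
        also have "\<dots> = (\<Sum>F\<in>keys w. coboundary \<phi> F * lookup w F)"
          by (simp only: w(2) pairing_boundary pairing_def[of _ w])
        also have "\<dots> = 0"
          by (rule sum.neutral) (use w(1) cyc in \<open>auto simp: chains'\<close>)
        finally show "(\<Sum>b\<in>faces \<Gamma> c. \<phi> b * y b) = 0" .
      qed
      then obtain \<psi> where \<psi>: "\<And>F. F \<in> faces \<Gamma> c \<Longrightarrow> (\<Sum>G\<in>?A. \<psi> G * incidence G F) = \<phi> F" by blast
      show "\<exists>\<psi>. \<forall>F\<in>\<Gamma>. card F = c \<longrightarrow> \<phi> F = coboundary \<psi> F"
      proof (intro exI ballI impI)
        fix F assume F: "F \<in> \<Gamma>" "card F = c"
        then have "(\<Sum>G\<in>?A. \<psi> G * incidence G F) = coboundary \<psi> F"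
          by (intro sum_incidence finA) (auto simp: finF)
        then show "\<phi> F = coboundary \<psi> F" using \<psi> F by simp
      qed
    qed
  next
    assume coh: "coh_zero k \<Gamma> c"
    show "\<forall>z\<in>simplicial_chains k (int c - 1) \<Gamma>. simplicial_boundary z = 0 \<longrightarrow>
      z \<in> simplicial_boundary ` simplicial_chains k (int c - 1 + 1) \<Gamma>"
    proof (intro ballI impI)
      fix z assume z: "z \<in> simplicial_chains k (int c - 1) \<Gamma>" "simplicial_boundary z = 0"
      \<comment> \<open>A cycle is orthogonal to all coboundaries, hence by hypothesis to all
        cocycles.\<close>
      have "\<exists>x. \<forall>b\<in>faces \<Gamma> c. (\<Sum>a\<in>faces \<Gamma> (Suc c). x a * incidence b a) = lookup z b"
      proof (rule fredholm_alternative[OF fin(2) fin(1)])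
        fix \<phi> :: "nat set \<Rightarrow> 'k"
        assume \<phi>: "\<And>a. a \<in> faces \<Gamma> (Suc c) \<Longrightarrow> (\<Sum>b\<in>faces \<Gamma> c. incidence b a * \<phi> b) = 0"
        have "coboundary \<phi> F = 0" if "F \<in> \<Gamma>" "card F = Suc c" for F
          using \<phi>[of F] sum_incidence[OF fin(1) finF[OF that(1)] del, of c \<phi>] that
          by (simp add: mult.commute)
        then obtain \<psi> where \<psi>: "\<And>F. F \<in> \<Gamma> \<Longrightarrow> card F = c \<Longrightarrow> \<phi> F = coboundary \<psi> F"
          by (rule coh_zeroE[OF coh, of \<phi>]) blast+
        have "(\<Sum>b\<in>faces \<Gamma> c. lookup z b * \<phi> b) = pairing (coboundary \<psi>) z"
          using z(1) \<psi> by (subst pairing_superset[OF fin(1)[of c]]) (auto simp: chains intro!: sum.cong)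
        also have "\<dots> = 0" using z(2) bdry by blast
        finally show "(\<Sum>b\<in>faces \<Gamma> c. lookup z b * \<phi> b) = 0" .
      qed
      then obtain x where x: "\<And>b. b \<in> faces \<Gamma> c \<Longrightarrow> (\<Sum>a\<in>faces \<Gamma> (Suc c). x a * incidence b a) = lookup z b"
        by blast
      define w where "w = poly_mapping_on (faces \<Gamma> (Suc c)) x"
      have w: "w \<in> simplicial_chains k (int c - 1 + 1) \<Gamma>"
        using keys_poly_mapping_on[OF fin(2)[of c], of x] by (simp add: w_def chains')
      have "pairing \<phi> z = pairing \<phi> (simplicial_boundary w)" for \<phi>
      proof -
        have "pairing \<phi> z = (\<Sum>b\<in>faces \<Gamma> c. \<phi> b * lookup z b)"
          using z(1) by (intro pairing_superset fin) (simp add: chains)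
        also have "\<dots> = (\<Sum>b\<in>faces \<Gamma> c. \<phi> b * (\<Sum>a\<in>faces \<Gamma> (Suc c). x a * incidence b a))"
          using x by simp
        also have "\<dots> = (\<Sum>a\<in>faces \<Gamma> (Suc c). (\<Sum>b\<in>faces \<Gamma> c. \<phi> b * incidence b a) * x a)"
          unfolding sum_distrib_left sum_distrib_right by (subst sum.swap) (simp add: ac_simps)
        also have "\<dots> = (\<Sum>a\<in>faces \<Gamma> (Suc c). coboundary \<phi> a * x a)"
        proof (intro sum.cong refl arg_cong2[of _ _ _ _ "(*)"])
          fix a assume a: "a \<in> faces \<Gamma> (Suc c)"
          then show "(\<Sum>b\<in>faces \<Gamma> c. \<phi> b * incidence b a) = coboundary \<phi> a"
            by (intro sum_incidence fin) (use del finF in auto)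
        qed
        also have "\<dots> = pairing \<phi> (simplicial_boundary w)"
          unfolding pairing_boundary w_def by (rule pairing_poly_mapping_on[symmetric, OF fin(2)])
        finally show ?thesis .
      qed
      then have "z = simplicial_boundary w" by (rule poly_mapping_pairing_eqI)
      then show "z \<in> simplicial_boundary ` simplicial_chains k (int c - 1 + 1) \<Gamma>" using w by blast
    qed
  qed
qed

section \<open>Facet sizes and the homology conditions\<close>

lemma simplicial_complex_is_complex:
  assumes "simplicial_complex n \<Delta>" shows "is_complex \<Delta>"
proof -
  have s: "\<Delta> \<subseteq> Pow {1..n}" "\<forall>F\<in>\<Delta>. \<forall>G. G \<subseteq> F \<longrightarrow> G \<in> \<Delta>"
    using assms unfolding simplicial_complex_def by auto
  have "finite F" if "F \<in> \<Delta>" for F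
    using s(1) that by (meson PowD finite_atLeastAtMost finite_subset subsetD)
  moreover have "finite \<Delta>" using s(1) by (meson finite_Pow_iff finite_atLeastAtMost finite_subset)
  ultimately show ?thesis using s(2) unfolding is_complex_def by blast
qed

text \<open>On faces this number determines both the dimension of the link and, by comparison with
  \<open>d\<close>, membership in the pure skeleton.\<close>

definition top_card :: "nat set set \<Rightarrow> nat set \<Rightarrow> nat" where
  "top_card \<Delta> F = Max (card ` {G\<in>\<Delta>. F \<subseteq> G})"

lemma card_le_top_card:
  assumes "is_complex \<Delta>" "G \<in> \<Delta>" "F \<subseteq> G"
  shows "card G \<le> top_card \<Delta> F"
  using assms unfolding top_card_def is_complex_def by (intro Max_ge) auto

lemma top_card_attained:
  assumes "is_complex \<Delta>" "F \<in> \<Delta>"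
  obtains G where "G \<in> \<Delta>" "F \<subseteq> G" "card G = top_card \<Delta> F"
proof -
  have "top_card \<Delta> F \<in> card ` {G\<in>\<Delta>. F \<subseteq> G}"
    unfolding top_card_def by (rule Max_in) (use assms in \<open>auto simp: is_complex_def\<close>)
  then show thesis using that by auto
qed

lemma complex_dim_link:
  assumes cx: "is_complex \<Delta>" and F: "F \<in> \<Delta>"
  shows "complex_dim (link \<Delta> F) = int (top_card \<Delta> F) - int (card F) - 1"
  unfolding complex_dim_def
proof (rule Max_eqI)
  show "finite (face_dim ` link \<Delta> F)"
    using is_complex_link[OF cx, of F] unfolding is_complex_def by simp
  have finF: "finite F" using cx F unfolding is_complex_def by auto
  fix y assume "y \<in> face_dim ` link \<Delta> F"
  then obtain G where G: "y = face_dim G" "G \<in> \<Delta>" "G \<inter> F = {}" "G \<union> F \<in> \<Delta>" unfolding link_def by auto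
  then have "card (G \<union> F) \<le> top_card \<Delta> F" by (intro card_le_top_card[OF cx]) auto
  moreover have "finite G" using G cx unfolding is_complex_def by auto
  ultimately show "y \<le> int (top_card \<Delta> F) - int (card F) - 1"
    using G finF by (simp add: face_dim_def card_Un_disjoint)
next
  obtain G where G: "G \<in> \<Delta>" "F \<subseteq> G" "card G = top_card \<Delta> F" using top_card_attained[OF cx F] .
  have fin: "finite G" using cx G unfolding is_complex_def by auto
  have "G - F \<in> \<Delta>" using cx G unfolding is_complex_def by blast
  then have "G - F \<in> link \<Delta> F" using G unfolding link_def by (auto simp: Un_absorb2)
  moreover have "face_dim (G - F) = int (top_card \<Delta> F) - int (card F) - 1"
    using G fin card_mono[OF fin G(2)] finite_subset[OF G(2) fin]
    by (simp add: face_dim_def card_Diff_subset of_nat_diff)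
  ultimately show "int (top_card \<Delta> F) - int (card F) - 1 \<in> face_dim ` link \<Delta> F" by (metis imageI)
qed

text \<open>Degree 1 is dimension 0. If no edge joined the two classes of vertices, the indicator of
  \<open>P\<close> would be a cocycle; but a coboundary on vertices comes from the empty face alone
  and is constant.\<close>

lemma coh_zero_1_connected:
  assumes cx: "is_complex \<Gamma>" and coh: "coh_zero (k::'k::field itself) \<Gamma> 1"
    and V: "{v} \<in> \<Gamma>" "{w} \<in> \<Gamma>" and P: "P v" "\<not> P w"
  obtains a b where "{a, b} \<in> \<Gamma>" "P a" "\<not> P b"
proof (rule ccontr)
  note obt = that
  assume no: "\<not> thesis"
  have const: "P a = P b" if "{a,b} \<in> \<Gamma>" for a b
    using obt[of a b] obt[of b a] no that by (auto simp: insert_commute)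
  define \<phi> :: "nat set \<Rightarrow> 'k" where "\<phi> F = (if P (the_elem F) then 1 else 0)" for F
  have "coboundary \<phi> F = 0" if F: "F \<in> \<Gamma>" "card F = Suc 1" for F
  proof -
    obtain a b where ab: "F = {a,b}" "a < b"
    proof -
      obtain a b where "F = {a,b}" "a \<noteq> b" using F(2) by (auto simp: card_Suc_eq)
      then show thesis using that[of a b] that[of b a] by (cases "a < b") auto
    qed
    have e: "{u \<in> {a,b}. u < a} = {}" "{u \<in> {a,b}. u < b} = {a}" using ab(2) by auto
    have "inc_sign a {a,b} = (1::'k)" "inc_sign b {a,b} = (-1::'k)" unfolding inc_sign_def e by simp_all
    moreover have "{a,b} - {a} = {b}" "{a,b} - {b} = {a}" using ab by auto
    moreover have "P a = P b" using const ab F by blast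
    ultimately show ?thesis using ab(2) unfolding ab(1) koszul_d_def by (simp add: \<phi>_def)
  qed
  then obtain \<psi> where \<psi>: "\<And>F. F \<in> \<Gamma> \<Longrightarrow> card F = 1 \<Longrightarrow> \<phi> F = coboundary \<psi> F"
    by (rule coh_zeroE[OF coh, of \<phi>]) blast+
  have "coboundary \<psi> {u} = \<psi> {}" for u
  proof -
    have "{x \<in> {u}. x < u} = {}" by auto
    then have "inc_sign u {u} = (1::'k)" unfolding inc_sign_def by (simp only: card.empty power_0)
    then show ?thesis by (simp add: koszul_d_def)
  qed
  then have "\<phi> {v} = \<phi> {w}" using \<psi> V by simp
  then show False using P by (simp add: \<phi>_def)
qed

text \<open>
  Choose a face \<open>F\<close> of maximal cardinality lying both in a facet \<open>G\<close> with at most \<open>d - 2\<close> vertices and in a larger face. An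
  edge of the link of \<open>F\<close> from a vertex of small to a vertex of large \<open>top_card\<close> contradicts the maximality.
\<close>

lemma homology_conditions_pure:
  assumes cx: "is_complex \<Delta>" and top: "top_card \<Delta> {} = d" and F0: "F0 \<in> \<Delta>"
    and 1: "\<And>F. F \<in> \<Delta> \<Longrightarrow> top_card \<Delta> F = d \<Longrightarrow> card F + 2 < d \<Longrightarrow> coh_zero (k::'k::field itself) (link \<Delta> F) 1"
    and 2: "\<And>F. F \<in> \<Delta> \<Longrightarrow> top_card \<Delta> F < d \<Longrightarrow> card F + 2 \<le> top_card \<Delta> F \<Longrightarrow> coh_zero k (link \<Delta> F) 1"
  shows "d \<le> top_card \<Delta> F0 + 1"
proof (rule ccontr)
  assume not: "\<not> ?thesis"
  let ?M = "top_card \<Delta>"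
  have sub: "G \<in> \<Delta>" if "F \<in> \<Delta>" "G \<subseteq> F" for F G using that cx unfolding is_complex_def by blast
  have finF: "finite F" if "F \<in> \<Delta>" for F using that cx unfolding is_complex_def by blast
  have anti: "?M G \<le> ?M F" if FG: "F \<subseteq> G" "G \<in> \<Delta>" for F G
  proof -
    obtain H where "H \<in> \<Delta>" "G \<subseteq> H" "card H = ?M G" using top_card_attained[OF cx FG(2)] .
    then show ?thesis using card_le_top_card[OF cx, of H F] FG by auto
  qed
  have facet: "\<exists>G\<in>\<Delta>. F \<subseteq> G \<and> card G = ?M F \<and> ?M G = ?M F" if FD: "F \<in> \<Delta>" for F
  proof -
    obtain G where "G \<in> \<Delta>" "F \<subseteq> G" "card G = ?M F" using top_card_attained[OF cx FD] .
    then show ?thesis using anti[of F G] card_le_top_card[OF cx, of G G] by (intro bexI[of _ G]) auto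
  qed
  define Q where "Q F \<longleftrightarrow> (\<exists>G\<in>\<Delta>. F \<subseteq> G \<and> ?M G = card G \<and> card G + 2 \<le> d \<and> card G < ?M F)" for F
  obtain G0 where G0: "G0 \<in> \<Delta>" "card G0 = ?M F0" "?M G0 = ?M F0" using facet[OF F0] by blast
  have Q0: "Q {}" unfolding Q_def using G0 not top by (intro bexI[of _ G0]) auto
  have bound: "\<forall>F. Q F \<longrightarrow> card F < Suc d"
  proof (intro allI impI)
    fix F assume "Q F"
    then obtain G where "G \<in> \<Delta>" "F \<subseteq> G" "card G + 2 \<le> d" unfolding Q_def by blast
    then show "card F < Suc d" using card_mono[OF finF, of G F] by linarith
  qed
  have "\<exists>F. Q F \<and> (\<forall>F'. Q F' \<longrightarrow> card F' \<le> card F)"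
    by (rule ex_has_greatest_nat[OF Q0 bound])
  then obtain F where F: "Q F" "\<And>F'. Q F' \<Longrightarrow> card F' \<le> card F" by (elim exE conjE) simp
  then obtain G where G: "G \<in> \<Delta>" "F \<subseteq> G" "?M G = card G" "card G + 2 \<le> d" "card G < ?M F"
    unfolding Q_def by blast
  have FD: "F \<in> \<Delta>" using sub G by blast
  have finf: "finite F" using FD finF by blast
  obtain H where H: "H \<in> \<Delta>" "F \<subseteq> H" "card H = ?M F" using top_card_attained[OF cx FD] .
  have "F \<noteq> G" using G by auto
  then obtain v where v: "v \<in> G" "v \<notin> F" using G by blast
  have FG: "card F < card G" using G \<open>F \<noteq> G\<close> finF psubset_card_mono by blast
  have Md: "?M F \<le> d" using anti[of "{}" F] FD top by simp
  \<comment> \<open>The inequalities \<open>card F < card G < ?M F\<close> and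
    \<open>card G + 2 \<le> d\<close> put degree 1 into the range of either hypothesis.\<close>
  have coh: "coh_zero k (link \<Delta> F) 1"
  proof (cases "?M F = d")
    case True then show ?thesis using 1 FD FG G by auto
  next
    case False then show ?thesis using 2 FD FG G Md by auto
  qed
  have vert: "{u} \<in> link \<Delta> F" if "u \<in> K" "u \<notin> F" "F \<subseteq> K" "K \<in> \<Delta>" for u K
  proof -
    have "insert u F \<in> \<Delta>" "{u} \<in> \<Delta>" using sub[OF \<open>K \<in> \<Delta>\<close>] that by blast+
    then show ?thesis using that unfolding link_def by simp
  qed
  have "card F < card H" using FG G H by simp
  then obtain w where w: "w \<in> H" "w \<notin> F" using H by (metis less_irrefl subset_antisym subsetI)
  have small: "?M (insert v F) \<le> card G"
  proof (rule ccontr)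
    assume "\<not> ?thesis"
    then have "Q (insert v F)" unfolding Q_def using G v by (intro bexI[of _ G]) auto
    then show False using F(2)[of "insert v F"] finf v by simp
  qed
  have big: "\<not> ?M (insert w F) \<le> card G"
    using card_le_top_card[OF cx H(1), of "insert w F"] H w G by auto
  obtain a b where ab: "{a,b} \<in> link \<Delta> F" "?M (insert a F) \<le> card G" "\<not> ?M (insert b F) \<le> card G"
    by (rule coh_zero_1_connected[OF is_complex_link[OF cx] coh vert[OF v G(2,1)] vert[OF w H(2,1)],
          where P="\<lambda>u. ?M (insert u F) \<le> card G", OF small big])
  let ?E = "{a,b} \<union> F"
  have E: "?E \<in> \<Delta>" "b \<notin> F" using ab(1) unfolding link_def by auto
  then obtain G' where G': "G' \<in> \<Delta>" "?E \<subseteq> G'" "card G' = ?M ?E" "?M G' = ?M ?E" using facet[OF E(1)] by blast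
  have "?M ?E \<le> ?M (insert a F)" by (rule anti) (use E in auto)
  then have "Q (insert b F)" unfolding Q_def using G' G ab by (intro bexI[of _ G']) auto
  then show False using F(2)[of "insert b F"] finf E by simp
qed

text \<open>With \<open>M = top_card \<Delta> F\<close>, conditions (i) and (ii) ask for vanishing
  when \<open>c + card F < M\<close> and when \<open>c + card F + 1 < d\<close>. The uniform bound
  agrees with them for \<open>M = d - 1\<close> and \<open>M = d\<close>. It would be the stronger
  demand for smaller \<open>M\<close>, a case that \<open>homology_conditions_pure\<close>
  excludes.\<close>

lemma homology_conditions_iff:
  fixes k :: "'k::field itself"
  assumes sc: "simplicial_complex n \<Delta>" and dim: "complex_dim \<Delta> = int d - 1"
  shows "((\<forall>F \<in> \<Delta> - pure_skeleton \<Delta> (int d - 1). \<forall>i::int.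
       i < complex_dim (link \<Delta> F) \<longrightarrow> trivial_group (reduced_homology k i (link \<Delta> F))) \<and>
    (\<forall>F \<in> pure_skeleton \<Delta> (int d - 1). \<forall>i::int.
       i < complex_dim (link \<Delta> F) - 1 \<longrightarrow> trivial_group (reduced_homology k i (link \<Delta> F)))) \<longleftrightarrow>
    (\<forall>F\<in>\<Delta>. \<forall>c. c + card F < d - 1 \<longrightarrow> coh_zero k (link \<Delta> F) c)" (is "?L \<longleftrightarrow> ?R")
proof -
  have cx: "is_complex \<Delta>" using simplicial_complex_is_complex[OF sc] .
  have e: "{} \<in> \<Delta>" using sc unfolding simplicial_complex_def by blast
  have "link \<Delta> {} = \<Delta>" unfolding link_def by auto
  then have top: "top_card \<Delta> {} = d" using complex_dim_link[OF cx e] dim by simp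
  have le: "top_card \<Delta> F \<le> d" if FD: "F \<in> \<Delta>" for F
  proof -
    obtain G where "G \<in> \<Delta>" "F \<subseteq> G" "card G = top_card \<Delta> F" using top_card_attained[OF cx FD] .
    then show ?thesis using card_le_top_card[OF cx, of G "{}"] top by simp
  qed
  have pure: "F \<in> pure_skeleton \<Delta> (int d - 1) \<longleftrightarrow> top_card \<Delta> F = d" if FD: "F \<in> \<Delta>" for F
  proof
    assume "F \<in> pure_skeleton \<Delta> (int d - 1)"
    then obtain G where "G \<in> \<Delta>" "F \<subseteq> G" "card G = d" unfolding pure_skeleton_def face_dim_def by auto
    then show "top_card \<Delta> F = d" using card_le_top_card[OF cx, of G F] le[OF FD] by simp
  next
    assume "top_card \<Delta> F = d"
    moreover obtain G where "G \<in> \<Delta>" "F \<subseteq> G" "card G = top_card \<Delta> F" using top_card_attained[OF cx FD] .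
    ultimately show "F \<in> pure_skeleton \<Delta> (int d - 1)" using FD unfolding pure_skeleton_def face_dim_def by auto
  qed
  have sk: "pure_skeleton \<Delta> (int d - 1) \<subseteq> \<Delta>" unfolding pure_skeleton_def by blast
  have bound: "(\<forall>i::int. i < int m - 1 \<longrightarrow> trivial_group (reduced_homology k i (link \<Delta> F))) \<longleftrightarrow>
      (\<forall>c. c < m \<longrightarrow> coh_zero k (link \<Delta> F) c)" for m F
  proof
    assume *: "\<forall>i::int. i < int m - 1 \<longrightarrow> trivial_group (reduced_homology k i (link \<Delta> F))"
    show "\<forall>c. c < m \<longrightarrow> coh_zero k (link \<Delta> F) c"
    proof (intro allI impI)
      fix c assume "c < m"
      then have "trivial_group (reduced_homology k (int c - 1) (link \<Delta> F))" using * by simp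
      then show "coh_zero k (link \<Delta> F) c"
        using trivial_homology_iff_coh_zero[OF is_complex_link[OF cx]] by blast
    qed
  next
    assume *: "\<forall>c. c < m \<longrightarrow> coh_zero k (link \<Delta> F) c"
    show "\<forall>i::int. i < int m - 1 \<longrightarrow> trivial_group (reduced_homology k i (link \<Delta> F))"
    proof (intro allI impI)
      fix i :: int assume i: "i < int m - 1"
      show "trivial_group (reduced_homology k i (link \<Delta> F))"
      \<comment> \<open>Degrees below -1 correspond to no \<open>c\<close>, but there are no chains
        in them.\<close>
      proof (cases "i < -1")
        case True
        then have "simplicial_chains k i (link \<Delta> F) = {0}"
          unfolding simplicial_chains_def face_dim_def by auto
        moreover have "(0 :: nat set \<Rightarrow>\<^sub>0 'k) \<in> simplicial_boundary ` simplicial_chains k (i + 1) (link \<Delta> F)"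
          by (rule image_eqI[of _ _ 0]) (auto simp: simplicial_boundary_zero simplicial_chains_def)
        ultimately show ?thesis unfolding trivial_reduced_homology_iff by simp
      next
        case False
        define c where "c = nat (i + 1)"
        have c: "i = int c - 1" "c < m" using False i by (auto simp: c_def)
        then show ?thesis using * trivial_homology_iff_coh_zero[OF is_complex_link[OF cx]] by blast
      qed
    qed
  qed
  have cdim: "complex_dim (link \<Delta> F) = int (top_card \<Delta> F - card F) - 1" "card F \<le> top_card \<Delta> F" if "F \<in> \<Delta>" for F
    using complex_dim_link[OF cx that] card_le_top_card[OF cx that, of F] by auto
  let ?Q = "\<forall>F\<in>\<Delta>. (top_card \<Delta> F < d \<longrightarrow> (\<forall>c. c + card F < top_card \<Delta> F \<longrightarrow> coh_zero k (link \<Delta> F) c)) \<and>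
    (top_card \<Delta> F = d \<longrightarrow> (\<forall>c. c + card F + 1 < d \<longrightarrow> coh_zero k (link \<Delta> F) c))"
  have L: "?L \<longleftrightarrow> ?Q"
  proof -
    have A: "(\<forall>i::int. i < complex_dim (link \<Delta> F) \<longrightarrow> trivial_group (reduced_homology k i (link \<Delta> F))) \<longleftrightarrow>
       (\<forall>c. c + card F < top_card \<Delta> F \<longrightarrow> coh_zero k (link \<Delta> F) c)" if "F \<in> \<Delta>" for F
      unfolding cdim(1)[OF that] bound by (simp add: less_diff_conv)
    have B: "(\<forall>i::int. i < complex_dim (link \<Delta> F) - 1 \<longrightarrow> trivial_group (reduced_homology k i (link \<Delta> F))) \<longleftrightarrow>
       (\<forall>c. c + card F + 1 < d \<longrightarrow> coh_zero k (link \<Delta> F) c)" if "F \<in> \<Delta>" "top_card \<Delta> F = d" for F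
    \<comment> \<open>For a face with \<open>d\<close> vertices natural subtraction would truncate.
      Then no \<open>c\<close> is in range on the right, and only degrees below -2 are on the
      left.\<close>
    proof (cases "card F < d")
      case True
      then have "complex_dim (link \<Delta> F) - 1 = int (d - card F - 1) - 1" using cdim[OF that(1)] that(2) by simp
      then show ?thesis using bound[of "d - card F - 1" F] by (simp add: less_diff_conv)
    next
      case False
      then have "complex_dim (link \<Delta> F) - 1 = -2" using cdim[OF that(1)] that(2) by simp
      moreover have "trivial_group (reduced_homology k i (link \<Delta> F))" if "i < -2" for i
        using bound[of 0 F] that by simp
      ultimately show ?thesis using False by simp
    qed
    show ?thesis
    proof (intro iffI conjI ballI impI)
      fix F assume F: "F \<in> \<Delta>" "top_card \<Delta> F < d" and ?L
      then have "F \<in> \<Delta> - pure_skeleton \<Delta> (int d - 1)" using pure by auto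
      then show "\<forall>c. c + card F < top_card \<Delta> F \<longrightarrow> coh_zero k (link \<Delta> F) c"
        using \<open>?L\<close> A[OF F(1)] by blast
    next
      fix F assume F: "F \<in> \<Delta>" "top_card \<Delta> F = d" and ?L
      then have "F \<in> pure_skeleton \<Delta> (int d - 1)" using pure by auto
      then show "\<forall>c. c + card F + 1 < d \<longrightarrow> coh_zero k (link \<Delta> F) c"
        using \<open>?L\<close> B[OF F] by blast
    next
      fix F assume F: "F \<in> \<Delta> - pure_skeleton \<Delta> (int d - 1)" and R: "?Q"
      then have "F \<in> \<Delta>" "top_card \<Delta> F < d" using pure[of F] le[of F] by auto
      then show "\<forall>i. i < complex_dim (link \<Delta> F) \<longrightarrow> trivial_group (reduced_homology k i (link \<Delta> F))"
        using A R by blast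
    next
      fix F assume F: "F \<in> pure_skeleton \<Delta> (int d - 1)" and R: "?Q"
      then have "F \<in> \<Delta>" "top_card \<Delta> F = d" using pure[of F] sk by auto
      then show "\<forall>i. i < complex_dim (link \<Delta> F) - 1 \<longrightarrow> trivial_group (reduced_homology k i (link \<Delta> F))"
        using B R by blast
    qed
  qed
  show ?thesis unfolding L
  proof
    assume *: "?Q"
    have p: "d \<le> top_card \<Delta> F + 1" if "F \<in> \<Delta>" for F
      by (rule homology_conditions_pure[OF cx top that, where k=k]) (use * in auto)
    show ?R
    proof (intro ballI allI impI)
      fix F c assume F: "F \<in> \<Delta>" "c + card F < d - 1"
      show "coh_zero k (link \<Delta> F) c"
      proof (cases "top_card \<Delta> F = d")
        case True then show ?thesis using * F by auto
      next
        case False then show ?thesis using * F p[OF F(1)] le[OF F(1)] by auto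
      qed
    qed
  next
    assume ?R
    then show "?Q"
      by auto
  qed
qed

section \<open>Koszul cohomology and regular sequences\<close>

text \<open>The ring as a module over itself: \<open>idl.subspace\<close> means ideal and
  \<open>idl.span\<close> the generated ideal.\<close>

interpretation idl: Modules.module "(*) :: 'a::comm_ring_1 \<Rightarrow> 'a \<Rightarrow> 'a"
  by unfold_locales (simp_all add: algebra_simps)

text \<open>For the ring as a module over itself, this rule reverses \<open>mult.assoc\<close>.\<close>

declare idl.scale_scale [simp del]

section \<open>Prime avoidance and annihilators modulo an ideal\<close>

definition prime_set :: "'a::comm_ring_1 set \<Rightarrow> bool" where
  "prime_set P \<longleftrightarrow> idl.subspace P \<and> 1 \<notin> P \<and> (\<forall>a b. a * b \<in> P \<longrightarrow> a \<in> P \<or> b \<in> P)"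

text \<open>Noetherianity of the quotient by \<open>J\<close>, in the form that forbids strictly
  increasing chains of ideals.\<close>

definition acc_above :: "'a::comm_ring_1 set \<Rightarrow> bool" where
  "acc_above J \<longleftrightarrow> (\<forall>I :: nat \<Rightarrow> 'a set.
     (\<forall>n. idl.subspace (I n) \<and> J \<subseteq> I n \<and> I n \<subseteq> I (Suc n)) \<longrightarrow> (\<exists>n. I (Suc n) = I n))"

lemma acc_above_mono: "acc_above J \<Longrightarrow> J \<subseteq> J' \<Longrightarrow> acc_above J'"
  unfolding acc_above_def by (meson subset_trans)

lemma idl_mult_left: "idl.subspace J \<Longrightarrow> a \<in> J \<Longrightarrow> b * a \<in> J"
  by (rule idl.subspace_scale)

lemma idl_mult_right: "idl.subspace J \<Longrightarrow> a \<in> J \<Longrightarrow> a * b \<in> J"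
  by (subst mult.commute) (rule idl.subspace_scale)

lemma prime_set_prod:
  assumes P: "prime_set P" and "finite A"
  shows "prod f A \<in> P \<longleftrightarrow> (\<exists>a\<in>A. f a \<in> P)"
  using assms(2)
proof (induction A)
  case (insert a A)
  have "f a * prod f A \<in> P \<longleftrightarrow> f a \<in> P \<or> prod f A \<in> P"
    using P unfolding prime_set_def by (blast intro: idl_mult_left idl_mult_right)
  then show ?case using insert by simp
qed (use P in \<open>simp add: prime_set_def\<close>)

lemma prime_avoidance:
  assumes "finite \<P>" "\<And>P. P \<in> \<P> \<Longrightarrow> prime_set P" and M: "idl.subspace M" and "M \<subseteq> \<Union>\<P>"
  shows "\<exists>P\<in>\<P>. M \<subseteq> P"
  using assms(1,2,4)
proof (induction \<P> rule: finite_psubset_induct)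
  case (psubset \<P>)
  show ?case
  proof (cases "\<exists>P0\<in>\<P>. M \<subseteq> \<Union>(\<P> - {P0})")
    case True
    then obtain P0 where "P0 \<in> \<P>" "M \<subseteq> \<Union>(\<P> - {P0})" by blast
    then have "\<exists>P\<in>\<P> - {P0}. M \<subseteq> P" by (intro psubset.IH) (use psubset.prems in auto)
    then show ?thesis by blast
  next
    case False
    have "\<exists>a. a \<in> M \<and> a \<notin> \<Union>(\<P> - {P})" if "P \<in> \<P>" for P using False that by blast
    then obtain a where a: "\<And>P. P \<in> \<P> \<Longrightarrow> a P \<in> M \<and> a P \<notin> \<Union>(\<P> - {P})" by metis
    have aP: "a P \<in> P" if "P \<in> \<P>" for P using a[OF that] psubset.prems(2) by blast
    have "0 \<in> M" using M idl.subspace_0 by blast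
    then obtain P0 where P0: "P0 \<in> \<P>" using psubset.prems(2) by blast
    \<comment> \<open>With no member of \<open>\<P>\<close> redundant, each \<open>a P\<close> lies
      in \<open>P\<close> and in no other member. So \<open>a P0 + b\<close> is in \<open>M\<close>
      but in no member: modulo \<open>P0\<close> it is \<open>b\<close>, modulo any other member it
      is \<open>a P0\<close>.\<close>
    define b where "b = (\<Prod>P\<in>\<P> - {P0}. a P)"
    show ?thesis
    proof (cases "\<P> = {P0}")
      case True then show ?thesis using psubset.prems(2) by auto
    next
      case False
      then obtain P1 where P1: "P1 \<in> \<P>" "P1 \<noteq> P0" using P0 by blast
      have "b = a P1 * prod a (\<P> - {P0} - {P1})"
        unfolding b_def by (rule prod.remove) (use P1 psubset.hyps in auto)
      then have "b \<in> M" using a[OF P1(1)] idl_mult_right[OF M] by simp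
      then have "a P0 + b \<in> M" using a[OF P0] M idl.subspace_add by blast
      then obtain P where P: "P \<in> \<P>" "a P0 + b \<in> P" using psubset.prems(2) by blast
      have pP: "prime_set P" using psubset.prems(1) P by blast
      then have sP: "idl.subspace P" unfolding prime_set_def by blast
      have fin: "finite (\<P> - {P0})" using psubset.hyps by simp
      show ?thesis
      proof (cases "P = P0")
        case True
        then have "b \<in> P0" using P idl.subspace_diff[OF sP, of "a P0 + b" "a P0"] aP[OF P0] by simp
        then obtain Q where "Q \<in> \<P> - {P0}" "a Q \<in> P0"
          unfolding b_def using prime_set_prod[OF _ fin, of P0 a] pP True by blast
        then show ?thesis using a[of Q] P0 by blast
      next
        case False
        then have "b \<in> P" unfolding b_def using prime_set_prod[OF pP fin, of a] P aP by blast
        then have "a P0 \<in> P" using P idl.subspace_diff[OF sP, of "a P0 + b" b] by simp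
        then show ?thesis using a[OF P0] P False by blast
      qed
    qed
  qed
qed

definition colon :: "'a::comm_ring_1 set \<Rightarrow> 'a \<Rightarrow> 'a set" where
  "colon J u = {f. f * u \<in> J}"

lemma subspace_colon:
  assumes J: "idl.subspace J"
  shows "idl.subspace (colon J u)"
proof (rule idl.subspaceI)
  show "0 \<in> colon J u" using idl.subspace_0[OF J] by (simp add: colon_def)
  show "a + b \<in> colon J u" if "a \<in> colon J u" "b \<in> colon J u" for a b
    using idl.subspace_add[OF J] that by (simp add: colon_def distrib_right)
  show "c * a \<in> colon J u" if "a \<in> colon J u" for a c
    using idl_mult_left[OF J] that by (simp add: colon_def mult.assoc)
qed

lemma acc_maximal:
  assumes acc: "acc_above J" and A: "A \<in> \<A>" and \<A>: "\<And>A. A \<in> \<A> \<Longrightarrow> idl.subspace A \<and> J \<subseteq> A"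
  shows "\<exists>B\<in>\<A>. A \<subseteq> B \<and> (\<forall>C\<in>\<A>. B \<subseteq> C \<longrightarrow> C = B)"
proof (rule ccontr)
  assume "\<not> ?thesis"
  then have "\<exists>C\<in>\<A>. B \<subset> C" if "B \<in> \<A>" "A \<subseteq> B" for B using that by blast
  then obtain nx where nx: "\<And>B. B \<in> \<A> \<Longrightarrow> A \<subseteq> B \<Longrightarrow> nx B \<in> \<A> \<and> B \<subset> nx B" by metis
  define I where "I n = (nx ^^ n) A" for n
  have I: "I n \<in> \<A> \<and> A \<subseteq> I n" for n
    unfolding I_def by (induction n) (use A nx in auto)
  have "I n \<subset> I (Suc n)" for n using nx I[of n] by (simp add: I_def)
  then show False using acc \<A> I unfolding acc_above_def by (metis psubset_eq)
qed

text \<open>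
  The maximal annihilators modulo \<open>J\<close> are prime, and there are only finitely many of them: if
  \<open>u\<^sub>0, u\<^sub>1, \<dots>\<close> had distinct maximal annihilators, some \<open>u\<^sub>n\<close> would lie in the ideal generated by \<open>J\<close> and
  its predecessors, so its annihilator would contain the intersection of theirs.
\<close>

lemma zero_divisors_common_annihilator:
  fixes J M :: "'a::comm_ring_1 set"
  assumes J: "idl.subspace J" and acc: "acc_above J" and M: "idl.subspace M"
    and zd: "\<And>f. f \<in> M \<Longrightarrow> \<exists>u. u \<notin> J \<and> f * u \<in> J"
  shows "\<exists>u. u \<notin> J \<and> (\<forall>f\<in>M. f * u \<in> J)"
proof -
  let ?A = "colon J ` (- J)"
  define \<P> where "\<P> = {P\<in>?A. \<forall>C\<in>?A. P \<subseteq> C \<longrightarrow> C = P}"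
  have A: "idl.subspace A \<and> J \<subseteq> A" if "A \<in> ?A" for A
  proof -
    obtain u where "A = colon J u" using \<open>A \<in> ?A\<close> by blast
    moreover have "J \<subseteq> colon J u" unfolding colon_def using idl_mult_right[OF J] by blast
    ultimately show ?thesis using subspace_colon[OF J] by simp
  qed
  have prime: "prime_set P" if "P \<in> \<P>" for P
  proof -
    obtain u where u: "u \<notin> J" "P = colon J u" using \<open>P \<in> \<P>\<close> unfolding \<P>_def by blast
    have "b \<in> P" if ab: "a * b \<in> P" "a \<notin> P" for a b
    proof -
      \<comment> \<open>The annihilator of \<open>a * u\<close> contains that of \<open>u\<close>,
        so by maximality they coincide, and \<open>b\<close> belongs to it.\<close>
      have "a * u \<notin> J" using ab u unfolding colon_def by simp
      moreover have "P \<subseteq> colon J (a * u)"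
      proof
        fix y assume "y \<in> P"
        then have "a * (y * u) \<in> J" using idl_mult_left[OF J] unfolding u(2) colon_def by blast
        then show "y \<in> colon J (a * u)" unfolding colon_def by (simp add: ac_simps)
      qed
      ultimately have "colon J (a * u) = P" using \<open>P \<in> \<P>\<close> unfolding \<P>_def by blast
      moreover have "b \<in> colon J (a * u)" using ab unfolding u colon_def by (simp add: ac_simps)
      ultimately show ?thesis by simp
    qed
    moreover have "1 \<notin> P" using u unfolding colon_def by simp
    ultimately show ?thesis using subspace_colon[OF J, of u] unfolding prime_set_def u(2) by blast
  qed
  have "finite \<P>"
  proof (rule ccontr)
    assume "infinite \<P>"
    then obtain P :: "nat \<Rightarrow> 'a set" where P: "inj P" "range P \<subseteq> \<P>"
      using infinite_countable_subset by blast
    have "\<exists>u. u \<notin> J \<and> P i = colon J u" for i using P(2) unfolding \<P>_def by blast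
    then obtain u where u: "\<And>i. u i \<notin> J" "\<And>i. P i = colon J (u i)" by metis
    define I where "I n = idl.span (J \<union> u ` {..<n})" for n
    have "idl.subspace (I n) \<and> J \<subseteq> I n \<and> I n \<subseteq> I (Suc n)" for n
    proof (intro conjI)
      show "idl.subspace (I n)" unfolding I_def by simp
      show "J \<subseteq> I n" unfolding I_def using idl.span_superset[of "J \<union> u ` {..<n}"] by simp
      show "I n \<subseteq> I (Suc n)" unfolding I_def by (rule idl.span_mono) auto
    qed
    then obtain n where n: "I (Suc n) = I n" using acc unfolding acc_above_def by blast
    have "u n \<in> I (Suc n)" unfolding I_def by (rule idl.span_base) auto
    then have un: "u n \<in> idl.span (J \<union> u ` {..<n})" using n unfolding I_def by simp
    have inter: "f \<in> P n" if f: "\<And>i. i < n \<Longrightarrow> f \<in> P i" for f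
    proof -
      have "idl.subspace {a. f * a \<in> J}"
        using subspace_colon[OF J, of f] unfolding colon_def by (simp add: mult.commute)
      moreover have "J \<union> u ` {..<n} \<subseteq> {a. f * a \<in> J}"
        using f idl_mult_left[OF J] unfolding u(2) colon_def by auto
      ultimately have "u n \<in> {a. f * a \<in> J}" using un idl.span_minimal by blast
      then show ?thesis unfolding u(2) colon_def by simp
    qed
    have pn: "prime_set (P n)" using prime P by blast
    \<comment> \<open>Otherwise a product of elements of \<open>P i\<close> outside
      \<open>P n\<close>, one for each \<open>i < n\<close>, would lie in \<open>P n\<close>,
      against primality.\<close>
    have "\<exists>i<n. P i \<subseteq> P n"
    proof (rule ccontr)
      assume "\<not> ?thesis"
      then have "\<exists>a. a \<in> P i \<and> a \<notin> P n" if "i < n" for i using that by blast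
      then obtain a where a: "\<And>i. i < n \<Longrightarrow> a i \<in> P i \<and> a i \<notin> P n" by metis
      have "prod a {..<n} \<in> P i" if "i < n" for i
        using prime_set_prod[of "P i" "{..<n}" a] prime P a that by blast
      then have "prod a {..<n} \<in> P n" using inter by blast
      then show False using prime_set_prod[OF pn, of "{..<n}" a] a by blast
    qed
    then obtain i where i: "i < n" "P i \<subseteq> P n" by blast
    have "P i \<in> \<P>" "P n \<in> ?A" using P(2) unfolding \<P>_def by blast+
    then have "P n = P i" using i(2) unfolding \<P>_def by blast
    then show False using P(1) i(1) by (metis injD less_irrefl)
  qed
  moreover have "M \<subseteq> \<Union>\<P>"
  proof
    fix f assume "f \<in> M"
    then obtain u where u: "u \<notin> J" "f * u \<in> J" using zd by blast
    have "colon J u \<in> ?A" using u by blast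
    from acc_maximal[OF acc this A] obtain B where "B \<in> ?A" "colon J u \<subseteq> B" "\<forall>C\<in>?A. B \<subseteq> C \<longrightarrow> C = B" by blast
    then show "f \<in> \<Union>\<P>" using u unfolding \<P>_def colon_def by blast
  qed
  ultimately obtain P where P: "P \<in> \<P>" "M \<subseteq> P" using prime_avoidance[OF _ prime M] by blast
  then obtain u where "u \<notin> J" "P = colon J u" unfolding \<P>_def by blast
  then show ?thesis using P(2) unfolding colon_def by blast
qed

text \<open>Vanishing in degree \<open>c\<close> of the Koszul cohomology of the quotient by
  \<open>J\<close>. Cochains keep their values in the ring and the conditions are read modulo
  \<open>J\<close>, so no quotient is formed.\<close>

definition koszul_zero :: "(nat \<Rightarrow> 'a::comm_ring_1) \<Rightarrow> nat set \<Rightarrow> 'a set \<Rightarrow> nat \<Rightarrow> bool" where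
  "koszul_zero x V J c \<longleftrightarrow> (\<forall>u. (\<forall>W. W \<subseteq> V \<longrightarrow> card W = Suc c \<longrightarrow> koszul_d x u W \<in> J) \<longrightarrow>
     (\<exists>w. \<forall>W. W \<subseteq> V \<longrightarrow> card W = c \<longrightarrow> u W - koszul_d x w W \<in> J))"

lemma koszul_zeroE:
  assumes "koszul_zero x V J c" and "\<And>W. W \<subseteq> V \<Longrightarrow> card W = Suc c \<Longrightarrow> koszul_d x u W \<in> J"
  obtains w where "\<And>W. W \<subseteq> V \<Longrightarrow> card W = c \<Longrightarrow> u W - koszul_d x w W \<in> J"
proof -
  have "\<exists>w. \<forall>W. W \<subseteq> V \<longrightarrow> card W = c \<longrightarrow> u W - koszul_d x w W \<in> J"
    using assms(1)[unfolded koszul_zero_def, rule_format, of u] assms(2) by blast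
  then show thesis using that by blast
qed

lemma koszul_d_in_ideal:
  assumes "idl.subspace J" "\<And>v. v \<in> W \<Longrightarrow> u (W - {v}) \<in> J"
  shows "koszul_d x u W \<in> J"
  unfolding koszul_d_def using assms by (intro idl.subspace_sum idl_mult_left) auto

text \<open>The multipliers \<open>f\<close> for which \<open>f * u\<close> is a coboundary modulo
  \<open>J\<close> form an ideal. It contains \<open>J\<close> and, by
  \<open>koszul_homotopy\<close>, each \<open>x g\<close>, with the contraction of \<open>u\<close>
  as primitive.\<close>

lemma koszul_annihilated:
  fixes x :: "nat \<Rightarrow> 'a::comm_ring_1"
  assumes fV: "finite V" and J: "idl.subspace J" and f: "f \<in> idl.span (J \<union> x ` V)"
    and u: "\<And>W. W \<subseteq> V \<Longrightarrow> card W = Suc c \<Longrightarrow> koszul_d x u W \<in> J"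
  shows "\<exists>w. \<forall>W. W \<subseteq> V \<longrightarrow> card W = c \<longrightarrow> f * u W - koszul_d x w W \<in> J"
proof -
  let ?S = "{f. \<exists>w. \<forall>W. W \<subseteq> V \<longrightarrow> card W = c \<longrightarrow> f * u W - koszul_d x w W \<in> J}"
  have "idl.subspace ?S"
  proof (rule idl.subspaceI)
    have "\<forall>W. W \<subseteq> V \<longrightarrow> card W = c \<longrightarrow> 0 * u W - koszul_d x (\<lambda>_. 0) W \<in> J"
      using idl.subspace_0[OF J] by (simp add: koszul_d_def)
    then show "0 \<in> ?S" by blast
  next
    fix a b assume "a \<in> ?S" "b \<in> ?S"
    then obtain w w' where w: "\<forall>W. W \<subseteq> V \<longrightarrow> card W = c \<longrightarrow> a * u W - koszul_d x w W \<in> J"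
      "\<forall>W. W \<subseteq> V \<longrightarrow> card W = c \<longrightarrow> b * u W - koszul_d x w' W \<in> J" by blast
    have "(a + b) * u W - koszul_d x (\<lambda>W. w W + w' W) W
      = (a * u W - koszul_d x w W) + (b * u W - koszul_d x w' W)" for W
      by (simp add: koszul_d_add algebra_simps)
    then have "\<forall>W. W \<subseteq> V \<longrightarrow> card W = c \<longrightarrow> (a + b) * u W - koszul_d x (\<lambda>W. w W + w' W) W \<in> J"
      using w idl.subspace_add[OF J] by simp
    then show "a + b \<in> ?S" by blast
  next
    fix r a assume "a \<in> ?S"
    then obtain w where w: "\<forall>W. W \<subseteq> V \<longrightarrow> card W = c \<longrightarrow> a * u W - koszul_d x w W \<in> J" by blast
    have "r * a * u W - koszul_d x (\<lambda>W. r * w W) W = r * (a * u W - koszul_d x w W)" for W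
      by (simp add: koszul_d_scale algebra_simps)
    then have "\<forall>W. W \<subseteq> V \<longrightarrow> card W = c \<longrightarrow> r * a * u W - koszul_d x (\<lambda>W. r * w W) W \<in> J"
      using w idl_mult_left[OF J] by simp
    then show "r * a \<in> ?S" by blast
  qed
  moreover have "J \<union> x ` V \<subseteq> ?S"
  proof
    fix f assume "f \<in> J \<union> x ` V"
    then show "f \<in> ?S"
    proof
      assume "f \<in> J"
      then have "\<forall>W. W \<subseteq> V \<longrightarrow> card W = c \<longrightarrow> f * u W - koszul_d x (\<lambda>_. 0) W \<in> J"
        using idl_mult_right[OF J] by (simp add: koszul_d_def)
      then show "f \<in> ?S" by blast
    next
      assume "f \<in> x ` V"
      then obtain g where g: "g \<in> V" "f = x g" by blast
      have "f * u W - koszul_d x (contraction g u) W \<in> J" if W: "W \<subseteq> V" "card W = c" for W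
      proof -
        have fW: "finite W" using W fV finite_subset by blast
        have "f * u W - koszul_d x (contraction g u) W = contraction g (koszul_d x u) W"
          using koszul_homotopy[OF fW, of x g u] g by (simp add: algebra_simps)
        also have "\<dots> \<in> J"
          using u[of "insert g W"] W g fW idl_mult_left[OF J] idl.subspace_0[OF J] by (simp add: contraction_def)
        finally show ?thesis .
      qed
      then show "f \<in> ?S" by blast
    qed
  qed
  ultimately show ?thesis using f idl.span_minimal by blast
qed

definition nonzerodivisor_mod :: "'a::comm_ring_1 set \<Rightarrow> 'a \<Rightarrow> bool" where
  "nonzerodivisor_mod J f \<longleftrightarrow> (\<forall>u. f * u \<in> J \<longrightarrow> u \<in> J)"

lemma in_span_insert: "idl.subspace J \<Longrightarrow> a \<in> idl.span (insert f J) \<longleftrightarrow> (\<exists>b. a - b * f \<in> J)"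
  using idl.span_breakdown_eq[of a f J] by (simp add: idl.span_eq_iff[THEN iffD2])

text \<open>Multiplication by \<open>f\<close> gives 0 -> A/J -> A/J -> A/(J + f) -> 0, where A is
  the ring, so H^c(A/(J + f)) lies between H^c(A/J) and H^(c+1)(A/J). The connecting map sends
  \<open>u\<close> to \<open>g\<close>, its differential divided by \<open>f\<close>.\<close>

lemma koszul_zero_quotient:
  assumes fV: "finite V" and J: "idl.subspace J" and f: "nonzerodivisor_mod J f"
    and K: "koszul_zero x V J c" "koszul_zero x V J (Suc c)"
  shows "koszul_zero x V (idl.span (insert f J)) c"
  unfolding koszul_zero_def
proof (intro allI impI)
  let ?J' = "idl.span (insert f J)"
  fix u assume "\<forall>W. W \<subseteq> V \<longrightarrow> card W = Suc c \<longrightarrow> koszul_d x u W \<in> ?J'"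
  then have "\<forall>W. \<exists>b. W \<subseteq> V \<longrightarrow> card W = Suc c \<longrightarrow> koszul_d x u W - b * f \<in> J"
    unfolding in_span_insert[OF J] by blast
  then obtain g where g: "\<And>W. W \<subseteq> V \<Longrightarrow> card W = Suc c \<Longrightarrow> koszul_d x u W - g W * f \<in> J" by metis
  have "koszul_d x g W \<in> J" if W: "W \<subseteq> V" "card W = Suc (Suc c)" for W
  proof -
    have fW: "finite W" using W fV finite_subset by blast
    have "koszul_d x (\<lambda>W. koszul_d x u W - f * g W) W \<in> J"
    proof (rule koszul_d_in_ideal[OF J])
      fix v assume "v \<in> W"
      then have "W - {v} \<subseteq> V" "card (W - {v}) = Suc c" using W fW by (auto simp: card_Diff_singleton)
      then show "koszul_d x u (W - {v}) - f * g (W - {v}) \<in> J" using g by (simp add: mult.commute)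
    qed
    then have "- (f * koszul_d x g W) \<in> J"
      unfolding koszul_d_diff koszul_d_scale koszul_d_d[OF fW] by simp
    then have "f * koszul_d x g W \<in> J" using idl.subspace_neg[OF J] by fastforce
    then show ?thesis using f unfolding nonzerodivisor_mod_def by blast
  qed
  then obtain w where w: "\<And>W. W \<subseteq> V \<Longrightarrow> card W = Suc c \<Longrightarrow> g W - koszul_d x w W \<in> J"
    by (rule koszul_zeroE[OF K(2), of g]) blast+
  have "koszul_d x (\<lambda>W. u W - f * w W) W \<in> J" if W: "W \<subseteq> V" "card W = Suc c" for W
  proof -
    have "koszul_d x (\<lambda>W. u W - f * w W) W = (koszul_d x u W - g W * f) + f * (g W - koszul_d x w W)"
      unfolding koszul_d_diff koszul_d_scale by (simp add: algebra_simps)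
    then show ?thesis using g[OF W] w[OF W] idl.subspace_add[OF J] idl_mult_left[OF J] by simp
  qed
  then obtain z where z: "\<And>W. W \<subseteq> V \<Longrightarrow> card W = c \<Longrightarrow> (u W - f * w W) - koszul_d x z W \<in> J"
    by (rule koszul_zeroE[OF K(1), of "\<lambda>W. u W - f * w W"]) blast+
  show "\<exists>w. \<forall>W. W \<subseteq> V \<longrightarrow> card W = c \<longrightarrow> u W - koszul_d x w W \<in> ?J'"
  proof (intro exI[of _ z] allI impI)
    fix W assume "W \<subseteq> V" "card W = c"
    then have "u W - koszul_d x z W - w W * f \<in> J" using z by (simp add: algebra_simps)
    then show "u W - koszul_d x z W \<in> ?J'" unfolding in_span_insert[OF J] by blast
  qed
qed

text \<open>In the same sequence \<open>f\<close> acts as zero on H^(c+1)(A/J), so the connecting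
  map from H^c(A/(J + f)) is onto. Concretely \<open>f * u\<close> is the differential of
  \<open>w\<close>; writing \<open>w\<close> as a differential plus \<open>f * y\<close> and
  cancelling \<open>f\<close> makes \<open>u\<close> the differential of \<open>y\<close>, all
  modulo \<open>J\<close>.\<close>

lemma koszul_zero_lift:
  assumes fV: "finite V" and J: "idl.subspace J" and f: "nonzerodivisor_mod J f"
    and fx: "f \<in> idl.span (J \<union> x ` V)" and K: "koszul_zero x V (idl.span (insert f J)) c"
  shows "koszul_zero x V J (Suc c)"
  unfolding koszul_zero_def
proof (intro allI impI)
  let ?J' = "idl.span (insert f J)"
  fix u assume u: "\<forall>W. W \<subseteq> V \<longrightarrow> card W = Suc (Suc c) \<longrightarrow> koszul_d x u W \<in> J"
  then obtain w where w: "\<And>W. W \<subseteq> V \<Longrightarrow> card W = Suc c \<Longrightarrow> f * u W - koszul_d x w W \<in> J"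
    using koszul_annihilated[OF fV J fx, of "Suc c" u] by blast
  have "koszul_d x w W \<in> ?J'" if W: "W \<subseteq> V" "card W = Suc c" for W
    unfolding in_span_insert[OF J] using idl.subspace_neg[OF J w[OF W]]
    by (intro exI[of _ "u W"]) (simp add: mult.commute)
  then obtain z where z: "\<And>W. W \<subseteq> V \<Longrightarrow> card W = c \<Longrightarrow> w W - koszul_d x z W \<in> ?J'"
    by (rule koszul_zeroE[OF K, of w]) blast+
  then have "\<forall>W. \<exists>b. W \<subseteq> V \<longrightarrow> card W = c \<longrightarrow> w W - koszul_d x z W - b * f \<in> J"
    unfolding in_span_insert[OF J] by blast
  then obtain y where y: "\<And>W. W \<subseteq> V \<Longrightarrow> card W = c \<Longrightarrow> w W - koszul_d x z W - y W * f \<in> J" by metis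
  have "u W - koszul_d x y W \<in> J" if W: "W \<subseteq> V" "card W = Suc c" for W
  proof -
    have fW: "finite W" using W fV finite_subset by blast
    have "koszul_d x (\<lambda>W. w W - koszul_d x z W - f * y W) W \<in> J"
    proof (rule koszul_d_in_ideal[OF J])
      fix v assume "v \<in> W"
      then have "W - {v} \<subseteq> V" "card (W - {v}) = c" using W fW by (auto simp: card_Diff_singleton)
      then show "w (W - {v}) - koszul_d x z (W - {v}) - f * y (W - {v}) \<in> J"
        using y by (simp add: mult.commute)
    qed
    then have "koszul_d x w W - f * koszul_d x y W \<in> J"
      unfolding koszul_d_diff koszul_d_scale koszul_d_d[OF fW] by simp
    then have "(f * u W - koszul_d x w W) + (koszul_d x w W - f * koszul_d x y W) \<in> J"
      using w[OF W] idl.subspace_add[OF J] by blast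
    then have "f * (u W - koszul_d x y W) \<in> J" by (simp add: algebra_simps)
    then show ?thesis using f unfolding nonzerodivisor_mod_def by blast
  qed
  then show "\<exists>w. \<forall>W. W \<subseteq> V \<longrightarrow> card W = Suc c \<longrightarrow> u W - koszul_d x w W \<in> J" by blast
qed

text \<open>A cochain of degree 0 is a single element \<open>a\<close>, its differential lists the
  products \<open>x v * a\<close>, and the only coboundary is 0.\<close>

lemma koszul_zero_0_iff:
  assumes fV: "finite V"
  shows "koszul_zero x V J 0 \<longleftrightarrow> (\<forall>a. (\<forall>v\<in>V. x v * a \<in> J) \<longrightarrow> a \<in> J)"
proof -
  have d1: "koszul_d x u {v} = x v * u {}" for u v
  proof -
    have "{w \<in> {v}. w < v} = {}" by auto
    then have "inc_sign v {v} = (1::'a)" unfolding inc_sign_def by (simp only: card.empty power_0)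
    then show ?thesis by (simp add: koszul_d_def)
  qed
  have d0: "koszul_d x u {} = 0" for u by (simp add: koszul_d_def)
  show ?thesis
  proof
    assume K: "koszul_zero x V J 0"
    show "\<forall>a. (\<forall>v\<in>V. x v * a \<in> J) \<longrightarrow> a \<in> J"
    proof (intro allI impI)
      fix a assume a: "\<forall>v\<in>V. x v * a \<in> J"
      have "koszul_d x (\<lambda>_. a) W \<in> J" if W: "W \<subseteq> V" "card W = Suc 0" for W
      proof -
        obtain v where "W = {v}" using W(2) card_1_singletonE by auto
        then show ?thesis using a W(1) d1 by simp
      qed
      then obtain w where "\<And>W. W \<subseteq> V \<Longrightarrow> card W = 0 \<Longrightarrow> a - koszul_d x w W \<in> J"
        by (rule koszul_zeroE[OF K, of "\<lambda>_. a"]) blast+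
      from this[of "{}"] show "a \<in> J" by (simp add: d0)
    qed
  next
    assume *: "\<forall>a. (\<forall>v\<in>V. x v * a \<in> J) \<longrightarrow> a \<in> J"
    show "koszul_zero x V J 0"
      unfolding koszul_zero_def
    proof (intro allI impI exI)
      fix u W assume u: "\<forall>W. W \<subseteq> V \<longrightarrow> card W = Suc 0 \<longrightarrow> koszul_d x u W \<in> J"
        and W: "W \<subseteq> V" "card W = 0"
      have "finite W" using W(1) fV by (rule finite_subset)
      then have "W = {}" using W(2) by simp
      moreover have "x v * u {} \<in> J" if "v \<in> V" for v using u[rule_format, of "{v}"] that d1 by simp
      ultimately show "u W - koszul_d x (\<lambda>_. 0) W \<in> J" using * d0 by simp
    qed
  qed
qed

text \<open>The other half of \<open>regular_sequence\<close>, properness of the final ideal, is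
  settled by \<open>one_notin_max\<close>.\<close>

fun regular_mod :: "'a::comm_ring_1 set \<Rightarrow> 'a list \<Rightarrow> bool" where
  "regular_mod J [] \<longleftrightarrow> True"
| "regular_mod J (f # fs) \<longleftrightarrow> nonzerodivisor_mod J f \<and> regular_mod (idl.span (insert f J)) fs"

text \<open>In degree 0, an element that every \<open>x v\<close> sends into \<open>J\<close> is
  also sent there by \<open>f\<close>, hence lies in \<open>J\<close>. Higher degrees are lifted
  from the quotient by \<open>f\<close>, each at the cost of one element of the sequence.\<close>

lemma regular_mod_koszul_zero:
  assumes fV: "finite V" and "idl.subspace J" "set fs \<subseteq> idl.span (J \<union> x ` V)" "regular_mod J fs" "c < length fs"
  shows "koszul_zero x V J c"
  using assms(2-)
proof (induction fs arbitrary: J c)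
  case (Cons f fs)
  let ?J' = "idl.span (insert f J)"
  have f: "nonzerodivisor_mod J f" "f \<in> idl.span (J \<union> x ` V)" using Cons.prems by auto
  show ?case
  proof (cases c)
    case 0
    have "a \<in> J" if a: "\<forall>v\<in>V. x v * a \<in> J" for a
    proof -
      have "idl.span (J \<union> x ` V) \<subseteq> colon J a"
        by (rule idl.span_minimal[OF _ subspace_colon[OF Cons.prems(1)]])
          (use a idl_mult_right[OF Cons.prems(1)] in \<open>auto simp: colon_def\<close>)
      then have "f * a \<in> J" using f(2) unfolding colon_def by blast
      then show ?thesis using f(1) unfolding nonzerodivisor_mod_def by blast
    qed
    then show ?thesis unfolding 0 koszul_zero_0_iff[OF fV] by blast
  next
    case (Suc c')
    have "idl.span (J \<union> x ` V) \<subseteq> idl.span (?J' \<union> x ` V)"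
      by (rule idl.span_mono) (use idl.span_superset in blast)
    then have "koszul_zero x V ?J' c'"
      by (intro Cons.IH) (use Cons.prems Suc in auto)
    then show ?thesis unfolding Suc by (rule koszul_zero_lift[OF fV Cons.prems(1) f])
  qed
qed simp

lemma koszul_zero_regular_mod:
  assumes fV: "finite V" and "idl.subspace J" "acc_above J" "\<And>c. c < r \<Longrightarrow> koszul_zero x V J c"
  shows "\<exists>fs. length fs = r \<and> set fs \<subseteq> idl.span (J \<union> x ` V) \<and> regular_mod J fs"
  using assms(2-)
proof (induction r arbitrary: J)
  case (Suc r)
  let ?M = "idl.span (J \<union> x ` V)"
  have "\<exists>f\<in>?M. nonzerodivisor_mod J f"
  proof (rule ccontr)
    assume "\<not> ?thesis"
    then have "\<exists>u. u \<notin> J \<and> f * u \<in> J" if "f \<in> ?M" for f using that unfolding nonzerodivisor_mod_def by blast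
    then obtain u where u: "u \<notin> J" "\<forall>f\<in>?M. f * u \<in> J"
      using zero_divisors_common_annihilator[OF Suc.prems(1,2), of ?M] by blast
    have "x v * u \<in> J" if "v \<in> V" for v using u(2) that by (auto intro: idl.span_base)
    then show False using Suc.prems(3)[of 0] u(1) unfolding koszul_zero_0_iff[OF fV] by blast
  qed
  then obtain f where f: "f \<in> ?M" "nonzerodivisor_mod J f" by blast
  let ?J' = "idl.span (insert f J)"
  have "J \<subseteq> ?J'" using idl.span_superset by blast
  have "\<exists>fs. length fs = r \<and> set fs \<subseteq> idl.span (?J' \<union> x ` V) \<and> regular_mod ?J' fs"
  proof (rule Suc.IH)
    show "acc_above ?J'" using Suc.prems(2) \<open>J \<subseteq> ?J'\<close> by (rule acc_above_mono)
    show "koszul_zero x V ?J' c" if "c < r" for c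
      by (rule koszul_zero_quotient[OF fV Suc.prems(1) f(2)]) (use Suc.prems(3) that in auto)
  qed simp
  then obtain fs where fs: "length fs = r" "set fs \<subseteq> idl.span (?J' \<union> x ` V)" "regular_mod ?J' fs" by blast
  \<comment> \<open>Since \<open>f\<close> is already in \<open>?M\<close>, enlarging
    \<open>J\<close> by \<open>f\<close> does not enlarge the ideal from which the sequence is
    drawn.\<close>
  have "?J' \<union> x ` V \<subseteq> ?M"
  proof -
    have "insert f J \<subseteq> ?M" using f(1) idl.span_superset by blast
    then have "?J' \<subseteq> ?M" by (rule idl.span_minimal) simp
    then show ?thesis using idl.span_superset[of "J \<union> x ` V"] by simp
  qed
  then have "idl.span (?J' \<union> x ` V) \<subseteq> ?M" by (rule idl.span_minimal) simp
  then show ?case using fs f by (intro exI[of _ "f # fs"]) auto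
qed simp

section \<open>Koszul cohomology of the face ideal\<close>

lemma lookup_single_mult:
  fixes t :: "nat \<Rightarrow>\<^sub>0 nat" and a :: "'k::comm_ring_1"
  shows "lookup (single t a * p) (t + m) = a * lookup p m"
    and "(\<And>m. s \<noteq> t + m) \<Longrightarrow> lookup (single t a * p) s = 0"
proof -
  have p: "p = (\<Sum>m\<in>keys p. single m (lookup p m))"
    by (rule poly_mapping_eqI) (simp add: lookup_sum lookup_single when_def in_keys_iff)
  have *: "single t a * p = (\<Sum>m\<in>keys p. single (t + m) (a * lookup p m))"
    by (subst p) (simp add: sum_distrib_left mult_single)
  show "lookup (single t a * p) (t + m) = a * lookup p m"
    unfolding * by (simp add: lookup_sum lookup_single when_def in_keys_iff)
  show "lookup (single t a * p) s = 0" if s: "\<And>m. s \<noteq> t + m"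
    unfolding * lookup_sum
  proof (rule sum.neutral, rule ballI)
    fix m
    have "t + m \<noteq> s" using s[of m] by (rule not_sym)
    then show "lookup (single (t + m) (a * lookup p m)) s = 0"
      by (rule lookup_single_not_eq)
  qed
qed

lemma lookup_Var_mult:
  "lookup (Var k v * p) m =
    (if v \<in> keys m then lookup p (m - single v 1) else 0)"
proof (cases "v \<in> keys m")
  case True
  then have "m = single v 1 + (m - single v 1)"
    by (intro poly_mapping_eqI) (auto simp: lookup_add lookup_minus lookup_single when_def in_keys_iff)
  then show ?thesis using True lookup_single_mult(1)[of "single v 1" 1 p "m - single v 1"]
    unfolding Var_def by simp
next
  case False
  then have "m \<noteq> single v 1 + m'" for m'
    by (auto simp: in_keys_iff lookup_add)
  then show ?thesis using False lookup_single_mult(2) unfolding Var_def by metis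
qed

text \<open>Matches the sign as a scalar with the sign as a polynomial, so that it can be taken out
  of a coefficient.\<close>

lemma inc_sign_cases:
  "inc_sign v W = (1::'a::comm_ring_1) \<and> inc_sign v W = (1::'b::comm_ring_1) \<or>
   inc_sign v W = (-1::'a) \<and> inc_sign v W = (-1::'b)"
  unfolding inc_sign_def by (cases "even (card {u\<in>W. u < v})") simp_all

lemma lookup_inc_sign_mult:
  "lookup (inc_sign v W * p) m = inc_sign v W * lookup (p :: ('k::comm_ring_1) mpoly) m"
  using inc_sign_cases[of v W, where 'a='k and 'b="'k mpoly"] by auto

lemma lookup_koszul_d_Var:
  "lookup (koszul_d (Var k) u W) m = (\<Sum>v\<in>W. inc_sign v W *
     (if v \<in> keys m then lookup (u (W - {v})) (m - single v 1) else 0))"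
  unfolding koszul_d_def by (simp add: lookup_sum mult.assoc lookup_inc_sign_mult lookup_Var_mult)

text \<open>The ideal \<open>J\<close> of the overview, described by coefficients: modulo it, the
  monomials supported on faces form a basis.\<close>

definition face_ideal :: "nat set set \<Rightarrow> ('k::comm_ring_1) mpoly set" where
  "face_ideal \<Delta> = {p. \<forall>m. keys m \<in> \<Delta> \<longrightarrow> lookup p m = 0}"

lemma keys_add_nat: "keys (a + b) = keys a \<union> keys (b :: 'a \<Rightarrow>\<^sub>0 nat)"
  by (auto simp: in_keys_iff lookup_add)

lemma subspace_face_ideal:
  assumes "is_complex \<Delta>"
  shows "idl.subspace (face_ideal \<Delta> :: ('k::comm_ring_1) mpoly set)"
proof (rule idl.subspaceI)
  fix c a :: "'k mpoly" assume a: "a \<in> face_ideal \<Delta>"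
  have "lookup (c * a) m = 0" if m: "keys m \<in> \<Delta>" for m
  proof (rule ccontr)
    assume "lookup (c * a) m \<noteq> 0"
    then have "m \<in> keys (c * a)" by (simp add: in_keys_iff)
    then obtain s t where st: "m = s + t" "t \<in> keys a"
      using keys_mult[of c a] by blast
    then have "keys t \<in> \<Delta>" using m assms unfolding is_complex_def st(1) keys_add_nat by blast
    then show False using a st(2) unfolding face_ideal_def by (simp add: in_keys_iff)
  qed
  then show "c * a \<in> face_ideal \<Delta>" unfolding face_ideal_def by blast
qed (simp_all add: face_ideal_def lookup_add)

text \<open>For \<open>N \<subseteq> W\<close>, the sign of the permutation listing
  \<open>W - N\<close> before \<open>N\<close>: its inversions are the pairs \<open>a < b\<close>
  with \<open>a\<close> in \<open>N\<close> and \<open>b\<close> in \<open>W - N\<close>.\<close>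

definition shuffle_sign :: "nat set \<Rightarrow> nat set \<Rightarrow> 'a::comm_ring_1" where
  "shuffle_sign N W = (\<Prod>b\<in>W - N. (-1) ^ card {a\<in>N. a < b})"

lemma shuffle_sign_sq [simp]: "shuffle_sign N W * shuffle_sign N W = (1::'a::comm_ring_1)"
  unfolding shuffle_sign_def prod.distrib[symmetric] by (simp flip: power_add mult_2)

lemma shuffle_sign_sq_left [simp]: "shuffle_sign N W * (shuffle_sign N W * a) = (a::'a::comm_ring_1)"
  by (simp flip: mult.assoc)

lemma shuffle_sign_neq_0 [simp]: "shuffle_sign N W \<noteq> (0::'a::comm_ring_1)"
  using shuffle_sign_sq[of N W, where 'a='a] by (metis mult_zero_left zero_neq_one)

text \<open>The predecessors of \<open>w\<close> in \<open>W\<close> split into those in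
  \<open>N\<close>, accounted for by the shuffle sign, and those in \<open>W - N\<close>.\<close>

lemma inc_sign_shuffle:
  assumes "finite W" "N \<subseteq> W" "w \<in> W - N"
  shows "inc_sign w W * shuffle_sign N (W - {w}) = shuffle_sign N W * (inc_sign w (W - N) :: 'a::comm_ring_1)"
proof -
  have fN: "finite N" using assms finite_subset by blast
  have "shuffle_sign N W = (-1) ^ card {a\<in>N. a < w} * (shuffle_sign N (W - {w}) :: 'a)"
  proof -
    have "W - N - {w} = W - {w} - N" by blast
    then show ?thesis unfolding shuffle_sign_def using assms by (subst prod.remove[of _ w]) auto
  qed
  moreover have "card {u\<in>W. u < w} = card {a\<in>N. a < w} + card {u\<in>W - N. u < w}"
  proof -
    have "{u\<in>W. u < w} = {a\<in>N. a < w} \<union> {u\<in>W - N. u < w}" using assms by auto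
    then show ?thesis using assms fN by (simp add: card_Un_disjoint disjoint_iff)
  qed
  ultimately show ?thesis unfolding inc_sign_def by (simp add: power_add ac_simps)
qed

text \<open>Applied to coefficients of the Koszul differential in a fixed multidegree: the summands
  for \<open>N\<close> vanish because the monomial has exponent 0 there, and what remains is a
  simplicial coboundary.\<close>

lemma shuffle_koszul_d:
  fixes \<phi> :: "nat set \<Rightarrow> 'a::comm_ring_1"
  assumes "finite W" "N \<subseteq> W"
    and "\<And>v. v \<in> W - N \<Longrightarrow> t v = shuffle_sign N (W - {v}) * \<phi> (W - {v} - N)"
    and "\<And>v. v \<in> N \<Longrightarrow> t v = 0"
  shows "(\<Sum>v\<in>W. inc_sign v W * t v) = shuffle_sign N W * coboundary \<phi> (W - N)"
proof -
  have "(\<Sum>v\<in>W. inc_sign v W * t v) = (\<Sum>v\<in>W - N. inc_sign v W * t v)"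
    by (rule sum.mono_neutral_right) (use assms in auto)
  also have "\<dots> = (\<Sum>v\<in>W - N. shuffle_sign N W * (inc_sign v (W - N) * 1 * \<phi> (W - N - {v})))"
  proof (rule sum.cong[OF refl])
    fix v assume v: "v \<in> W - N"
    have "W - {v} - N = W - N - {v}" by blast
    then have "inc_sign v W * t v = (inc_sign v W * shuffle_sign N (W - {v})) * \<phi> (W - N - {v})"
      using assms(3)[OF v] by (simp add: mult.assoc)
    then show "inc_sign v W * t v = shuffle_sign N W * (inc_sign v (W - N) * 1 * \<phi> (W - N - {v}))"
      using inc_sign_shuffle[OF assms(1,2) v, where 'a='a] by (simp add: mult.assoc)
  qed
  finally show ?thesis by (simp add: koszul_d_def sum_distrib_left)
qed

section \<open>Multigraded pieces of the Koszul complex\<close>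

definition sqfree :: "nat set \<Rightarrow> nat \<Rightarrow>\<^sub>0 nat" where
  "sqfree A = poly_mapping_on A (\<lambda>_. 1)"

lemma lookup_sqfree: "finite A \<Longrightarrow> lookup (sqfree A) i = (if i \<in> A then 1 else 0)"
  by (simp add: sqfree_def lookup_poly_mapping_on)

lemma keys_sqfree: "finite A \<Longrightarrow> keys (sqfree A) = A"
  by (rule Set.set_eqI) (simp add: in_keys_iff lookup_sqfree)

lemma sqfree_remove: "finite A \<Longrightarrow> v \<in> A \<Longrightarrow> sqfree A - single v 1 = sqfree (A - {v})"
  by (rule poly_mapping_eqI) (auto simp: lookup_minus lookup_sqfree lookup_single when_def)

text \<open>\<open>u\<close> embeds \<open>\<phi>\<close> into the Koszul complex in the degree that
  is -1 on \<open>N\<close> and 0 elsewhere, which forces the monomial at \<open>W\<close> to be the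
  product of the variables in \<open>W - N\<close>. Reading off the coefficients of these monomials
  inverts the embedding.\<close>

lemma coh_zero_of_koszul_zero:
  fixes k :: "'k::field itself"
  assumes cx: "is_complex \<Delta>" and V: "\<Union>\<Delta> \<subseteq> V" "finite V" and N: "N \<subseteq> V"
    and K: "koszul_zero (Var k) V (face_ideal \<Delta>) (c + card N)"
  shows "coh_zero k (deletion \<Delta> N) c"
  unfolding coh_zero_def
proof (intro allI impI)
  fix \<phi> :: "nat set \<Rightarrow> 'k"
  assume cyc: "\<forall>F\<in>deletion \<Delta> N. card F = Suc c \<longrightarrow> coboundary \<phi> F = 0"
  have fN: "finite N" using N V finite_subset by blast
  define u where "u W = (if N \<subseteq> W then single (sqfree (W - N)) (shuffle_sign N W * \<phi> (W - N)) else 0)" for W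
  have "koszul_d (Var k) u W \<in> face_ideal \<Delta>" if W: "W \<subseteq> V" "card W = Suc (c + card N)" for W
  proof -
    have fW: "finite W" using W V finite_subset by blast
    have "lookup (koszul_d (Var k) u W) m = 0" if m: "keys m \<in> \<Delta>" for m
    proof (cases "N \<subseteq> W \<and> m = sqfree (W - N)")
      case True
      have km: "keys m = W - N" using True fW by (simp add: keys_sqfree)
      have "lookup (koszul_d (Var k) u W) m = shuffle_sign N W * coboundary \<phi> (W - N)"
        unfolding lookup_koszul_d_Var
      proof (rule shuffle_koszul_d[OF fW])
        fix v assume v: "v \<in> W - N"
        have e: "W - {v} - N = W - N - {v}" by blast
        have "m - single v 1 = sqfree (W - N - {v})"
          using sqfree_remove[of "W - N" v] True v fW by simp
        then show "(if v \<in> keys m then lookup (u (W - {v})) (m - single v 1) else 0)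
          = shuffle_sign N (W - {v}) * \<phi> (W - {v} - N)"
          using True v km by (auto simp: u_def e)
      qed (use True km in auto)
      also have "coboundary \<phi> (W - N) = 0"
      proof -
        have "W - N \<in> deletion \<Delta> N" using m km unfolding deletion_def by auto
        moreover have "card (W - N) = Suc c" using W(2) True fN by (simp add: card_Diff_subset)
        ultimately show ?thesis using cyc by blast
      qed
      finally show ?thesis by simp
    next
      case False
      \<comment> \<open>The differential preserves the multidegree, so no other monomial can occur
        at \<open>W\<close>.\<close>
      have "(if v \<in> keys m then lookup (u (W - {v})) (m - single v 1) else 0) = 0"
        if v: "v \<in> W" for v
      proof (rule ccontr)
        assume a: "\<not> ?thesis"
        then have vm: "v \<in> keys m" and NW: "N \<subseteq> W - {v}"
          and eq: "m - single v 1 = sqfree (W - {v} - N)"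
          by (auto simp: u_def lookup_single when_def split: if_splits)
        have "m = sqfree (W - N)"
        proof (rule poly_mapping_eqI)
          fix i
          have "lookup m i - (if v = i then 1 else 0) = (if i \<in> W - {v} - N then 1 else 0)"
            using arg_cong[OF eq, of "\<lambda>p. lookup p i"]
            unfolding lookup_minus lookup_single when_def lookup_sqfree[OF finite_Diff[OF finite_Diff[OF fW]]] .
          then show "lookup m i = lookup (sqfree (W - N)) i"
            using vm v NW fW by (cases "v = i") (auto simp: lookup_sqfree in_keys_iff)
        qed
        then show False using False NW by blast
      qed
      then show ?thesis unfolding lookup_koszul_d_Var by (intro sum.neutral) simp
    qed
    then show ?thesis unfolding face_ideal_def by blast
  qed
  then obtain w where w: "\<And>W. W \<subseteq> V \<Longrightarrow> card W = c + card N \<Longrightarrow> u W - koszul_d (Var k) w W \<in> face_ideal \<Delta>"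
    by (rule koszul_zeroE[OF K, of u]) blast+
  define \<psi> where "\<psi> G = shuffle_sign N (G \<union> N) * lookup (w (G \<union> N)) (sqfree G)" for G
  show "\<exists>\<psi>. \<forall>F\<in>deletion \<Delta> N. card F = c \<longrightarrow> \<phi> F = coboundary \<psi> F"
  proof (intro exI[of _ \<psi>] ballI impI)
    fix F assume F: "F \<in> deletion \<Delta> N" "card F = c"
    let ?W = "F \<union> N"
    have FN: "F \<inter> N = {}" and FD: "F \<in> \<Delta>" using F unfolding deletion_def by auto
    have fF: "finite F" using FD cx unfolding is_complex_def by blast
    have W: "?W \<subseteq> V" "card ?W = c + card N" "?W - N = F" using F FD V N FN fF fN by (auto simp: card_Un_disjoint)
    have "lookup (u ?W - koszul_d (Var k) w ?W) (sqfree F) = 0"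
      using w[OF W(1,2)] FD fF unfolding face_ideal_def by (simp add: keys_sqfree)
    then have "shuffle_sign N ?W * \<phi> F = lookup (koszul_d (Var k) w ?W) (sqfree F)"
      using W by (simp add: lookup_minus u_def)
    also have "\<dots> = shuffle_sign N ?W * coboundary \<psi> (?W - N)"
      unfolding lookup_koszul_d_Var
    proof (rule shuffle_koszul_d)
      fix v assume "v \<in> ?W - N"
      then have v: "v \<in> F" by auto
      have e: "?W - {v} - N = F - {v}" "F - {v} \<union> N = ?W - {v}" using v FN by auto
      show "(if v \<in> keys (sqfree F)
          then lookup (w (?W - {v})) (sqfree F - single v 1) else 0)
         = shuffle_sign N (?W - {v}) * \<psi> (?W - {v} - N)"
        using v fF sqfree_remove[OF fF v] by (simp add: e \<psi>_def keys_sqfree del: Un_Diff)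
    qed (use fF fN FN in \<open>auto simp: keys_sqfree\<close>)
    finally have "shuffle_sign N ?W * (shuffle_sign N ?W * \<phi> F) = shuffle_sign N ?W * (shuffle_sign N ?W * coboundary \<psi> F)"
      using W(3) by simp
    then show "\<phi> F = coboundary \<psi> F" by simp
  qed
qed

text \<open>
  The degree in \<open>Z^n\<close> of the Koszul cochain supported at \<open>W\<close> with value the monomial \<open>m\<close>. Its entries may
  be \<open>-1\<close>, and these occur only inside \<open>W\<close>.
\<close>

definition multidegree :: "(nat \<Rightarrow>\<^sub>0 nat) \<Rightarrow> nat set \<Rightarrow> nat \<Rightarrow> int" where
  "multidegree m W i = int (lookup m i) - (if i \<in> W then 1 else 0)"

lemma multidegree_inj: "multidegree m W = multidegree m' W \<Longrightarrow> m = m'"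
  by (rule poly_mapping_eqI) (metis add_diff_cancel_right diff_add_cancel multidegree_def of_nat_eq_iff)

lemma multidegree_remove:
  assumes "v \<in> W" "v \<in> keys m"
  shows "multidegree (m - single v 1) (W - {v}) = multidegree m W"
proof
  fix i
  show "multidegree (m - single v 1) (W - {v}) i = multidegree m W i"
    using assms by (auto simp: multidegree_def lookup_minus lookup_single when_def in_keys_iff of_nat_diff)
qed

text \<open>
  Let \<open>N\<close> and \<open>G\<close> be the sets of indices where the degree \<open>a\<close> is \<open>-1\<close> and positive. Up to the shuffle sign,
  \<open>W \<mapsto> W - N\<close> identifies the part of degree \<open>a\<close> with cochains on the sets \<open>F\<close> disjoint from \<open>N\<close> with
  \<open>F \<union> G \<in> \<Delta>\<close>; if \<open>G\<close> is nonempty these form a cone.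
\<close>

lemma koszul_multidegree_solution:
  fixes k :: "'k::field itself"
  assumes cx: "is_complex \<Delta>" and V: "\<Union>\<Delta> \<subseteq> V" "finite V"
    and coh: "\<And>N c'. N \<subseteq> V \<Longrightarrow> c' + card N = c \<Longrightarrow> coh_zero k (deletion \<Delta> N) c'"
    and u: "\<And>W. W \<subseteq> V \<Longrightarrow> card W = Suc c \<Longrightarrow> koszul_d (Var k) u W \<in> face_ideal \<Delta>"
  shows "\<exists>b::nat set \<Rightarrow> 'k. \<forall>W m. W \<subseteq> V \<longrightarrow> card W = c \<longrightarrow> multidegree m W = a \<longrightarrow> keys m \<in> \<Delta> \<longrightarrow>
     lookup (u W) m = (\<Sum>v\<in>W. inc_sign v W * (if v \<in> keys m then b (W - {v}) else 0))"
proof (cases "\<exists>W m. W \<subseteq> V \<and> card W = c \<and> multidegree m W = a")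
  case True
  then obtain W0 m0 where W0: "W0 \<subseteq> V" "card W0 = c" "multidegree m0 W0 = a" by blast
  define N where "N = {i. a i = -1}"
  define G where "G = {i. a i \<ge> 1}"
  define \<Gamma> where "\<Gamma> = {F. F \<union> G \<in> \<Delta> \<and> F \<inter> N = {}}"
  have fW0: "finite W0" using W0 V finite_subset by blast
  have NW: "N \<subseteq> W" if "multidegree m W = a" for m W
    using that unfolding N_def multidegree_def by (auto split: if_splits)
  have keysm: "keys m = (W - N) \<union> G" if "multidegree m W = a" for m W
    using that unfolding N_def G_def multidegree_def by (auto simp: in_keys_iff split: if_splits)
  have NG: "N \<inter> G = {}" unfolding N_def G_def by auto
  have N0: "N \<subseteq> W0" using NW W0(3) by blast
  then have fN: "finite N" and NV: "N \<subseteq> V" using fW0 W0 finite_subset by blast+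
  have ge: "a i \<ge> -1" for i using W0(3) unfolding multidegree_def by auto
  define c' where "c' = c - card N"
  have c': "c' + card N = c" using card_mono[OF fW0 N0] W0(2) unfolding c'_def by simp
  \<comment> \<open>The only monomial that has degree \<open>a\<close> at \<open>W\<close>. Outside
    \<open>keys m0 \<union> W0\<close> the degree \<open>a\<close> is 0, which makes the support
    finite.\<close>
  define E where "E W = poly_mapping_on (W \<union> keys m0 \<union> W0) (\<lambda>i. nat (a i + (if i \<in> W then 1 else 0)))" for W
  have E: "multidegree (E W) W = a" if W: "finite W" "N \<subseteq> W" for W
  proof
    fix i
    have "a i + (if i \<in> W then 1 else 0) \<ge> 0" using ge[of i] W(2) unfolding N_def by (cases "a i = -1") auto
    moreover have "a i = 0" if "i \<notin> keys m0" "i \<notin> W0"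
      using W0(3) that unfolding multidegree_def by (auto simp: in_keys_iff)
    ultimately show "multidegree (E W) W i = a i"
      using W fW0 unfolding multidegree_def E_def
      by (cases "i \<in> W") (auto simp: lookup_poly_mapping_on)
  qed
  define \<phi> where "\<phi> F = shuffle_sign N (F \<union> N) * lookup (u (F \<union> N)) (E (F \<union> N))" for F
  have cyc: "coboundary \<phi> F = 0" if F: "F \<in> \<Gamma>" "card F = Suc c'" for F
  proof -
    let ?W = "F \<union> N"
    have FG: "F \<union> G \<in> \<Delta>" and FN: "F \<inter> N = {}" using F unfolding \<Gamma>_def by auto
    have FD: "F \<in> \<Delta>" using FG cx unfolding is_complex_def by blast
    then have fF: "finite F" "F \<subseteq> V" using cx V unfolding is_complex_def by blast+
    have W: "finite ?W" "?W \<subseteq> V" "card ?W = Suc c" "?W - N = F"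
      using fF fN NV FN F c' by (auto simp: card_Un_disjoint)
    have deg: "multidegree (E ?W) ?W = a" by (rule E) (use W in auto)
    have km: "keys (E ?W) = F \<union> G" using keysm[OF deg] W(4) by simp
    have "0 = lookup (koszul_d (Var k) u ?W) (E ?W)"
      using u[OF W(2,3)] km FG unfolding face_ideal_def by simp
    also have "\<dots> = shuffle_sign N ?W * coboundary \<phi> (?W - N)"
      unfolding lookup_koszul_d_Var
    proof (rule shuffle_koszul_d[OF W(1)])
      fix v assume v: "v \<in> ?W - N"
      then have vF: "v \<in> F" by auto
      have e: "?W - {v} - N \<union> N = ?W - {v}" using v FN by auto
      have "multidegree (E ?W - single v 1) (?W - {v}) = a"
        using multidegree_remove[of v ?W "E ?W"] deg vF km by simp
      moreover have "multidegree (E (?W - {v})) (?W - {v}) = a" by (rule E) (use W v in auto)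
      ultimately have "E ?W - single v 1 = E (?W - {v})" using multidegree_inj by metis
      then show "(if v \<in> keys (E ?W)
           then lookup (u (?W - {v})) (E ?W - single v 1) else 0)
         = shuffle_sign N (?W - {v}) * \<phi> (?W - {v} - N)"
        using vF km unfolding \<phi>_def e by simp
    qed (use km NG FN in auto)
    finally show ?thesis using W(4) by simp
  qed
  have "\<exists>\<psi>. \<forall>F\<in>\<Gamma>. card F = c' \<longrightarrow> \<phi> F = coboundary \<psi> F"
  proof (cases "G = {}")
    case True
    then have "\<Gamma> = deletion \<Delta> N" unfolding \<Gamma>_def deletion_def by simp
    then have "coh_zero k \<Gamma> c'" using coh[OF NV c'] by simp
    then obtain \<psi> where "\<And>F. F \<in> \<Gamma> \<Longrightarrow> card F = c' \<Longrightarrow> \<phi> F = coboundary \<psi> F"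
      by (rule coh_zeroE[of k \<Gamma> c' \<phi>]) (use cyc in blast)+
    then show ?thesis by blast
  next
    case False
    \<comment> \<open>\<open>g\<close> is an apex: adding it to a member of \<open>\<Gamma>\<close>
      never leaves \<open>\<Gamma>\<close>, so the contraction of \<open>\<phi>\<close> by
      \<open>g\<close> is a primitive.\<close>
    then obtain g where g: "g \<in> G" by blast
    have "\<phi> F = coboundary (contraction g \<phi>) F" if F: "F \<in> \<Gamma>" "card F = c'" for F
    proof -
      have FG: "F \<union> G \<in> \<Delta>" "F \<inter> N = {}" using F unfolding \<Gamma>_def by auto
      then have fF: "finite F" using cx unfolding is_complex_def by (metis finite_Un)
      have "insert g F \<union> G = F \<union> G" using g by auto
      then have "insert g F \<in> \<Gamma>" using FG g NG unfolding \<Gamma>_def by auto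
      then have "contraction g (coboundary \<phi>) F = 0"
        using cyc[of "insert g F"] F fF by (simp add: contraction_def)
      then show ?thesis using koszul_homotopy[OF fF, of "\<lambda>_. 1" g \<phi>] by simp
    qed
    then show ?thesis by blast
  qed
  then obtain \<psi> where \<psi>: "\<And>F. F \<in> \<Gamma> \<Longrightarrow> card F = c' \<Longrightarrow> \<phi> F = coboundary \<psi> F" by blast
  show ?thesis
  proof (intro exI[of _ "\<lambda>W. shuffle_sign N W * \<psi> (W - N)"] allI impI)
    fix W m assume W: "W \<subseteq> V" "card W = c" and deg: "multidegree m W = a" and m: "keys m \<in> \<Delta>"
    have fW: "finite W" using W V finite_subset by blast
    note NW = NW[OF deg] and keysm = keysm[OF deg]
    have WN: "W - N \<union> N = W" using NW by auto
    have "W - N \<in> \<Gamma>" using m keysm unfolding \<Gamma>_def by auto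
    moreover have "card (W - N) = c'" using W(2) NW fN by (simp add: card_Diff_subset c'_def)
    ultimately have "\<phi> (W - N) = coboundary \<psi> (W - N)" using \<psi> by blast
    moreover have "E W = m" using E[OF fW NW] deg multidegree_inj by metis
    ultimately have "shuffle_sign N W * lookup (u W) m = coboundary \<psi> (W - N)"
      unfolding \<phi>_def WN by simp
    then have "lookup (u W) m = shuffle_sign N W * coboundary \<psi> (W - N)"
      by (metis shuffle_sign_sq_left)
    also have "\<dots> = (\<Sum>v\<in>W. inc_sign v W * (if v \<in> keys m then shuffle_sign N (W - {v}) * \<psi> (W - {v} - N) else 0))"
      by (rule shuffle_koszul_d[OF fW NW, symmetric]) (use keysm NG in auto)
    finally show "lookup (u W) m = (\<Sum>v\<in>W. inc_sign v W * (if v \<in> keys m then shuffle_sign N (W - {v}) * \<psi> (W - {v} - N) else 0))" .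
  qed
qed blast

text \<open>The problems in different multidegrees are independent. Only the finitely many degrees
  in \<open>D\<close> occur in \<open>u\<close>; choosing the zero solution in all others makes the
  assembled values of \<open>w\<close> polynomials.\<close>

lemma koszul_zero_of_coh_zero:
  fixes k :: "'k::field itself"
  assumes cx: "is_complex \<Delta>" and V: "\<Union>\<Delta> \<subseteq> V" "finite V"
    and coh: "\<And>N c'. N \<subseteq> V \<Longrightarrow> c' + card N = c \<Longrightarrow> coh_zero k (deletion \<Delta> N) c'"
  shows "koszul_zero (Var k) V (face_ideal \<Delta>) c"
  unfolding koszul_zero_def
proof (intro allI impI)
  fix u :: "nat set \<Rightarrow> 'k mpoly"
  assume u: "\<forall>W. W \<subseteq> V \<longrightarrow> card W = Suc c \<longrightarrow> koszul_d (Var k) u W \<in> face_ideal \<Delta>"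
  define sol where "sol a b \<longleftrightarrow> (\<forall>W m. W \<subseteq> V \<longrightarrow> card W = c \<longrightarrow> multidegree m W = a \<longrightarrow> keys m \<in> \<Delta> \<longrightarrow>
     lookup (u W) m = (\<Sum>v\<in>W. inc_sign v W * (if v \<in> keys m then b (W - {v}) else 0)))"
    for a and b :: "nat set \<Rightarrow> 'k"
  have ex: "\<exists>b. sol a b" for a
    unfolding sol_def by (rule koszul_multidegree_solution[OF cx V coh]) (use u in auto)
  define D where "D = (\<Union>W\<in>Pow V. (\<lambda>m. multidegree m W) ` keys (u W))"
  have finD: "finite D" unfolding D_def using V by simp
  have "\<forall>a. \<exists>b. sol a b \<and> (a \<notin> D \<longrightarrow> b = (\<lambda>_. 0))"
  proof
    fix a show "\<exists>b. sol a b \<and> (a \<notin> D \<longrightarrow> b = (\<lambda>_. 0))"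
    proof (cases "a \<in> D")
      case True then show ?thesis using ex by blast
    next
      case False
      have "lookup (u W) m = 0" if W: "W \<subseteq> V" "multidegree m W = a" for W m
      proof (rule ccontr)
        assume "lookup (u W) m \<noteq> 0"
        then have "m \<in> keys (u W)" by (simp add: in_keys_iff)
        then have "multidegree m W \<in> D" using W(1) unfolding D_def by blast
        then show False using False W(2) by simp
      qed
      then have "sol a (\<lambda>_. 0)" unfolding sol_def by simp
      then show ?thesis by blast
    qed
  qed
  then obtain B where B: "\<And>a. sol a (B a)" "\<And>a. a \<notin> D \<Longrightarrow> B a = (\<lambda>_. 0)" by metis
  define w where "w W = poly_mapping_on ((\<lambda>m. multidegree m W) -` D) (\<lambda>m. B (multidegree m W) W)" for W
  have "finite ((\<lambda>m. multidegree m W) -` D)" for W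
    by (rule finite_vimageI[OF finD]) (use multidegree_inj in \<open>auto intro: injI\<close>)
  then have w: "lookup (w W) m = B (multidegree m W) W" for W m
    unfolding w_def using B(2) by (simp add: lookup_poly_mapping_on)
  show "\<exists>w. \<forall>W. W \<subseteq> V \<longrightarrow> card W = c \<longrightarrow> u W - koszul_d (Var k) w W \<in> face_ideal \<Delta>"
  proof (intro exI[of _ w] allI impI)
    fix W assume W: "W \<subseteq> V" "card W = c"
    have "lookup (u W - koszul_d (Var k) w W) m = 0" if m: "keys m \<in> \<Delta>" for m
    proof -
      have "lookup (koszul_d (Var k) w W) m
        = (\<Sum>v\<in>W. inc_sign v W * (if v \<in> keys m then B (multidegree m W) (W - {v}) else 0))"
        unfolding lookup_koszul_d_Var w by (rule sum.cong[OF refl]) (simp add: multidegree_remove del: One_nat_def)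
      then show ?thesis using B(1)[unfolded sol_def, rule_format, OF W refl m] by (simp add: lookup_minus)
    qed
    then show "u W - koszul_d (Var k) w W \<in> face_ideal \<Delta>" unfolding face_ideal_def by blast
  qed
qed

lemma koszul_zero_iff_links:
  fixes k :: "'k::field itself"
  assumes cx: "is_complex \<Delta>" and V: "\<Union>\<Delta> \<subseteq> V" "finite V"
  shows "(\<forall>c<r. koszul_zero (Var k) V (face_ideal \<Delta>) c) \<longleftrightarrow>
    (\<forall>F\<in>\<Delta>. \<forall>c. c + card F < r \<longrightarrow> coh_zero k (link \<Delta> F) c)"
  unfolding coh_zero_links_iff_deletions[OF cx V]
proof
  assume *: "\<forall>c<r. koszul_zero (Var k) V (face_ideal \<Delta>) c"
  show "\<forall>N\<subseteq>V. \<forall>c. c + card N < r \<longrightarrow> coh_zero k (deletion \<Delta> N) c"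
    using coh_zero_of_koszul_zero[OF cx V] * by blast
next
  assume *: "\<forall>N\<subseteq>V. \<forall>c. c + card N < r \<longrightarrow> coh_zero k (deletion \<Delta> N) c"
  show "\<forall>c<r. koszul_zero (Var k) V (face_ideal \<Delta>) c"
    by (intro allI impI koszul_zero_of_coh_zero[OF cx V]) (use * in auto)
qed

section \<open>Ideals containing the face ideal\<close>

text \<open>A decreasing subsequence attains its minimum and is constant from there on.\<close>

lemma nat_seq_incseq_subseq:
  fixes f :: "nat \<Rightarrow> nat"
  obtains s :: "nat \<Rightarrow> nat" where "strict_mono s" "incseq (f \<circ> s)"
proof -
  obtain s :: "nat \<Rightarrow> nat" where s: "strict_mono s" "monoseq (\<lambda>n. f (s n))"
    using seq_monosub[of f] by blast
  show thesis
  proof (cases "incseq (f \<circ> s)")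
    case True then show ?thesis using s that by blast
  next
    case False
    then have dec: "decseq (\<lambda>n. f (s n))" using s(2) unfolding monoseq_iff by (simp add: o_def)
    obtain N where N: "\<And>n. f (s N) \<le> f (s n)"
      using ex_has_least_nat[of "\<lambda>_. True" _ "\<lambda>n. f (s n)"] by auto
    have "f (s (n + N)) = f (s N)" for n
      using N[of "n + N"] decseqD[OF dec, of N "n + N"] by simp
    then have "incseq (f \<circ> (\<lambda>n. s (n + N)))" by (simp add: incseq_def)
    moreover have "strict_mono (\<lambda>n. s (n + N))" using s(1) by (simp add: strict_mono_def)
    ultimately show ?thesis using that by blast
  qed
qed

text \<open>Successive subsequences make the coordinates in \<open>V\<close> nondecreasing one by
  one; all other coordinates are 0.\<close>

lemma dickson:
  fixes m :: "nat \<Rightarrow> 'a \<Rightarrow>\<^sub>0 nat"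
  assumes "finite V" and keys: "\<And>n. keys (m n) \<subseteq> V"
  obtains i j where "i < j" "\<And>v. lookup (m i) v \<le> lookup (m j) v"
proof -
  have "\<exists>s. strict_mono s \<and> (\<forall>v\<in>V. incseq (\<lambda>n. lookup (m (s n)) v))"
    using assms(1)
  proof (induction V)
    case empty
    have "strict_mono (\<lambda>n::nat. n)" by (simp add: strict_mono_def)
    then show ?case by blast
  next
    case (insert w V)
    then obtain s where s: "strict_mono s" "\<forall>v\<in>V. incseq (\<lambda>n. lookup (m (s n)) v)" by blast
    obtain t :: "nat \<Rightarrow> nat" where t: "strict_mono t" "incseq ((\<lambda>n. lookup (m (s n)) w) \<circ> t)"
      by (rule nat_seq_incseq_subseq)
    have "strict_mono (s \<circ> t)" using s(1) t(1) by (rule strict_mono_o)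
    moreover have "incseq (\<lambda>n. lookup (m ((s \<circ> t) n)) v)" if "v \<in> insert w V" for v
    proof (cases "v = w")
      case True then show ?thesis using t(2) by (simp add: o_def)
    next
      case False
      then have "incseq (\<lambda>n. lookup (m (s n)) v)" using s(2) that by blast
      then show ?thesis using strict_mono_mono[OF t(1)] unfolding incseq_def by (simp add: mono_def)
    qed
    ultimately show ?case by blast
  qed
  then obtain s where s: "strict_mono s" "\<And>v. v \<in> V \<Longrightarrow> incseq (\<lambda>n. lookup (m (s n)) v)" by blast
  have "s 0 < s 1" using s(1) by (simp add: strict_mono_def)
  moreover have "lookup (m (s 0)) v \<le> lookup (m (s 1)) v" for v
  proof (cases "v \<in> V")
    case True then show ?thesis using s(2)[of v] by (simp add: incseq_def)
  next
    case False
    then have "v \<notin> keys (m (s 0))" using keys by blast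
    then show ?thesis by (simp add: in_keys_iff)
  qed
  ultimately show thesis using that by blast
qed

text \<open>The order on exponents is lexicographic, linear and compatible with addition; with 0 as
  least element it serves as a monomial order.\<close>

lemma exponents_nonneg: "(0 :: nat \<Rightarrow>\<^sub>0 nat) \<le> t"
proof (rule ccontr)
  assume "\<not> 0 \<le> t"
  then have "t < 0" by simp
  then show False by (auto simp: less_poly_mapping.rep_eq less_fun_def)
qed

lemma exponents_le:
  fixes s t :: "nat \<Rightarrow>\<^sub>0 nat"
  assumes "\<And>v. lookup s v \<le> lookup t v"
  shows "t = (t - s) + s" "s \<le> t"
proof -
  show *: "t = (t - s) + s"
    by (rule poly_mapping_eqI) (use assms in \<open>simp add: lookup_add lookup_minus\<close>)
  have "0 + s \<le> (t - s) + s" by (rule add_right_mono[OF exponents_nonneg])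
  then show "s \<le> t" using * by simp
qed

text \<open>In a strictly descending sequence \<open>dickson\<close> would find an earlier monomial
  dividing a later one. The finite \<open>V\<close> matters: lexicographically, the variables
  themselves form an infinite descent.\<close>

lemma exponents_minimal:
  assumes V: "finite V" and S: "S \<noteq> {}" "\<And>m. m \<in> S \<Longrightarrow> keys m \<subseteq> V"
  obtains m :: "nat \<Rightarrow>\<^sub>0 nat" where "m \<in> S" "\<And>m'. m' \<in> S \<Longrightarrow> m \<le> m'"
proof (rule ccontr)
  note obt = that
  assume no: "\<not> thesis"
  have "\<exists>m'\<in>S. m' < m" if "m \<in> S" for m using obt[OF that] no by force
  then obtain nx where nx: "\<And>m. m \<in> S \<Longrightarrow> nx m \<in> S \<and> nx m < m" by metis
  obtain m0 where "m0 \<in> S" using S by blast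
  define f where "f n = (nx ^^ n) m0" for n
  have fS: "f n \<in> S" for n unfolding f_def by (induction n) (use nx \<open>m0 \<in> S\<close> in auto)
  have dec: "f j < f i" if "i < j" for i j
    using that
  proof (induction j)
    case (Suc j)
    have "f (Suc j) < f j" using nx fS[of j] by (simp add: f_def)
    then show ?case using Suc by (cases "i = j") auto
  qed simp
  obtain i j where "i < j" "\<And>v. lookup (f i) v \<le> lookup (f j) v"
    by (rule dickson[OF V, of f]) (use S(2) fS in blast)+
  then show False using exponents_le(2)[of "f i" "f j"] dec[of i j] by simp
qed

text \<open>Normal form modulo \<open>face_ideal \<Delta>\<close>.\<close>

definition face_part :: "nat set set \<Rightarrow> ('k::comm_ring_1) mpoly \<Rightarrow> 'k mpoly" where
  "face_part \<Delta> p = poly_mapping_on (keys p) (\<lambda>m. if keys m \<in> \<Delta> then lookup p m else 0)"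

lemma lookup_face_part:
  "lookup (face_part \<Delta> p) m = (if keys m \<in> \<Delta> then lookup p m else 0)"
  unfolding face_part_def by (simp add: lookup_poly_mapping_on in_keys_iff)

lemma diff_face_part: "p - face_part \<Delta> p \<in> face_ideal \<Delta>"
  unfolding face_ideal_def by (simp add: lookup_minus lookup_face_part)

lemma keys_face_part: "keys (face_part \<Delta> p) = {m\<in>keys p. keys m \<in> \<Delta>}"
  by (rule Set.set_eqI) (simp add: in_keys_iff lookup_face_part)

text \<open>Hilbert's basis theorem by leading monomials. At each strict step, take a new normal
  form with the least possible leading exponent. By \<open>dickson\<close> one of these divides a
  later one, and cancelling the later leading term yields a new element with a smaller leading
  exponent.\<close>

lemma acc_above_face_ideal:
  fixes \<Delta> :: "nat set set"
  assumes V: "\<Union>\<Delta> \<subseteq> V" "finite V"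
  shows "acc_above (face_ideal \<Delta> :: ('k::field) mpoly set)"
  unfolding acc_above_def
proof (intro allI impI, rule ccontr)
  fix I :: "nat \<Rightarrow> 'k mpoly set"
  assume I: "\<forall>n. idl.subspace (I n) \<and> face_ideal \<Delta> \<subseteq> I n \<and> I n \<subseteq> I (Suc n)"
    and no: "\<not> (\<exists>n. I (Suc n) = I n)"
  have sub: "idl.subspace (I n)" and J: "face_ideal \<Delta> \<subseteq> I n" and step: "I n \<subseteq> I (Suc n)" for n
    using I by blast+
  have mono: "I i \<subseteq> I j" if "i \<le> j" for i j using lift_Suc_mono_le[of I, OF step that] .
  define Q where "Q n = {p \<in> I (Suc n) - I n. \<forall>m\<in>keys p. keys m \<in> \<Delta>}" for n
  have Qpart: "face_part \<Delta> p \<in> Q n" if p: "p \<in> I (Suc n)" "p \<notin> I n" for p n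
  proof -
    have d: "p - face_part \<Delta> p \<in> I i" for i using diff_face_part J by blast
    have "p - (p - face_part \<Delta> p) \<in> I (Suc n)" using idl.subspace_diff[OF sub p(1) d] .
    moreover have "face_part \<Delta> p \<notin> I n" 
      using idl.subspace_add[OF sub d[of n], of "face_part \<Delta> p"] p(2) by auto
    ultimately show ?thesis unfolding Q_def by (simp add: keys_face_part)
  qed
  have Q0: "keys p \<noteq> {}" if "p \<in> Q n" for p n
  proof -
    have "0 \<in> I n" using sub idl.subspace_0 by blast
    then have "p \<noteq> 0" using that unfolding Q_def by auto
    then obtain m where "lookup p m \<noteq> 0" by (metis lookup_zero poly_mapping_eqI)
    then show ?thesis by (auto simp: in_keys_iff)
  qed
  define lm where "lm p = Max (keys p)" for p :: "'k mpoly"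
  have lm_in: "lm p \<in> keys p" if "p \<in> Q n" for p n
    unfolding lm_def by (rule Max_in) (use Q0[OF that] in simp_all)
  have lm_ge: "m \<le> lm p" if "m \<in> keys p" for p m
    unfolding lm_def by (rule Max_ge) (use that in simp_all)
  have lmV: "keys (lm p) \<subseteq> V" if "p \<in> Q n" for p n
    using lm_in[OF that] that V unfolding Q_def by blast
  have "\<exists>p. p \<in> Q n \<and> (\<forall>q\<in>Q n. lm p \<le> lm q)" for n
  proof -
    obtain p where "p \<in> I (Suc n)" "p \<notin> I n" using no step[of n] by blast
    then have "lm ` Q n \<noteq> {}" using Qpart by blast
    then obtain m where "m \<in> lm ` Q n" "\<And>m'. m' \<in> lm ` Q n \<Longrightarrow> m \<le> m'"
      by (rule exponents_minimal[OF V(2)]) (use lmV in blast)+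
    then show ?thesis by blast
  qed
  then obtain p where p: "\<And>n. p n \<in> Q n" "\<And>n q. q \<in> Q n \<Longrightarrow> lm (p n) \<le> lm q" by metis
  obtain i j where ij: "i < j" "\<And>v. lookup (lm (p i)) v \<le> lookup (lm (p j)) v"
    by (rule dickson[OF V(2), of "\<lambda>n. lm (p n)"]) (use lmV[OF p(1)] in blast)+
  define t where "t = lm (p j) - lm (p i)"
  define c where "c = lookup (p j) (lm (p j)) / lookup (p i) (lm (p i))"
  have t: "lm (p j) = t + lm (p i)" unfolding t_def by (rule exponents_le(1)[OF ij(2)])
  \<comment> \<open>\<open>p i\<close> lies in \<open>I j\<close> because \<open>i < j\<close>, so
    subtracting a multiple of it leaves an element that is still new at step
    \<open>j\<close>.\<close>
  define q where "q = p j - single t c * p i"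
  have pi: "p i \<in> I j" using p(1)[of i] mono[of "Suc i" j] ij(1) unfolding Q_def by auto
  then have s: "single t c * p i \<in> I j" using idl_mult_left[OF sub] by blast
  have pj: "p j \<in> I (Suc j)" "p j \<notin> I j" using p(1)[of j] unfolding Q_def by auto
  have "q \<in> I (Suc j)" unfolding q_def using idl.subspace_diff[OF sub pj(1)] s step by blast
  moreover have "q \<notin> I j"
  proof
    assume "q \<in> I j"
    then have "q + single t c * p i \<in> I j" using s idl.subspace_add[OF sub] by blast
    then show False using pj(2) by (simp add: q_def)
  qed
  ultimately have fq: "face_part \<Delta> q \<in> Q j" by (rule Qpart)
  have "m < lm (p j)" if m: "m \<in> keys q" for m
  proof -
    have "m \<le> lm (p j)"
    proof (rule ccontr)
      assume a: "\<not> m \<le> lm (p j)"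
      then have "lookup (p j) m = 0" using lm_ge[of m "p j"] by (auto simp: in_keys_iff)
      then have "lookup (single t c * p i) m \<noteq> 0"
        using m by (simp add: q_def in_keys_iff lookup_minus)
      then obtain m' where m': "m = t + m'" using lookup_single_mult(2) by metis
      then have "m' \<in> keys (p i)"
        using \<open>lookup (single t c * p i) m \<noteq> 0\<close>
        by (auto simp: lookup_single_mult(1) in_keys_iff)
      then have "t + m' \<le> t + lm (p i)" by (intro add_left_mono lm_ge)
      then show False using a m' t by simp
    qed
    moreover have "m \<noteq> lm (p j)"
    proof
      assume "m = lm (p j)"
      then have "lookup q m = lookup (p j) (lm (p j)) - c * lookup (p i) (lm (p i))"
        unfolding q_def lookup_minus using lookup_single_mult(1)[of t c "p i" "lm (p i)"] t by simp
      also have "\<dots> = 0" using lm_in[OF p(1)[of i]] by (simp add: c_def in_keys_iff)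
      finally show False using m by (simp add: in_keys_iff)
    qed
    ultimately show ?thesis by simp
  qed
  moreover have "lm (face_part \<Delta> q) \<in> keys q"
    using lm_in[OF fq] by (simp add: keys_face_part)
  ultimately have "lm (face_part \<Delta> q) < lm (p j)" by blast
  then show False using p(2)[OF fq] by simp
qed

section \<open>Chains of prime ideals\<close>

text \<open>Gaussian elimination: the equation \<open>b0\<close> is solved for the unknown
  \<open>a0\<close>, which removes one equation and one unknown.\<close>

lemma underdetermined_system:
  fixes M :: "'b \<Rightarrow> 'a \<Rightarrow> 'k::field"
  assumes "finite B" and "finite A" "card B < card A"
  shows "\<exists>c. (\<exists>a\<in>A. c a \<noteq> 0) \<and> (\<forall>b\<in>B. (\<Sum>a\<in>A. c a * M b a) = 0)"
  using assms
proof (induction B arbitrary: A M)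
  case empty
  then obtain a where "a \<in> A" by fastforce
  then show ?case by (intro exI[of _ "\<lambda>_. 1"]) auto
next
  case (insert b0 B)
  show ?case
  proof (cases "\<forall>a\<in>A. M b0 a = 0")
    case True
    obtain c where "\<exists>a\<in>A. c a \<noteq> 0" "\<forall>b\<in>B. (\<Sum>a\<in>A. c a * M b a) = 0"
      using insert.IH[of A M] insert.prems insert.hyps by auto
    then show ?thesis using True by (intro exI[of _ c]) auto
  next
    case False
    then obtain a0 where a0: "a0 \<in> A" "M b0 a0 \<noteq> 0" by blast
    let ?A = "A - {a0}"
    have "card B < card ?A" "finite ?A" using insert.prems insert.hyps a0 by auto
    then obtain c where c: "\<exists>a\<in>?A. c a \<noteq> 0"
      "\<forall>b\<in>B. (\<Sum>a\<in>?A. c a * (M b a - M b a0 * M b0 a / M b0 a0)) = 0"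
      using insert.IH[of ?A "\<lambda>b a. M b a - M b a0 * M b0 a / M b0 a0"] by blast
    define r where "r = - (\<Sum>a\<in>?A. c a * M b0 a) / M b0 a0"
    define c' where "c' = c(a0 := r)"
    have s: "(\<Sum>a\<in>A. c' a * M b a) = r * M b a0 + (\<Sum>a\<in>?A. c a * M b a)" for b
    proof -
      have "(\<Sum>a\<in>A. c' a * M b a) = c' a0 * M b a0 + (\<Sum>a\<in>?A. c' a * M b a)"
        by (rule sum.remove) (use a0 insert.prems in auto)
      also have "(\<Sum>a\<in>?A. c' a * M b a) = (\<Sum>a\<in>?A. c a * M b a)"
        by (rule sum.cong) (auto simp: c'_def)
      finally show ?thesis by (simp add: c'_def)
    qed
    have "(\<Sum>a\<in>A. c' a * M b a) = 0" if b: "b \<in> insert b0 B" for b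
    proof (cases "b = b0")
      case True
      then show ?thesis using a0 by (simp add: s r_def)
    next
      case False
      then have "0 = (\<Sum>a\<in>?A. c a * (M b a - M b a0 * M b0 a / M b0 a0))" using b c(2) by simp
      also have "\<dots> = (\<Sum>a\<in>?A. c a * M b a - c a * M b0 a * (M b a0 / M b0 a0))"
        by (intro sum.cong refl) (simp add: right_diff_distrib)
      also have "\<dots> = (\<Sum>a\<in>?A. c a * M b a) - (\<Sum>a\<in>?A. c a * M b0 a) * (M b a0 / M b0 a0)"
        by (simp only: sum_subtractf sum_distrib_right)
      also have "\<dots> = (\<Sum>a\<in>A. c' a * M b a)" by (simp add: s r_def)
      finally show ?thesis by simp
    qed
    moreover have "\<exists>a\<in>A. c' a \<noteq> 0" using c(1) by (auto simp: c'_def)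
    ultimately show ?thesis by blast
  qed
qed

section \<open>Algebraic dependence by counting monomials\<close>

definition bounded_exponents :: "('k::comm_ring_1) mpoly \<Rightarrow> nat \<Rightarrow> bool" where
  "bounded_exponents p D \<longleftrightarrow> (\<forall>m\<in>keys p. \<forall>i. lookup m i \<le> D)"

lemma bounded_exponents_mono: "bounded_exponents p D \<Longrightarrow> D \<le> D' \<Longrightarrow> bounded_exponents p D'"
  unfolding bounded_exponents_def by (meson le_trans)

lemma bounded_exponents_exists: "\<exists>D. bounded_exponents p D"
proof -
  let ?S = "\<Union>m\<in>keys p. lookup m ` keys m"
  have fin: "finite ?S" by simp
  have "lookup m i \<le> Max (insert 0 ?S)" if "m \<in> keys p" for m i
  proof (rule Max_ge)
    show "lookup m i \<in> insert 0 ?S"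
      by (cases "i \<in> keys m") (use that in \<open>auto simp: not_in_keys_iff_lookup_eq_zero\<close>)
  qed (use fin in simp)
  then show ?thesis unfolding bounded_exponents_def by blast
qed

lemma bounded_exponents_mult:
  assumes "bounded_exponents p D" "bounded_exponents q E"
  shows "bounded_exponents (p * q) (D + E)"
  unfolding bounded_exponents_def
proof (intro ballI allI)
  fix m i assume "m \<in> keys (p * q)"
  then obtain s t where "m = s + t" "s \<in> keys p" "t \<in> keys q"
    using keys_mult[of p q] by blast
  then show "lookup m i \<le> D + E"
    using assms unfolding bounded_exponents_def by (simp add: lookup_add add_mono)
qed

lemma bounded_exponents_1: "bounded_exponents 1 0"
  unfolding bounded_exponents_def by simp

lemma bounded_exponents_power: "bounded_exponents p D \<Longrightarrow> bounded_exponents (p ^ n) (n * D)"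
  by (induction n) (simp_all add: bounded_exponents_1 bounded_exponents_mult)

fun power_product :: "'a::comm_ring_1 list \<Rightarrow> nat list \<Rightarrow> 'a" where
  "power_product (y # ys) (n # ns) = y ^ n * power_product ys ns"
| "power_product _ _ = 1"

lemma bounded_exponents_power_product:
  assumes "\<And>y. y \<in> set ys \<Longrightarrow> bounded_exponents y D" "set ns \<subseteq> {..N}"
  shows "bounded_exponents (power_product ys ns) (length ys * (N * D))"
  using assms
proof (induction ys ns rule: power_product.induct)
  case (1 y ys n ns)
  have "bounded_exponents (y ^ n) (n * D)" using 1(2)[of y] bounded_exponents_power[of y D n] by simp
  then have "bounded_exponents (y ^ n) (N * D)" using 1 by (elim bounded_exponents_mono) simp
  moreover have "bounded_exponents (power_product ys ns) (length ys * (N * D))" using 1 by simp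
  ultimately show ?case using bounded_exponents_mult by fastforce
qed (auto intro: bounded_exponents_mono[OF bounded_exponents_1])

lemma card_bounded_face_exponents:
  fixes \<Delta> :: "nat set set" and L :: nat
  assumes cx: "is_complex \<Delta>" and d: "\<And>F. F \<in> \<Delta> \<Longrightarrow> card F \<le> d"
  defines "B \<equiv> {m :: nat \<Rightarrow>\<^sub>0 nat. keys m \<in> \<Delta> \<and> (\<forall>i. lookup m i \<le> L)}"
  shows "finite B" "card B \<le> card \<Delta> * (L + 1) ^ d"
proof -
  define S where "S F = {m :: nat \<Rightarrow>\<^sub>0 nat. keys m \<subseteq> F \<and> (\<forall>i. lookup m i \<le> L)}" for F
  have S: "finite (S F) \<and> card (S F) \<le> (L + 1) ^ d" if F: "F \<in> \<Delta>" for F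
  proof -
    have fF: "finite F" using cx F unfolding is_complex_def by blast
    let ?g = "\<lambda>m. restrict (lookup m) F"
    have inj: "inj_on ?g (S F)"
    proof (rule inj_onI, rule poly_mapping_eqI)
      fix s t i assume st: "s \<in> S F" "t \<in> S F" "?g s = ?g t"
      show "lookup s i = lookup t i"
      proof (cases "i \<in> F")
        case True then show ?thesis using fun_cong[OF st(3), of i] by simp
      next
        case False
        then have "i \<notin> keys s" "i \<notin> keys t" using st unfolding S_def by auto
        then show ?thesis by (simp add: in_keys_iff)
      qed
    qed
    have sub: "?g ` S F \<subseteq> (\<Pi>\<^sub>E i\<in>F. {..L})" unfolding S_def by auto
    have fin: "finite (\<Pi>\<^sub>E i\<in>F. {..L})" using fF by (intro finite_PiE) auto
    have "card (S F) \<le> card (\<Pi>\<^sub>E i\<in>F. {..L})" using inj sub fin by (rule card_inj_on_le)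
    also have "\<dots> = (L + 1) ^ card F" using fF by (simp add: card_PiE)
    also have "\<dots> \<le> (L + 1) ^ d" using d[OF F] by (intro power_increasing) auto
    finally show ?thesis using inj_on_finite[OF inj sub fin] by blast
  qed
  have B: "B \<subseteq> (\<Union>F\<in>\<Delta>. S F)" unfolding B_def S_def by blast
  have fin: "finite \<Delta>" using cx unfolding is_complex_def by blast
  then have finU: "finite (\<Union>F\<in>\<Delta>. S F)" using S by blast
  then show "finite B" using B finite_subset by blast
  have "card B \<le> card (\<Union>F\<in>\<Delta>. S F)" by (rule card_mono[OF finU B])
  also have "\<dots> \<le> (\<Sum>F\<in>\<Delta>. card (S F))" by (rule card_UN_le[OF fin])
  also have "\<dots> \<le> (\<Sum>F\<in>\<Delta>. (L + 1) ^ d)" by (rule sum_mono) (use S in blast)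
  finally show "card B \<le> card \<Delta> * (L + 1) ^ d" by simp
qed

text \<open>
  There are \<open>(N + 1)^(d + 1)\<close> power products with exponents at most \<open>N\<close>, whereas only \<open>O(N^d)\<close> monomials
  supported on faces can occur in them.
\<close>

lemma algebraic_dependence:
  fixes \<Delta> :: "nat set set" and ys :: "('k::field) mpoly list"
  assumes cx: "is_complex \<Delta>" and d: "\<And>F. F \<in> \<Delta> \<Longrightarrow> card F \<le> d" and len: "length ys = Suc d"
  obtains A c where "finite A" "\<And>\<alpha>. \<alpha> \<in> A \<Longrightarrow> length \<alpha> = Suc d" "\<exists>\<alpha>\<in>A. c \<alpha> \<noteq> 0"
    "(\<Sum>\<alpha>\<in>A. single 0 (c \<alpha>) * power_product ys \<alpha>) \<in> face_ideal \<Delta>"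
proof -
  have "\<exists>D. \<forall>y\<in>set ys. bounded_exponents y D"
  proof (induction ys)
    case (Cons y ys)
    then obtain D E where "\<forall>y\<in>set ys. bounded_exponents y D" "bounded_exponents y E"
      using bounded_exponents_exists by blast
    then have "\<forall>z\<in>set (y # ys). bounded_exponents z (max D E)"
      using bounded_exponents_mono[of _ D "max D E"] bounded_exponents_mono[of _ E "max D E"] by auto
    then show ?case by blast
  qed simp
  then obtain D where D: "\<And>y. y \<in> set ys \<Longrightarrow> bounded_exponents y D" by blast
  \<comment> \<open>\<open>L\<close> bounds the exponents in the power products. \<open>K\<close> is
    chosen for \<open>L + 1 \<le> K * (N + 1)\<close>, and \<open>N\<close> so that
    \<open>card \<Delta> * (L + 1) ^ d \<le> N * (N + 1) ^ d\<close>, which is less than the number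
    \<open>(N + 1) ^ Suc d\<close> of power products.\<close>
  define K where "K = Suc d * D + 1"
  define N where "N = card \<Delta> * K ^ d"
  define L where "L = Suc d * (N * D)"
  define A where "A = {\<alpha>. set \<alpha> \<subseteq> {..N} \<and> length \<alpha> = Suc d}"
  define B where "B = {m :: nat \<Rightarrow>\<^sub>0 nat. keys m \<in> \<Delta> \<and> (\<forall>i. lookup m i \<le> L)}"
  have A: "finite A" "card A = (N + 1) ^ Suc d"
    unfolding A_def by (simp_all add: finite_lists_length_eq card_lists_length_eq)
  have B: "finite B" "card B \<le> card \<Delta> * (L + 1) ^ d"
    unfolding B_def using card_bounded_face_exponents[OF cx d] by blast+
  have "L + 1 \<le> K * (N + 1)" unfolding L_def K_def by (simp add: algebra_simps)
  then have "(L + 1) ^ d \<le> (K * (N + 1)) ^ d" by (rule power_mono) simp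
  then have "(L + 1) ^ d \<le> K ^ d * (N + 1) ^ d" by (simp only: power_mult_distrib)
  then have "card \<Delta> * (L + 1) ^ d \<le> card \<Delta> * (K ^ d * (N + 1) ^ d)" by (rule mult_le_mono2)
  moreover have "N * (N + 1) ^ d = card \<Delta> * (K ^ d * (N + 1) ^ d)" by (simp add: N_def mult.assoc)
  ultimately have "card B \<le> N * (N + 1) ^ d" using B(2) by linarith
  also have "\<dots> < card A" unfolding A(2) by simp
  finally obtain c where c: "\<exists>\<alpha>\<in>A. c \<alpha> \<noteq> 0"
    "\<And>m. m \<in> B \<Longrightarrow> (\<Sum>\<alpha>\<in>A. c \<alpha> * lookup (power_product ys \<alpha>) m) = 0"
    using underdetermined_system[OF B(1) A(1), of "\<lambda>m \<alpha>. lookup (power_product ys \<alpha>) m"] by blast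
  have "lookup (\<Sum>\<alpha>\<in>A. single 0 (c \<alpha>) * power_product ys \<alpha>) m = 0"
    if m: "keys m \<in> \<Delta>" for m
  proof -
    have l: "lookup (\<Sum>\<alpha>\<in>A. single 0 (c \<alpha>) * power_product ys \<alpha>) m
      = (\<Sum>\<alpha>\<in>A. c \<alpha> * lookup (power_product ys \<alpha>) m)"
      unfolding lookup_sum by (simp add: lookup_single_mult(1)[of 0 _ _ m, simplified])
    show ?thesis
    proof (cases "m \<in> B")
      case True then show ?thesis using l c(2) by simp
    next
      case False
      then obtain i where i: "\<not> lookup m i \<le> L" using m unfolding B_def by blast
      have "lookup (power_product ys \<alpha>) m = 0" if "\<alpha> \<in> A" for \<alpha>
      proof (rule ccontr)
        assume "lookup (power_product ys \<alpha>) m \<noteq> 0"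
        moreover have "bounded_exponents (power_product ys \<alpha>) L"
          using bounded_exponents_power_product[of ys D \<alpha> N] D that len unfolding A_def L_def by simp
        ultimately show False using i unfolding bounded_exponents_def by (simp add: in_keys_iff)
      qed
      then show ?thesis using l by simp
    qed
  qed
  then have "(\<Sum>\<alpha>\<in>A. single 0 (c \<alpha>) * power_product ys \<alpha>) \<in> face_ideal \<Delta>"
    unfolding face_ideal_def by blast
  then show thesis using that[OF A(1) _ c(1)] unfolding A_def by blast
qed

section \<open>Lengths of prime chains\<close>

lemma prime_set_power: "prime_set P \<Longrightarrow> y ^ n \<in> P \<Longrightarrow> y \<in> P"
  by (induction n) (auto simp: prime_set_def)

text \<open>
  Dividing a relation by the smallest occurring power of the first element and reducing modulo the
  next prime leaves a nontrivial relation among the remaining elements.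
\<close>

lemma prime_chain_independent:
  fixes P :: "nat \<Rightarrow> ('k::field) mpoly set"
  assumes "\<And>i. i \<le> length ys \<Longrightarrow> prime_set (P i)"
    and "\<And>i. i < length ys \<Longrightarrow> P i \<subseteq> P (Suc i) \<and> ys ! i \<in> P (Suc i) \<and> ys ! i \<notin> P i"
    and "finite A" "\<And>\<alpha>. \<alpha> \<in> A \<Longrightarrow> length \<alpha> = length ys" "\<exists>\<alpha>\<in>A. c \<alpha> \<noteq> 0"
  shows "(\<Sum>\<alpha>\<in>A. single 0 (c \<alpha>) * power_product ys \<alpha>) \<notin> P 0"
  using assms
proof (induction ys arbitrary: P A c)
  case Nil
  obtain \<alpha> where \<alpha>: "\<alpha> \<in> A" "c \<alpha> \<noteq> 0" using Nil.prems(5) by blast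
  then have "A = {[]}" using Nil.prems(4) by force
  show ?case
  proof
    assume "(\<Sum>\<alpha>\<in>A. single 0 (c \<alpha>) * power_product [] \<alpha>) \<in> P 0"
    then have "single 0 (c []) \<in> P 0" using \<open>A = {[]}\<close> by simp
    moreover have p: "prime_set (P 0)" using Nil.prems(1) by simp
    ultimately have "single 0 (1 / c []) * single 0 (c []) \<in> P 0"
      unfolding prime_set_def using idl_mult_left by blast
    moreover have "c [] \<noteq> 0" using \<alpha> \<open>A = {[]}\<close> by simp
    ultimately show False using p unfolding prime_set_def by (simp add: mult_single)
  qed
next
  case (Cons y ys)
  define t where "t \<alpha> = single 0 (c \<alpha>) * power_product ys (tl \<alpha>)" for \<alpha>
  define A' where "A' = {\<alpha>\<in>A. c \<alpha> \<noteq> 0}"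
  define m where "m = Min (hd ` A')"
  define A0 where "A0 = {\<alpha>\<in>A'. hd \<alpha> = m}"
  have p0: "prime_set (P 0)" and p1: "prime_set (P 1)" using Cons.prems(1) by auto
  have s1: "idl.subspace (P 1)" using p1 unfolding prime_set_def by blast
  have y: "P 0 \<subseteq> P 1" "y \<in> P 1" "y \<notin> P 0" using Cons.prems(2)[of 0] by auto
  have fin: "finite A'" "A' \<noteq> {}" using Cons.prems(3,5) unfolding A'_def by auto
  have ne: "\<alpha> = hd \<alpha> # tl \<alpha>" "length (tl \<alpha>) = length ys" if "\<alpha> \<in> A" for \<alpha>
    using Cons.prems(4)[OF that] by (cases \<alpha>; simp)+
  have mle: "m \<le> hd \<alpha>" if "\<alpha> \<in> A'" for \<alpha> unfolding m_def using fin that by simp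
  have "m \<in> hd ` A'" unfolding m_def using fin by (intro Min_in) auto
  then have A0: "A0 \<noteq> {}" "finite A0" unfolding A0_def using fin by auto
  have injA0: "inj_on tl A0"
    using ne(1) unfolding A0_def A'_def by (intro inj_onI) (metis (mono_tags, lifting) mem_Collect_eq)
  have notin: "(\<Sum>\<alpha>\<in>A0. t \<alpha>) \<notin> P 1"
  proof -
    \<comment> \<open>The induction hypothesis is used for the shifted chain. All first exponents in
      \<open>A0\<close> equal \<open>m\<close>, so the tails remain distinct.\<close>
    have "(\<Sum>\<beta>\<in>tl ` A0. single 0 (c (m # \<beta>)) * power_product ys \<beta>) \<notin> (P \<circ> Suc) 0"
    proof (rule Cons.IH)
      show "prime_set ((P \<circ> Suc) i)" if "i \<le> length ys" for i using Cons.prems(1) that by simp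
      show "(P \<circ> Suc) i \<subseteq> (P \<circ> Suc) (Suc i) \<and> ys ! i \<in> (P \<circ> Suc) (Suc i) \<and> ys ! i \<notin> (P \<circ> Suc) i"
        if "i < length ys" for i using Cons.prems(2)[of "Suc i"] that by simp
      show "finite (tl ` A0)" using A0 by simp
      show "length \<alpha> = length ys" if "\<alpha> \<in> tl ` A0" for \<alpha> using that ne unfolding A0_def A'_def by auto
      obtain \<alpha> where "\<alpha> \<in> A0" using A0 by blast
      moreover from this have "m # tl \<alpha> = \<alpha>" "c \<alpha> \<noteq> 0" using ne(1)[of \<alpha>] unfolding A0_def A'_def by auto
      ultimately show "\<exists>\<beta>\<in>tl ` A0. c (m # \<beta>) \<noteq> 0" by (intro bexI[of _ "tl \<alpha>"]) auto
    qed
    also have "(\<Sum>\<beta>\<in>tl ` A0. single 0 (c (m # \<beta>)) * power_product ys \<beta>) = (\<Sum>\<alpha>\<in>A0. t \<alpha>)"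
      unfolding sum.reindex[OF injA0] o_def
    proof (rule sum.cong[OF refl])
      fix \<alpha> assume "\<alpha> \<in> A0"
      then have "m # tl \<alpha> = \<alpha>" using ne(1)[of \<alpha>] unfolding A0_def A'_def by auto
      then show "single 0 (c (m # tl \<alpha>)) * power_product ys (tl \<alpha>) = t \<alpha>" by (simp add: t_def)
    qed
    finally show ?thesis by simp
  qed
  show ?case
  proof
    assume "(\<Sum>\<alpha>\<in>A. single 0 (c \<alpha>) * power_product (y # ys) \<alpha>) \<in> P 0"
    also have "(\<Sum>\<alpha>\<in>A. single 0 (c \<alpha>) * power_product (y # ys) \<alpha>)
      = (\<Sum>\<alpha>\<in>A'. single 0 (c \<alpha>) * power_product (y # ys) \<alpha>)"
      by (rule sum.mono_neutral_right) (use Cons.prems(3) in \<open>auto simp: A'_def\<close>)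
    also have "\<dots> = (\<Sum>\<alpha>\<in>A'. y ^ m * (y ^ (hd \<alpha> - m) * t \<alpha>))"
    proof (rule sum.cong[OF refl])
      fix \<alpha> assume \<alpha>: "\<alpha> \<in> A'"
      then have "\<alpha> = hd \<alpha> # tl \<alpha>" using ne(1) unfolding A'_def by blast
      then have "power_product (y # ys) \<alpha> = y ^ hd \<alpha> * power_product ys (tl \<alpha>)"
        by (metis power_product.simps(1))
      moreover have "y ^ hd \<alpha> = y ^ m * y ^ (hd \<alpha> - m)" using mle[OF \<alpha>] by (simp flip: power_add)
      ultimately show "single 0 (c \<alpha>) * power_product (y # ys) \<alpha> = y ^ m * (y ^ (hd \<alpha> - m) * t \<alpha>)"
        by (simp add: t_def ac_simps)
    qed
    also have "\<dots> = y ^ m * (\<Sum>\<alpha>\<in>A'. y ^ (hd \<alpha> - m) * t \<alpha>)" by (simp add: sum_distrib_left)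
    finally have "y ^ m * (\<Sum>\<alpha>\<in>A'. y ^ (hd \<alpha> - m) * t \<alpha>) \<in> P 0" .
    moreover have "y ^ m \<notin> P 0" using y(3) prime_set_power[OF p0] by blast
    ultimately have T: "(\<Sum>\<alpha>\<in>A'. y ^ (hd \<alpha> - m) * t \<alpha>) \<in> P 1" using p0 y(1) unfolding prime_set_def by blast
    have split: "(\<Sum>\<alpha>\<in>A'. y ^ (hd \<alpha> - m) * t \<alpha>) = (\<Sum>\<alpha>\<in>A0. t \<alpha>) + (\<Sum>\<alpha>\<in>A' - A0. y ^ (hd \<alpha> - m) * t \<alpha>)"
    proof -
      have "(\<Sum>\<alpha>\<in>A'. y ^ (hd \<alpha> - m) * t \<alpha>) = (\<Sum>\<alpha>\<in>A0. y ^ (hd \<alpha> - m) * t \<alpha>) + (\<Sum>\<alpha>\<in>A' - A0. y ^ (hd \<alpha> - m) * t \<alpha>)"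
        by (subst add.commute, rule sum.subset_diff) (use fin in \<open>auto simp: A0_def\<close>)
      also have "(\<Sum>\<alpha>\<in>A0. y ^ (hd \<alpha> - m) * t \<alpha>) = (\<Sum>\<alpha>\<in>A0. t \<alpha>)"
        by (rule sum.cong) (auto simp: A0_def)
      finally show ?thesis .
    qed
    \<comment> \<open>A first exponent above \<open>m\<close> leaves a factor \<open>y\<close>,
      which lies in \<open>P 1\<close>.\<close>
    have rest: "(\<Sum>\<alpha>\<in>A' - A0. y ^ (hd \<alpha> - m) * t \<alpha>) \<in> P 1"
    proof (rule idl.subspace_sum[OF s1])
      fix \<alpha> assume "\<alpha> \<in> A' - A0"
      then have "m < hd \<alpha>" using mle[of \<alpha>] unfolding A0_def by auto
      then have "y ^ (hd \<alpha> - m) = y * y ^ (hd \<alpha> - m - 1)" by (metis Suc_diff_1 power_Suc zero_less_diff)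
      then have "y ^ (hd \<alpha> - m) \<in> P 1" using idl_mult_right[OF s1 y(2)] by simp
      then show "y ^ (hd \<alpha> - m) * t \<alpha> \<in> P 1" by (rule idl_mult_right[OF s1])
    qed
    have "(\<Sum>\<alpha>\<in>A0. t \<alpha>) \<in> P 1" using idl.subspace_diff[OF s1 T rest] unfolding split by simp
    then show False using notin by blast
  qed
qed

lemma prime_chain_length:
  fixes P :: "nat \<Rightarrow> ('k::field) mpoly set"
  assumes cx: "is_complex \<Delta>" and d: "\<And>F. F \<in> \<Delta> \<Longrightarrow> card F \<le> d"
    and P: "\<And>i. i \<le> l \<Longrightarrow> prime_set (P i)" "\<And>i. i < l \<Longrightarrow> P i \<subset> P (Suc i)" and J: "face_ideal \<Delta> \<subseteq> P 0"
  shows "l \<le> d"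
proof (rule ccontr)
  assume l: "\<not> l \<le> d"
  have "\<exists>y. y \<in> P (Suc i) \<and> y \<notin> P i" if "i < l" for i using P(2)[OF that] by blast
  then obtain y where y: "\<And>i. i < l \<Longrightarrow> y i \<in> P (Suc i) \<and> y i \<notin> P i" by metis
  define ys where "ys = map y [0..<Suc d]"
  have len: "length ys = Suc d" and nth: "\<And>i. i < Suc d \<Longrightarrow> ys ! i = y i"
    unfolding ys_def by (simp_all del: upt_Suc)
  obtain A c where A: "finite A" "\<And>\<alpha>. \<alpha> \<in> A \<Longrightarrow> length \<alpha> = Suc d" "\<exists>\<alpha>\<in>A. c \<alpha> \<noteq> 0"
    "(\<Sum>\<alpha>\<in>A. single 0 (c \<alpha>) * power_product ys \<alpha>) \<in> face_ideal \<Delta>"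
    using algebraic_dependence[OF cx d len] by blast
  have "(\<Sum>\<alpha>\<in>A. single 0 (c \<alpha>) * power_product ys \<alpha>) \<notin> P 0"
  proof (rule prime_chain_independent)
    show "prime_set (P i)" if "i \<le> length ys" for i using P(1) that len l by simp
    show "P i \<subseteq> P (Suc i) \<and> ys ! i \<in> P (Suc i) \<and> ys ! i \<notin> P i" if "i < length ys" for i
      using P(2)[of i] y[of i] nth[of i] that len l by auto
  qed (use A len in auto)
  then show False using A(4) J by blast
qed

text \<open>The quotient is the polynomial ring in the variables of \<open>G\<close>, a domain.
  Concretely, both factors are replaced by normal forms; their product is again a normal form, so it
  lies in the ideal only if it is 0.\<close>

lemma prime_set_face_ideal_simplex:
  assumes "finite G"
  shows "prime_set (face_ideal (Pow G) :: ('k::field) mpoly set)"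
proof -
  let ?Q = "face_ideal (Pow G) :: 'k mpoly set"
  have cx: "is_complex (Pow G)" unfolding is_complex_def using assms by (auto intro: finite_subset)
  note sub = subspace_face_ideal[OF cx, where 'k='k]
  have one: "1 \<notin> ?Q"
    unfolding face_ideal_def by (auto intro!: exI[of _ 0])
  have "a \<in> ?Q \<or> b \<in> ?Q" if ab: "a * b \<in> ?Q" for a b
  proof -
    let ?a = "face_part (Pow G) a" and ?b = "face_part (Pow G) b"
    have "?a * ?b = a * b - a * (b - ?b) - ?b * (a - ?a)" by (simp add: algebra_simps)
    also have "\<dots> \<in> ?Q"
      by (intro idl.subspace_diff[OF sub] ab idl_mult_left[OF sub] diff_face_part)
    finally have Q: "?a * ?b \<in> ?Q" .
    have "?a * ?b = 0"
    proof (rule poly_mapping_eqI)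
      fix m
      show "lookup (?a * ?b) m = lookup 0 m"
      proof (rule ccontr)
        assume n: "lookup (?a * ?b) m \<noteq> lookup 0 m"
        then have "m \<in> keys (?a * ?b)" by (simp add: in_keys_iff)
        then obtain s t where "m = s + t" "s \<in> keys ?a" "t \<in> keys ?b"
          using keys_mult[of ?a ?b] by blast
        then have "keys m \<subseteq> G" unfolding keys_face_part by (auto simp: keys_add_nat)
        then show False using Q n unfolding face_ideal_def by simp
      qed
    qed
    then have "?a = 0 \<or> ?b = 0" by simp
    then show ?thesis using diff_face_part[of a "Pow G"] diff_face_part[of b "Pow G"] by auto
  qed
  then show ?thesis using sub one unfolding prime_set_def by blast
qed

lemma face_ideal_mono: "\<Gamma> \<subseteq> \<Delta> \<Longrightarrow> face_ideal \<Delta> \<subseteq> face_ideal \<Gamma>"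
  unfolding face_ideal_def by auto

lemma face_ideal_simplex_strict:
  assumes "G \<subset> H"
  shows "(face_ideal (Pow H) :: ('k::field) mpoly set) \<subset> face_ideal (Pow G)"
proof -
  obtain v where v: "v \<in> H" "v \<notin> G" using assms by blast
  let ?x = "single (single v 1) 1 :: 'k mpoly"
  have "?x \<in> face_ideal (Pow G)"
    unfolding face_ideal_def using v by (auto simp: lookup_single when_def)
  moreover have "?x \<notin> face_ideal (Pow H)"
    unfolding face_ideal_def using v by (auto intro!: exI[of _ "single v 1"])
  moreover have "face_ideal (Pow H) \<subseteq> (face_ideal (Pow G) :: 'k mpoly set)"
    by (rule face_ideal_mono) (use assms in auto)
  ultimately show ?thesis by blast
qed

text \<open>Removing the vertices of \<open>F\<close> one at a time gives a flag of simplices; their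
  face ideals, generated by the complementary variables, form the chain.\<close>

lemma prime_chain_exists:
  assumes F: "F \<in> \<Delta>" and cx: "is_complex \<Delta>"
  obtains P :: "nat \<Rightarrow> ('k::field) mpoly set"
  where "\<And>i. prime_set (P i)" "\<And>i. face_ideal \<Delta> \<subseteq> P i" "\<And>i j. i < j \<Longrightarrow> j \<le> card F \<Longrightarrow> P i \<subset> P j"
proof -
  have fF: "finite F" using cx F unfolding is_complex_def by blast
  obtain vs where vs: "set vs = F" "distinct vs" using finite_distinct_list[OF fF] by blast
  have len: "length vs = card F" using vs distinct_card by fastforce
  define G where "G i = set (take (card F - i) vs)" for i
  define P :: "nat \<Rightarrow> 'k mpoly set" where "P i = face_ideal (Pow (G i))" for i
  have GF: "G i \<subseteq> F" for i unfolding G_def vs(1)[symmetric] by (rule set_take_subset)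
  have GD: "Pow (G i) \<subseteq> \<Delta>" for i
  proof
    fix H assume "H \<in> Pow (G i)"
    then have "H \<subseteq> F" using GF[of i] by simp
    then show "H \<in> \<Delta>" using F cx unfolding is_complex_def by blast
  qed
  have cardG: "card (G i) = card F - i" for i
    unfolding G_def using vs len by (simp add: distinct_card)
  have G: "G j \<subset> G i" if "i < j" "j \<le> card F" for i j
  proof -
    have "G j \<subseteq> G i" unfolding G_def by (rule set_take_subset_set_take) (use that in simp)
    moreover have "G j \<noteq> G i"
    proof
      assume "G j = G i"
      then have "card (G j) = card (G i)" by (rule arg_cong)
      then have "card F - j = card F - i" unfolding cardG .
      then show False using that by linarith
    qed
    ultimately show ?thesis by (rule psubsetI)
  qed
  show thesis
  proof (rule that[of P])
    show "prime_set (P i)" for i unfolding P_def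
      by (rule prime_set_face_ideal_simplex) (simp add: G_def)
    show "face_ideal \<Delta> \<subseteq> P i" for i unfolding P_def by (rule face_ideal_mono[OF GD])
    show "P i \<subset> P j" if "i < j" "j \<le> card F" for i j unfolding P_def
      by (rule face_ideal_simplex_strict[OF G[OF that]])
  qed
qed

section \<open>The Stanley--Reisner ring\<close>

text \<open>The recursion adjoins the elements one by one, \<open>regular_sequence\<close> all
  earlier ones at once; the nested spans agree.\<close>

lemma regular_mod_iff:
  assumes "idl.subspace J"
  shows "regular_mod J fs \<longleftrightarrow> (\<forall>i<length fs. nonzerodivisor_mod (idl.span (J \<union> set (take i fs))) (fs ! i))"
  using assms
proof (induction fs arbitrary: J)
  case (Cons f fs)
  have J: "idl.span J = J" using Cons.prems by simp
  have s: "idl.span (idl.span (insert f J) \<union> T) = idl.span (J \<union> insert f T)" for T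
  proof (rule subset_antisym; rule idl.span_minimal)
    have "insert f J \<subseteq> idl.span (J \<union> insert f T)" using idl.span_superset[of "J \<union> insert f T"] by auto
    then have "idl.span (insert f J) \<subseteq> idl.span (J \<union> insert f T)" by (rule idl.span_minimal) simp
    then show "idl.span (insert f J) \<union> T \<subseteq> idl.span (J \<union> insert f T)"
      using idl.span_superset[of "J \<union> insert f T"] by auto
    show "J \<union> insert f T \<subseteq> idl.span (idl.span (insert f J) \<union> T)"
      using idl.span_superset[of "idl.span (insert f J) \<union> T"] idl.span_superset[of "insert f J"] by auto
  qed simp_all
  have "regular_mod (idl.span (insert f J)) fs \<longleftrightarrow>
    (\<forall>i<length fs. nonzerodivisor_mod (idl.span (J \<union> insert f (set (take i fs)))) (fs ! i))"
    using Cons.IH[of "idl.span (insert f J)"] by (simp add: s)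
  then show ?case by (simp add: All_less_Suc2 J)
qed simp

locale stanley_reisner =
  fixes k :: "'k::field itself" and n :: nat and \<Delta> :: "nat set set"
  assumes sc: "simplicial_complex n \<Delta>"
begin

abbreviation "R \<equiv> polynomial_ring k n"
abbreviation "S \<equiv> SR_ring k n \<Delta>"
abbreviation "J \<equiv> (face_ideal \<Delta> :: 'k mpoly set)"
abbreviation "I \<equiv> SR_ideal k n \<Delta>"

lemma is_complex_Delta: "is_complex \<Delta>" using simplicial_complex_is_complex[OF sc] .

lemma subspace_J: "idl.subspace J" using subspace_face_ideal[OF is_complex_Delta] .

lemma in_R: "p \<in> carrier R \<longleftrightarrow> (\<forall>m\<in>keys p. keys m \<subseteq> {1..n})"
  by (simp add: polynomial_ring_def)

lemma R_ops [simp]: "x \<otimes>\<^bsub>R\<^esub> y = x * y" "x \<oplus>\<^bsub>R\<^esub> y = x + y" "\<one>\<^bsub>R\<^esub> = 1" "\<zero>\<^bsub>R\<^esub> = 0"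
  by (simp_all add: polynomial_ring_def)

lemma R_closed:
  "0 \<in> carrier R" "1 \<in> carrier R"
  "p \<in> carrier R \<Longrightarrow> q \<in> carrier R \<Longrightarrow> p + q \<in> carrier R"
  "p \<in> carrier R \<Longrightarrow> q \<in> carrier R \<Longrightarrow> p * q \<in> carrier R"
  "p \<in> carrier R \<Longrightarrow> - p \<in> carrier R"
proof -
  show "p + q \<in> carrier R" if "p \<in> carrier R" "q \<in> carrier R"
    using that Poly_Mapping.keys_add[of p q] unfolding in_R by blast
  show "p * q \<in> carrier R" if pq: "p \<in> carrier R" "q \<in> carrier R"
    unfolding in_R
  proof
    fix m assume "m \<in> keys (p * q)"
    then obtain s t where "m = s + t" "s \<in> keys p" "t \<in> keys q"
      using keys_mult[of p q] by blast
    then show "keys m \<subseteq> {1..n}" using pq unfolding in_R by (simp add: keys_add_nat)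
  qed
  show "- p \<in> carrier R" if "p \<in> carrier R"
    using that unfolding in_R by (simp add: in_keys_iff)
qed (simp_all add: in_R)

lemma cring_R: "cring R"
proof (rule cringI)
  show "abelian_group R"
  proof (rule abelian_groupI)
    show "\<exists>y\<in>carrier R. y \<oplus>\<^bsub>R\<^esub> x = \<zero>\<^bsub>R\<^esub>" if "x \<in> carrier R" for x
      using R_closed(5)[OF that] by (intro bexI[of _ "- x"]) simp_all
  qed (simp_all add: R_closed add.assoc add.commute)
  show "Group.comm_monoid R"
    by (rule comm_monoidI) (simp_all add: R_closed ac_simps)
qed (simp add: distrib_right)

interpretation R: cring R by (rule cring_R)

text \<open>A monomial is a multiple of the squarefree monomial on its support, here a
  generator.\<close>

lemma monomial_in_SR_ideal:
  assumes "keys m \<subseteq> {1..n}" "keys m \<notin> \<Delta>"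
  shows "single m a \<in> I"
proof -
  let ?F = "keys m"
  let ?G = "{\<Prod>i\<in>F. Var k i | F. F \<subseteq> {1..n} \<and> F \<notin> \<Delta>}"
  have VR: "Var k i \<in> carrier R" if "i \<in> {1..n}" for i
    using that unfolding in_R Var_def by simp
  have prodR: "(\<Prod>i\<in>F. Var k i) \<in> carrier R" if "F \<subseteq> {1..n}" for F
    using that VR by (induction F rule: infinite_finite_induct) (auto simp: R_closed)
  have "?G \<subseteq> carrier R" using prodR by blast
  then have I: "ideal I R" and G: "?G \<subseteq> I"
    unfolding SR_ideal_def using R.genideal_ideal R.genideal_self by blast+
  have prod_eq: "(\<Prod>i\<in>F. Var k i) = single (sqfree F) 1" if "finite F" for F
    using that
  proof (induction F)
    case empty
    have "sqfree {} = 0" by (rule poly_mapping_eqI) (simp add: lookup_sqfree)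
    then show ?case by simp
  next
    case (insert v F)
    have "single v 1 + sqfree F = sqfree (insert v F)"
      by (rule poly_mapping_eqI) (use insert.hyps in \<open>auto simp: lookup_add lookup_single lookup_sqfree when_def\<close>)
    then show ?case using insert by (simp add: Var_def mult_single)
  qed
  have "(\<Prod>i\<in>?F. Var k i) \<in> I" using G assms by blast
  then have "single (sqfree ?F) 1 \<in> I" unfolding prod_eq[OF finite_keys] .
  moreover have "single (m - sqfree ?F) a \<in> carrier R"
    using assms(1) unfolding in_R by (auto simp: in_keys_iff lookup_minus subset_iff)
  ultimately have "single (m - sqfree ?F) a * single (sqfree ?F) 1 \<in> I"
    using ideal.I_l_closed[OF I] by fastforce
  moreover have "m - sqfree ?F + sqfree ?F = m"
    by (rule poly_mapping_eqI) (auto simp: lookup_add lookup_minus lookup_sqfree in_keys_iff)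
  ultimately show ?thesis by (simp add: mult_single)
qed

lemma generators_subset: "{\<Prod>i\<in>F. Var k i | F. F \<subseteq> {1..n} \<and> F \<notin> \<Delta>} \<subseteq> carrier R \<inter> J"
proof
  fix p assume "p \<in> {\<Prod>i\<in>F. Var k i | F. F \<subseteq> {1..n} \<and> F \<notin> \<Delta>}"
  then obtain F where F: "p = (\<Prod>i\<in>F. Var k i)" "F \<subseteq> {1..n}" "F \<notin> \<Delta>" by blast
  have fF: "finite F" using F(2) finite_subset by blast
  have "\<forall>m\<in>keys (\<Prod>i\<in>F. Var k i). keys m = F" using fF
  proof (induction F)
    case (insert v F)
    show ?case
    proof
      fix m assume "m \<in> keys (\<Prod>i\<in>insert v F. Var k i)"
      then have "m \<in> keys (Var k v * (\<Prod>i\<in>F. Var k i))" using insert.hyps by simp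
      then obtain s t where "m = s + t" "s \<in> keys (Var k v)" "t \<in> keys (\<Prod>i\<in>F. Var k i)"
        using keys_mult[of "Var k v" "\<Prod>i\<in>F. Var k i"] by blast
      then show "keys m = insert v F" using insert.IH by (simp add: keys_add_nat Var_def)
    qed
  qed simp
  then show "p \<in> carrier R \<inter> J" using F by (auto simp: in_R face_ideal_def in_keys_iff)
qed

lemma ideal_face_ideal: "ideal (carrier R \<inter> J) R"
proof (rule idealI[OF R.ring_axioms])
  show "subgroup (carrier R \<inter> J) (add_monoid R)"
  proof (rule subgroup.intro)
    fix x assume x: "x \<in> carrier R \<inter> J"
    have "\<ominus>\<^bsub>R\<^esub> x = - x"
      by (rule R.minus_equality) (use x R_closed in auto)
    then have "inv\<^bsub>add_monoid R\<^esub> x = - x" unfolding a_inv_def .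
    then show "inv\<^bsub>add_monoid R\<^esub> x \<in> carrier R \<inter> J"
      using x R_closed(5) idl.subspace_neg[OF subspace_J] by (simp only: Int_iff)
  qed (use R_closed idl.subspace_add[OF subspace_J] idl.subspace_0[OF subspace_J] in auto)
qed (use R_closed idl_mult_left[OF subspace_J] idl_mult_right[OF subspace_J] in auto)

text \<open>Each generator is supported on a non-face; conversely, a polynomial of \<open>J\<close>
  in the ring is the sum of its monomials, all of which are multiples of generators.\<close>

lemma SR_ideal_eq: "I = carrier R \<inter> J"
proof
  show "I \<subseteq> carrier R \<inter> J"
    unfolding SR_ideal_def by (rule R.genideal_minimal[OF ideal_face_ideal generators_subset])
  have I: "ideal I R"
    unfolding SR_ideal_def by (rule R.genideal_ideal) (use generators_subset in blast)
  show "carrier R \<inter> J \<subseteq> I"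
  proof
    fix p assume p: "p \<in> carrier R \<inter> J"
    have s: "(\<Sum>m\<in>M. single m (lookup p m)) \<in> I" if "M \<subseteq> keys p" for M
    proof -
      have "finite M" using that by (rule finite_subset) simp
      then show ?thesis using that
      proof (induction M)
        case empty
        then show ?case using additive_subgroup.zero_closed[OF ideal.axioms(1)[OF I]] by simp
      next
        case (insert m M)
        have m: "m \<in> keys p" using insert.prems by simp
        have "keys m \<subseteq> {1..n}" using p m by (simp add: in_R)
        moreover have "keys m \<notin> \<Delta>" using p m by (auto simp: face_ideal_def in_keys_iff)
        ultimately have "single m (lookup p m) \<in> I" by (rule monomial_in_SR_ideal)
        moreover have "(\<Sum>m\<in>M. single m (lookup p m)) \<in> I"
          using insert.IH insert.prems by simp
        ultimately show ?case
          using additive_subgroup.a_closed[OF ideal.axioms(1)[OF I]] insert.hyps by simp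
      qed
    qed
    have "p = (\<Sum>m\<in>keys p. single m (lookup p m))"
      by (rule poly_mapping_eqI) (simp add: lookup_sum lookup_single when_def in_keys_iff)
    then show "p \<in> I" using s[OF subset_refl] by simp
  qed
qed

interpretation I: ideal I R unfolding SR_ideal_eq by (rule ideal_face_ideal)

lemma cring_S: "cring S"
  unfolding SR_ring_def by (rule I.quotient_is_cring[OF cring_R])

interpretation S: cring S by (rule cring_S)

text \<open>
  Defined on the full polynomial ring: variables outside \<open>{1..n}\<close> have residue \<open>0\<close>.
\<close>

definition residue :: "('k mpoly) \<Rightarrow> 'k mpoly set" where
  "residue p = {q \<in> carrier R. q - p \<in> J}"

text \<open>Dropping the monomials that involve other variables changes \<open>p\<close> by an
  element of \<open>J\<close>, so every residue has a representative in
  \<open>carrier R\<close>.\<close>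

definition restr :: "('k mpoly) \<Rightarrow> 'k mpoly" where
  "restr = face_part (Pow {1..n})"

lemma restr: "restr p \<in> carrier R" "p - restr p \<in> J"
proof -
  show "restr p \<in> carrier R" unfolding in_R restr_def keys_face_part by simp
  have "\<Delta> \<subseteq> Pow {1..n}" using sc unfolding simplicial_complex_def by blast
  then show "p - restr p \<in> J" unfolding restr_def using diff_face_part face_ideal_mono by blast
qed

lemma residue_eq_iff: "residue p = residue q \<longleftrightarrow> p - q \<in> J"
proof
  assume eq: "residue p = residue q"
  have "restr p - p \<in> J" using idl.subspace_neg[OF subspace_J restr(2)[of p]] by simp
  then have "restr p \<in> residue q" using restr(1) eq unfolding residue_def by blast
  then have "(p - restr p) + (restr p - q) \<in> J" using idl.subspace_add[OF subspace_J restr(2)] unfolding residue_def by blast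
  then show "p - q \<in> J" by simp
next
  assume pq: "p - q \<in> J"
  have "r - p \<in> J \<longleftrightarrow> r - q \<in> J" for r
    using idl.subspace_add[OF subspace_J pq, of "r - p"] idl.subspace_diff[OF subspace_J _ pq, of "r - q"]
    by (auto simp: algebra_simps)
  then show "residue p = residue q" unfolding residue_def by simp
qed

lemma residue_restr: "residue (restr p) = residue p"
  using restr(2)[of p] residue_eq_iff by (metis)

lemma residue_coset:
  assumes "p \<in> carrier R"
  shows "I +>\<^bsub>R\<^esub> p = residue p"
proof -
  have "I +>\<^bsub>R\<^esub> p = {i + p | i. i \<in> I}" unfolding a_r_coset_def r_coset_def by auto
  also have "\<dots> = residue p"
  proof (intro subset_antisym subsetI)
    fix q assume "q \<in> {i + p | i. i \<in> I}"
    then show "q \<in> residue p" using assms R_closed(3) unfolding residue_def SR_ideal_eq by auto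
  next
    fix q assume "q \<in> residue p"
    then have "q \<in> carrier R" "q - p \<in> J" unfolding residue_def by auto
    moreover from this have "q - p \<in> carrier R" using R_closed(3)[OF _ R_closed(5)[OF assms]] by simp
    ultimately have "q - p \<in> I" unfolding SR_ideal_eq by blast
    moreover have "q = (q - p) + p" by simp
    ultimately show "q \<in> {i + p | i. i \<in> I}" by blast
  qed
  finally show ?thesis .
qed

lemma coset_hom: "(+>\<^bsub>R\<^esub>) I \<in> ring_hom R S"
  unfolding SR_ring_def by (rule I.rcos_ring_hom)

lemma carrier_S: "carrier S = range residue"
proof -
  have "carrier S = residue ` carrier R"
    unfolding SR_ring_def FactRing_def using residue_coset
    by (auto simp: A_RCOSETS_def' image_iff)
  also have "\<dots> = range residue"
  proof (intro subset_antisym subsetI)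
    fix x assume "x \<in> range residue"
    then obtain p where "x = residue (restr p)" using residue_restr by blast
    then show "x \<in> residue ` carrier R" using restr(1) by blast
  qed blast
  finally show ?thesis .
qed

lemma residue_in [simp]: "residue p \<in> carrier S" unfolding carrier_S by blast

lemma residue_mult: "residue p \<otimes>\<^bsub>S\<^esub> residue q = residue (p * q)"
proof -
  have "residue p \<otimes>\<^bsub>S\<^esub> residue q = (I +>\<^bsub>R\<^esub> restr p) \<otimes>\<^bsub>S\<^esub> (I +>\<^bsub>R\<^esub> restr q)"
    by (simp add: residue_coset restr residue_restr)
  also have "\<dots> = residue (restr p * restr q)"
    using ring_hom_mult[OF coset_hom restr(1)[of p] restr(1)[of q]] by (simp add: residue_coset R_closed restr)
  also have "\<dots> = residue (p * q)"
  proof -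
    have "restr p * restr q - p * q = - (q * (p - restr p) + restr p * (q - restr q))" by (simp add: algebra_simps)
    also have "\<dots> \<in> J"
      by (intro idl.subspace_neg[OF subspace_J] idl.subspace_add[OF subspace_J] idl_mult_left[OF subspace_J] restr)
    finally show ?thesis unfolding residue_eq_iff .
  qed
  finally show ?thesis .
qed

lemma residue_add: "residue p \<oplus>\<^bsub>S\<^esub> residue q = residue (p + q)"
proof -
  have "residue p \<oplus>\<^bsub>S\<^esub> residue q = (I +>\<^bsub>R\<^esub> restr p) \<oplus>\<^bsub>S\<^esub> (I +>\<^bsub>R\<^esub> restr q)"
    by (simp add: residue_coset restr residue_restr)
  also have "\<dots> = residue (restr p + restr q)"
    using ring_hom_add[OF coset_hom restr(1)[of p] restr(1)[of q]] by (simp add: residue_coset R_closed restr)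
  also have "\<dots> = residue (p + q)"
  proof -
    have "restr p + restr q - (p + q) = - ((p - restr p) + (q - restr q))" by (simp add: algebra_simps)
    also have "\<dots> \<in> J" by (intro idl.subspace_neg[OF subspace_J] idl.subspace_add[OF subspace_J] restr)
    finally show ?thesis unfolding residue_eq_iff .
  qed
  finally show ?thesis .
qed

lemma residue_one: "\<one>\<^bsub>S\<^esub> = residue 1"
  using ring_hom_one[OF coset_hom] residue_coset[OF R_closed(2)] by simp

lemma residue_zero: "\<zero>\<^bsub>S\<^esub> = residue 0"
proof -
  have "\<zero>\<^bsub>S\<^esub> = I" by (simp add: SR_ring_def FactRing_def)
  then show ?thesis unfolding SR_ideal_eq residue_def by auto
qed

lemma residue_minus: "\<ominus>\<^bsub>S\<^esub> residue p = residue (- p)"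
  by (rule S.minus_equality) (simp_all add: residue_add residue_zero)

section \<open>Ideals of the face ring and ideals above the face ideal\<close>

lemma ideal_image:
  assumes B: "idl.subspace B"
  shows "ideal (residue ` B) S"
proof (rule idealI[OF S.ring_axioms])
  show "subgroup (residue ` B) (add_monoid S)"
  proof (rule subgroup.intro)
    fix x assume "x \<in> residue ` B"
    then obtain b where b: "b \<in> B" "x = residue b" by blast
    have "inv\<^bsub>add_monoid S\<^esub> x = residue (- b)" using residue_minus[of b] b(2) by (simp add: a_inv_def)
    then show "inv\<^bsub>add_monoid S\<^esub> x \<in> residue ` B" using idl.subspace_neg[OF B b(1)] by blast
  next
    fix x y assume "x \<in> residue ` B" "y \<in> residue ` B"
    then obtain b c where "b \<in> B" "c \<in> B" "x = residue b" "y = residue c" by blast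
    then show "x \<otimes>\<^bsub>add_monoid S\<^esub> y \<in> residue ` B" using idl.subspace_add[OF B] by (simp add: residue_add)
  qed (use idl.subspace_0[OF B] in \<open>auto simp: residue_zero\<close>)
  fix a x assume "a \<in> residue ` B" "x \<in> carrier S"
  then obtain b p where bp: "b \<in> B" "a = residue b" "x = residue p" unfolding carrier_S by blast
  have "p * b \<in> B" "b * p \<in> B" using bp(1) idl_mult_left[OF B] idl_mult_right[OF B] by blast+
  then show "x \<otimes>\<^bsub>S\<^esub> a \<in> residue ` B" "a \<otimes>\<^bsub>S\<^esub> x \<in> residue ` B" using bp by (simp_all add: residue_mult)
qed

lemma subspace_preimage:
  assumes A: "ideal A S"
  shows "idl.subspace (residue -` A)" "J \<subseteq> residue -` A"
proof -
  note add = additive_subgroup.a_closed[OF ideal.axioms(1)[OF A]]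
  note zero = additive_subgroup.zero_closed[OF ideal.axioms(1)[OF A]]
  show "idl.subspace (residue -` A)"
  proof (rule idl.subspaceI)
    show "0 \<in> residue -` A" using zero by (simp add: residue_zero)
    show "p + q \<in> residue -` A" if "p \<in> residue -` A" "q \<in> residue -` A" for p q
      using add[of "residue p" "residue q"] that by (simp add: residue_add)
    show "c * p \<in> residue -` A" if "p \<in> residue -` A" for c p
      using ideal.I_l_closed[OF A, of "residue p" "residue c"] that by (simp add: residue_mult)
  qed
  show "J \<subseteq> residue -` A"
  proof
    fix p assume "p \<in> J"
    then have "residue p = residue 0" unfolding residue_eq_iff by simp
    then show "p \<in> residue -` A" using zero by (simp add: residue_zero)
  qed
qed

lemma residue_in_image_iff:
  assumes "idl.subspace B" "J \<subseteq> B"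
  shows "residue p \<in> residue ` B \<longleftrightarrow> p \<in> B"
proof
  assume "residue p \<in> residue ` B"
  then obtain b where b: "b \<in> B" "p - b \<in> J" using residue_eq_iff by blast
  then have "(p - b) + b \<in> B" using assms idl.subspace_add by blast
  then show "p \<in> B" by simp
qed blast

lemma genideal_image:
  "genideal S (residue ` T) = residue ` idl.span (J \<union> T)"
proof
  have T: "residue ` T \<subseteq> carrier S" by auto
  show "genideal S (residue ` T) \<subseteq> residue ` idl.span (J \<union> T)"
    by (rule S.genideal_minimal[OF ideal_image]) (use idl.span_superset[of "J \<union> T"] in auto)
  have id: "ideal (genideal S (residue ` T)) S" using S.genideal_ideal[OF T] .
  have "J \<union> T \<subseteq> residue -` genideal S (residue ` T)"
    using subspace_preimage(2)[OF id] S.genideal_self[OF T] by blast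
  then have "idl.span (J \<union> T) \<subseteq> residue -` genideal S (residue ` T)"
    by (rule idl.span_minimal[OF _ subspace_preimage(1)[OF id]])
  then show "residue ` idl.span (J \<union> T) \<subseteq> genideal S (residue ` T)" by blast
qed

lemma residue_in_genideal: "residue p \<in> genideal S (residue ` T) \<longleftrightarrow> p \<in> idl.span (J \<union> T)"
  unfolding genideal_image
  by (rule residue_in_image_iff) (use idl.span_superset[of "J \<union> T"] in auto)

lemma prime_preimage:
  assumes "primeideal P S"
  shows "prime_set (residue -` P)"
proof -
  interpret P: primeideal P S by fact
  have "1 \<notin> residue -` P" using P.I_notcarr P.one_imp_carrier by (auto simp: residue_one)
  moreover have "p \<in> residue -` P \<or> q \<in> residue -` P" if "p * q \<in> residue -` P" for p q
    using P.I_prime[of "residue p" "residue q"] that by (simp add: residue_mult)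
  ultimately show ?thesis using subspace_preimage(1)[OF P.is_ideal] unfolding prime_set_def by blast
qed

lemma prime_image:
  assumes B: "prime_set B" "J \<subseteq> B"
  shows "primeideal (residue ` B) S"
proof (rule primeidealI)
  have sB: "idl.subspace B" using B unfolding prime_set_def by blast
  show "ideal (residue ` B) S" by (rule ideal_image[OF sB])
  have "residue 1 \<notin> residue ` B" using residue_in_image_iff[OF sB B(2)] B(1) unfolding prime_set_def by blast
  then show "carrier S \<noteq> residue ` B" using residue_in by blast
  fix a b assume "a \<in> carrier S" "b \<in> carrier S" "a \<otimes>\<^bsub>S\<^esub> b \<in> residue ` B"
  then obtain p q where pq: "a = residue p" "b = residue q" "residue (p * q) \<in> residue ` B"
    unfolding carrier_S using residue_mult by auto
  then have "p * q \<in> B" using residue_in_image_iff[OF sB B(2)] by blast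
  then show "a \<in> residue ` B \<or> b \<in> residue ` B" using B(1) pq unfolding prime_set_def by blast
qed (rule cring_S)

section \<open>Krull dimension\<close>

lemma krull_dim_SR_ring:
  assumes d: "complex_dim \<Delta> = int d - 1"
  shows "krull_dim S = enat d"
proof (rule antisym)
  have fin: "finite (face_dim ` \<Delta>)" using is_complex_Delta unfolding is_complex_def by simp
  have ne: "face_dim ` \<Delta> \<noteq> {}" using sc unfolding simplicial_complex_def by blast
  have le: "card F \<le> d" if "F \<in> \<Delta>" for F
    using Max_ge[OF fin, of "face_dim F"] that d unfolding complex_dim_def face_dim_def by auto
  show "krull_dim S \<le> enat d"
    unfolding krull_dim_def
  proof (rule SUP_least)
    fix Ps assume "Ps \<in> {Ps. Ps \<noteq> [] \<and> (\<forall>P\<in>set Ps. primeideal P S) \<and> sorted_wrt (\<subset>) Ps}"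
    then have Ps: "Ps \<noteq> []" "\<And>P. P \<in> set Ps \<Longrightarrow> primeideal P S" "sorted_wrt (\<subset>) Ps" by auto
    have prime: "primeideal (Ps ! i) S" if "i < length Ps" for i using Ps(2) that by simp
    have "length Ps - 1 \<le> d"
    proof (rule prime_chain_length[OF is_complex_Delta le, where P="\<lambda>i. residue -` (Ps ! i)"])
      show "prime_set (residue -` (Ps ! i))" if "i \<le> length Ps - 1" for i
        by (rule prime_preimage[OF prime]) (use that Ps(1) in \<open>cases Ps; simp\<close>)
      show "residue -` (Ps ! i) \<subset> residue -` (Ps ! Suc i)" if i: "i < length Ps - 1" for i
      proof -
        have "Ps ! i \<subset> Ps ! Suc i" using sorted_wrt_nth_less[OF Ps(3), of i "Suc i"] i by simp
        moreover have "Ps ! Suc i \<subseteq> carrier S"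
        proof -
          have "ideal (Ps ! Suc i) S" by (rule primeideal.axioms(1)[OF prime]) (use i in simp)
          then show ?thesis using additive_subgroup.a_subset ideal.axioms(1) by metis
        qed
        \<comment> \<open>Every element of \<open>S\<close> is a residue, so strict inclusions
          survive taking preimages.\<close>
        ultimately obtain p where "residue p \<in> Ps ! Suc i" "residue p \<notin> Ps ! i" "Ps ! i \<subseteq> Ps ! Suc i"
          unfolding carrier_S by blast
        then show ?thesis by blast
      qed
      show "J \<subseteq> residue -` (Ps ! 0)"
        by (rule subspace_preimage(2)) (use primeideal.axioms(1)[OF prime[of 0]] Ps(1) in simp)
    qed
    then show "enat (length Ps - 1) \<le> enat d" by simp
  qed
  have "complex_dim \<Delta> \<in> face_dim ` \<Delta>" unfolding complex_dim_def by (rule Max_in[OF fin ne])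
  then obtain F where F: "F \<in> \<Delta>" "card F = d" using d unfolding face_dim_def by auto
  obtain P :: "nat \<Rightarrow> 'k mpoly set" where P: "\<And>i. prime_set (P i)" "\<And>i. J \<subseteq> P i"
    "\<And>i j. i < j \<Longrightarrow> j \<le> card F \<Longrightarrow> P i \<subset> P j"
    using prime_chain_exists[OF F(1) is_complex_Delta] by blast
  define Ps where "Ps = map (\<lambda>i. residue ` P i) [0..<Suc d]"
  have "residue ` P i \<subset> residue ` P j" if "i < j" "j \<le> d" for i j
  proof -
    have "P i \<subset> P j" using P(3) that F(2) by blast
    then obtain p where p: "p \<in> P j" "p \<notin> P i" by blast
    have "residue p \<notin> residue ` P i" using residue_in_image_iff[OF _ P(2)] P(1) p unfolding prime_set_def by blast
    then show ?thesis using p \<open>P i \<subset> P j\<close> by blast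
  qed
  then have "sorted_wrt (\<subset>) Ps" unfolding Ps_def sorted_wrt_iff_nth_less by (simp del: upt_Suc)
  moreover have "\<forall>P\<in>set Ps. primeideal P S" unfolding Ps_def using prime_image[OF P(1,2)] by auto
  ultimately have "Ps \<in> {Ps. Ps \<noteq> [] \<and> (\<forall>P\<in>set Ps. primeideal P S) \<and> sorted_wrt (\<subset>) Ps}"
    by (simp add: Ps_def)
  then have "enat (length Ps - 1) \<le> krull_dim S" unfolding krull_dim_def by (rule SUP_upper)
  then show "enat d \<le> krull_dim S" by (simp add: Ps_def)
qed

section \<open>Regular sequences in the homogeneous maximal ideal\<close>

lemma SR_max_ideal_eq: "SR_max_ideal k n \<Delta> = residue ` idl.span (J \<union> Var k ` {1..n})"
proof -
  have "Var k i \<in> carrier R" if "i \<in> {1..n}" for i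
    using that unfolding in_R Var_def by simp
  then have "(\<lambda>i. I +>\<^bsub>R\<^esub> Var k i) ` {1..n} = residue ` Var k ` {1..n}"
    using residue_coset by (simp add: image_image)
  then show ?thesis unfolding SR_max_ideal_def by (simp only: genideal_image)
qed

text \<open>\<open>face_ideal {{}}\<close> is the ideal of polynomials without constant term. It
  contains the variables and, since the empty set is a face, also \<open>J\<close>.\<close>

lemma one_notin_max: "1 \<notin> idl.span (J \<union> Var k ` {1..n})"
proof -
  let ?Z = "face_ideal {{}} :: 'k mpoly set"
  have "idl.subspace ?Z" by (rule subspace_face_ideal) (simp add: is_complex_def)
  moreover have "J \<subseteq> ?Z" by (rule face_ideal_mono) (use sc in \<open>auto simp: simplicial_complex_def\<close>)
  moreover have "Var k ` {1..n} \<subseteq> ?Z"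
  proof -
    have "single i (1::nat) \<noteq> 0" for i :: nat
      by (metis lookup_single_eq lookup_zero one_neq_zero)
    then show ?thesis unfolding face_ideal_def Var_def by (auto simp: lookup_single when_def)
  qed
  ultimately have "idl.span (J \<union> Var k ` {1..n}) \<subseteq> ?Z" by (intro idl.span_minimal) auto
  moreover have "1 \<notin> ?Z" unfolding face_ideal_def by simp
  ultimately show ?thesis by blast
qed

lemma regular_sequence_residue:
  "regular_sequence S (map residue fs) \<longleftrightarrow> regular_mod J fs \<and> 1 \<notin> idl.span (J \<union> set fs)"
proof -
  have g: "genideal S (set (take i (map residue fs))) = genideal S (residue ` set (take i fs))" for i
    by (simp add: take_map)
  have "(\<forall>s\<in>carrier S. map residue fs ! i \<otimes>\<^bsub>S\<^esub> s \<in> genideal S (set (take i (map residue fs))) \<longrightarrow>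
      s \<in> genideal S (set (take i (map residue fs)))) \<longleftrightarrow>
    nonzerodivisor_mod (idl.span (J \<union> set (take i fs))) (fs ! i)" if "i < length fs" for i
    unfolding g carrier_S nonzerodivisor_mod_def using that
    by (simp add: residue_mult residue_in_genideal)
  moreover have "genideal S (set (map residue fs)) \<noteq> carrier S \<longleftrightarrow> 1 \<notin> idl.span (J \<union> set fs)"
  proof -
    have id: "ideal (genideal S (residue ` set fs)) S" by (rule S.genideal_ideal) auto
    have "genideal S (residue ` set fs) = carrier S \<longleftrightarrow> residue 1 \<in> genideal S (residue ` set fs)"
      using ideal.one_imp_carrier[OF id] residue_one residue_in by metis
    then show ?thesis by (simp add: residue_in_genideal)
  qed
  ultimately show ?thesis
    unfolding regular_sequence_def regular_mod_iff[OF subspace_J] by auto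
qed

lemma regular_sequence_exists_iff:
  "(\<exists>xs. set xs \<subseteq> SR_max_ideal k n \<Delta> \<and> regular_sequence S xs \<and> r \<le> length xs) \<longleftrightarrow>
   (\<forall>c<r. koszul_zero (Var k) {1..n} J c)"
proof
  assume "\<exists>xs. set xs \<subseteq> SR_max_ideal k n \<Delta> \<and> regular_sequence S xs \<and> r \<le> length xs"
  then obtain xs where xs: "set xs \<subseteq> residue ` idl.span (J \<union> Var k ` {1..n})" "regular_sequence S xs" "r \<le> length xs"
    unfolding SR_max_ideal_eq by blast
  obtain fs where fs: "xs = map residue fs" "set fs \<subseteq> idl.span (J \<union> Var k ` {1..n})"
  proof -
    have "\<forall>x\<in>set xs. \<exists>f. x = residue f \<and> f \<in> idl.span (J \<union> Var k ` {1..n})" using xs(1) by blast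
    then obtain g where g: "\<And>x. x \<in> set xs \<Longrightarrow> x = residue (g x) \<and> g x \<in> idl.span (J \<union> Var k ` {1..n})" by metis
    then have "xs = map residue (map g xs)" by (simp add: map_idI)
    moreover have "set (map g xs) \<subseteq> idl.span (J \<union> Var k ` {1..n})" using g by auto
    ultimately show thesis using that by blast
  qed
  have "regular_mod J fs" using xs(2) unfolding fs(1) regular_sequence_residue by blast
  then show "\<forall>c<r. koszul_zero (Var k) {1..n} J c"
    using regular_mod_koszul_zero[OF _ subspace_J fs(2)] xs(3) fs(1) by simp
next
  assume K: "\<forall>c<r. koszul_zero (Var k) {1..n} J c"
  have V: "\<Union>\<Delta> \<subseteq> {1..n}" using sc unfolding simplicial_complex_def by blast
  obtain fs where fs: "length fs = r" "set fs \<subseteq> idl.span (J \<union> Var k ` {1..n})" "regular_mod J fs"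
    using koszul_zero_regular_mod[OF _ subspace_J acc_above_face_ideal[OF V], of "{1..n}" r "Var k"] K by auto
  \<comment> \<open>A sequence inside the ideal of the variables generates a proper ideal.\<close>
  have "J \<union> set fs \<subseteq> idl.span (J \<union> Var k ` {1..n})"
    using fs(2) idl.span_superset[of "J \<union> Var k ` {1..n}"] by simp
  then have "idl.span (J \<union> set fs) \<subseteq> idl.span (J \<union> Var k ` {1..n})" by (rule idl.span_minimal) simp
  then have "1 \<notin> idl.span (J \<union> set fs)" using one_notin_max by blast
  then have "regular_sequence S (map residue fs)" using fs(3) unfolding regular_sequence_residue by blast
  moreover have "set (map residue fs) \<subseteq> SR_max_ideal k n \<Delta>" unfolding SR_max_ideal_eq using fs(2) by auto
  ultimately show "\<exists>xs. set xs \<subseteq> SR_max_ideal k n \<Delta> \<and> regular_sequence S xs \<and> r \<le> length xs"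
    using fs(1) by (intro exI[of _ "map residue fs"]) simp
qed

end

text \<open>A supremum in \<open>enat\<close> that reaches a positive finite bound has a member
  reaching it; the bound 0 is met even by the supremum over the empty set. For \<open>d = 0\<close>
  and \<open>d = 1\<close> the inequality always holds, in accordance with the truncated
  \<open>d - 1\<close>.\<close>

lemma enat_le_SUP_length_plus_one:
  "enat d \<le> (SUP xs\<in>T. enat (length xs)) + 1 \<longleftrightarrow> d - 1 = 0 \<or> (\<exists>xs\<in>T. d - 1 \<le> length xs)"
proof
  assume le: "enat d \<le> (SUP xs\<in>T. enat (length xs)) + 1"
  show "d - 1 = 0 \<or> (\<exists>xs\<in>T. d - 1 \<le> length xs)"
  proof (rule ccontr)
    assume no: "\<not> ?thesis"
    then have "(SUP xs\<in>T. enat (length xs)) \<le> enat (d - 2)" by (intro SUP_least) auto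
    then have "enat d \<le> enat (d - 2) + 1" using le by (meson add_right_mono order_trans)
    then show False using no by (simp add: one_enat_def)
  qed
next
  assume "d - 1 = 0 \<or> (\<exists>xs\<in>T. d - 1 \<le> length xs)"
  then show "enat d \<le> (SUP xs\<in>T. enat (length xs)) + 1"
  proof
    assume "d - 1 = 0"
    then have "enat d \<le> 0 + 1" by (simp add: one_enat_def)
    also have "\<dots> \<le> (SUP xs\<in>T. enat (length xs)) + 1" by (rule add_right_mono) simp
    finally show ?thesis .
  next
    assume "\<exists>xs\<in>T. d - 1 \<le> length xs"
    then obtain xs where xs: "xs \<in> T" "d - 1 \<le> length xs" by blast
    then have "enat d \<le> enat (length xs) + 1" by (simp add: one_enat_def)
    also have "\<dots> \<le> (SUP xs\<in>T. enat (length xs)) + 1" by (intro add_right_mono SUP_upper xs)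
    finally show ?thesis .
  qed
qed

theorem theorem3p4:
  fixes k :: "'k::field itself" and n d :: nat and \<Delta> :: "nat set set"
  assumes "simplicial_complex n \<Delta>" and "complex_dim \<Delta> = int d - 1"
  shows "almost_Cohen_Macaulay k n \<Delta> \<longleftrightarrow>
    (\<forall>F \<in> \<Delta> - pure_skeleton \<Delta> (int d - 1). \<forall>i::int.
       i < complex_dim (link \<Delta> F) \<longrightarrow> trivial_group (reduced_homology k i (link \<Delta> F))) \<and>
    (\<forall>F \<in> pure_skeleton \<Delta> (int d - 1). \<forall>i::int.
       i < complex_dim (link \<Delta> F) - 1 \<longrightarrow> trivial_group (reduced_homology k i (link \<Delta> F)))"
proof -
  interpret stanley_reisner k n \<Delta> by unfold_locales (rule assms(1))
  have V: "\<Union>\<Delta> \<subseteq> {1..n}" using assms(1) unfolding simplicial_complex_def by blast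
  have "almost_Cohen_Macaulay k n \<Delta> \<longleftrightarrow>
      d - 1 = 0 \<or> (\<exists>xs. set xs \<subseteq> SR_max_ideal k n \<Delta> \<and> regular_sequence S xs \<and> d - 1 \<le> length xs)"
    unfolding almost_Cohen_Macaulay_def krull_dim_SR_ring[OF assms(2)] depth_def enat_le_SUP_length_plus_one
    by (simp add: conj_assoc)
  \<comment> \<open>For \<open>d - 1 = 0\<close> the right-hand side is vacuous.\<close>
  also have "\<dots> \<longleftrightarrow> (\<forall>c<d - 1. koszul_zero (Var k) {1..n} J c)"
    unfolding regular_sequence_exists_iff by auto
  also have "\<dots> \<longleftrightarrow> (\<forall>F\<in>\<Delta>. \<forall>c. c + card F < d - 1 \<longrightarrow> coh_zero k (link \<Delta> F) c)"
    by (rule koszul_zero_iff_links[OF is_complex_Delta V]) simp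
  finally show ?thesis unfolding homology_conditions_iff[OF assms] .
qed

end
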